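(* Let $X=\{X(t),t\in T\}$ be a centered Gaussian process, $d(s,t)=\|X(s)-X(t)\|_2$, $D=\mathrm{diam}(T,d)$; assume that $\sigma=\sup_{t\in T}\|X(t)\|_2<\infty$ and that $X$ is $d$-separable. Let $\Pi_0\preceq\Pi_1\preceq\cdots$ be a sequence of finite measurable ordered partitions of $T$ ($\Pi_{n+1}$ being a refinement of $\Pi_n$) such that $$\max_{\pi\in\Pi_n}\max_{u,v\in\pi}d(u,v)\le2^{-n}D,\qquad n=0,1,\ldots,$$ and let $N_n=\#\{\Pi_n\}$. For $t\in T$ let $\pi_n(t)$ be defined by $t\in\pi_n(t)\in\Pi_n$. Assume that there exists a probability measure $\mu$ on $T$ such that $$\lim_{n\to\infty}\sup_{t\in T}\sum_{m>n}2^{-m}\Big(\log\frac1{\mu(\pi_m(t))}\Big)^{1/2}=0 .$$ Let $v(m)>0$ be such that $\sum_{m=0}^\infty v(m)^{-1}<\infty$ and put $$H(n)=\sup_{t\in T}\sum_{m>n}(2^{-m}D)\Big(\log\frac{v(m)}{\mu(\pi_m(t))}\Big)^{1/2}.$$ For $0<\varepsilon\sigma<H(0)$, let $n(\varepsilon)$ be such that $H(n(\varepsilon))\le\varepsilon\sigma$. Then, for some constant $C>0$ not depending on $\varepsilon$, $$\mathbb{P}\Big\{\sup_{t\in T}|X(t)|\le2\varepsilon\sigma\Big\}\ge C\,e^{-N_{n(\varepsilon)}\log\frac1\varepsilon}.$$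
   Context: $\|\cdot\|_2$ is the $L^2(\mathbb{P})$-norm on the underlying probability space.
   Formalization: It is additionally assumed that n(ε) stays bounded over those ε > 1 with εσ < H(0); without this an arbitrary choice of n(ε) for ε slightly above 1 makes the right-hand side unbounded, so the literal claim fails. *)

theory Defs
  imports "HOL-Probability.Probability"
begin

text \<open>Gaussian laws may be degenerate: standard deviation \<open>0\<close> means a point mass.\<close>

definition gaussian_rv :: "'w measure \<Rightarrow> ('w \<Rightarrow> real) \<Rightarrow> bool" where
  "gaussian_rv M Y \<longleftrightarrow> Y \<in> borel_measurable M \<and>
     (\<exists>m s. 0 \<le> s \<and>
        distr M borel Y =
          (if s = 0 then return borel m else density lborel (normal_density m s)))"

definition gaussian_process :: "'w measure \<Rightarrow> 't set \<Rightarrow> ('t \<Rightarrow> 'w \<Rightarrow> real) \<Rightarrow> bool" where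
  "gaussian_process M T X \<longleftrightarrow>
     (\<forall>F c. finite F \<and> F \<subseteq> T \<longrightarrow> gaussian_rv M (\<lambda>\<omega>. \<Sum>t\<in>F. c t * X t \<omega>))"

definition centered_gaussian_process :: "'w measure \<Rightarrow> 't set \<Rightarrow> ('t \<Rightarrow> 'w \<Rightarrow> real) \<Rightarrow> bool" where
  "centered_gaussian_process M T X \<longleftrightarrow>
     gaussian_process M T X \<and> (\<forall>t\<in>T. integral\<^sup>L M (X t) = 0)"

definition L2norm :: "'w measure \<Rightarrow> ('w \<Rightarrow> real) \<Rightarrow> real" where
  "L2norm M Y = sqrt (LINT \<omega>|M. (Y \<omega>)\<^sup>2)"

definition proc_dist :: "'w measure \<Rightarrow> ('t \<Rightarrow> 'w \<Rightarrow> real) \<Rightarrow> 't \<Rightarrow> 't \<Rightarrow> real" where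
  "proc_dist M X s t = L2norm M (\<lambda>\<omega>. X s \<omega> - X t \<omega>)"

definition proc_diam :: "'w measure \<Rightarrow> 't set \<Rightarrow> ('t \<Rightarrow> 'w \<Rightarrow> real) \<Rightarrow> real" where
  "proc_diam M T X = (SUP (s, t)\<in>T \<times> T. proc_dist M X s t)"

definition proc_sigma :: "'w measure \<Rightarrow> 't set \<Rightarrow> ('t \<Rightarrow> 'w \<Rightarrow> real) \<Rightarrow> real" where
  "proc_sigma M T X = (SUP t\<in>T. L2norm M (X t))"

text \<open>Separability in the sense of Doob, for the topology of the pseudo-metric of the process:
  outside one null set, every value of the path at \<open>t\<close> is a limit of values at points of a
  fixed countable set tending to \<open>t\<close>.\<close>

definition d_separable :: "'w measure \<Rightarrow> 't set \<Rightarrow> ('t \<Rightarrow> 'w \<Rightarrow> real) \<Rightarrow> bool" where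
  "d_separable M T X \<longleftrightarrow>
     (\<exists>S N. countable S \<and> S \<subseteq> T \<and> N \<in> null_sets M \<and>
        (\<forall>\<omega>\<in>space M - N. \<forall>t\<in>T. \<forall>\<delta>>0.
           X t \<omega> \<in> closure {X s \<omega> | s. s \<in> S \<and> proc_dist M X s t < \<delta>}))"

definition part_at :: "'t set set \<Rightarrow> 't \<Rightarrow> 't set" where
  "part_at P t = (THE A. A \<in> P \<and> t \<in> A)"

text \<open>\<open>(log (c / p))\<^sup>1\<^sup>/\<^sup>2\<close> for \<open>c > 0\<close> and \<open>p \<ge> 0\<close>, with value \<open>\<infinity>\<close> at \<open>p = 0\<close> (where \<open>ln (c / p)\<close> would be
  \<open>ln 0 = 0\<close>). Where \<open>c < p\<close> the logarithm is negative and \<open>ennreal\<close> truncates its square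
  root to \<open>0\<close>.\<close>

definition sqrt_log :: "real \<Rightarrow> real \<Rightarrow> ennreal" where
  "sqrt_log c p = (if p = 0 then \<infinity> else ennreal (sqrt (ln (c / p))))"

text \<open>The supremum over \<open>t \<in> T\<close> of the sums over \<open>m > n\<close> of
  \<open>2\<^sup>-\<^sup>m a (log (v m / \<mu> (\<pi>\<^sub>m t)))\<^sup>1\<^sup>/\<^sup>2\<close>, the index being \<open>m = n + 1 + k\<close>; it may be infinite.
  The function \<open>H\<close> is the case where \<open>a\<close> is the diameter, and the majorizing measure condition
  is about the case \<open>a = 1\<close>, \<open>v = 1\<close>.\<close>

definition chain_tail ::
  "'t set \<Rightarrow> (nat \<Rightarrow> 't set set) \<Rightarrow> 't measure \<Rightarrow> real \<Rightarrow> (nat \<Rightarrow> real) \<Rightarrow> nat \<Rightarrow> ennreal" where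
  "chain_tail T \<P> \<mu> a v n =
     (SUP t\<in>T. \<Sum>k. let m = n + 1 + k in
        ennreal ((1 / 2) ^ m * a) * sqrt_log (v m) (measure \<mu> (part_at (\<P> m) t)))"

end

theory Submission
  imports Defs
begin

text \<open>
  A lower bound for small balls follows from Sidak's inequality as soon as the event
  \<open>sup \<bar>X\<bar> \<le> 2 \<epsilon> \<sigma>\<close> contains an intersection of symmetric slabs: it is at least the product of the
  probabilities of the slabs. The slabs come from a chaining argument on finite subsets of \<open>T\<close>.

  Chaining through points of the cells would cost \<open>2 \<surd>2 H(n)\<close>, which exceeds the available
  \<open>2 \<epsilon> \<sigma>\<close>. Instead every cell of level \<open>m\<close> gets a centre in the linear span of the process. As in
  Jung's theorem it can be chosen within \<open>R\<^sub>m = 2\<^sup>-\<^sup>m D / \<surd>2\<close> of all points of the cell, and at the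
  same time within \<open>\<surd>(R\<^sub>m\<^sub>-\<^sub>1\<^sup>2 - R\<^sub>m\<^sup>2) = \<surd>(3/2) 2\<^sup>-\<^sup>m D\<close> of the centre of the parent cell. The links above level
  \<open>n\<close> then cost only \<open>\<surd>3 H(n) \<le> 7/4 \<epsilon> \<sigma>\<close>, and they hold with a probability bounded below, because
  the failure probabilities sum to at most a multiple of \<open>\<Sum> 1 / v m\<close>.

  The remaining \<open>\<epsilon> \<sigma> / 4\<close> is spent on the cells of level \<open>n = n(\<epsilon>)\<close>, each of which may cost a
  factor \<open>\<epsilon>\<close> but no worse. Fix a level \<open>k\<close> with \<open>2\<^sup>-\<^sup>k D\<close> small compared to \<open>\<sigma>\<close>. One subcell of each
  cell of level \<open>k\<close> has its centre bounded directly, at the cost of a factor \<open>\<kappa> \<epsilon>\<close>; the other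
  centres are linked to it, and because these links are short they cost at most \<open>\<epsilon>\<close> each. So the
  loss of \<open>\<kappa>\<close> occurs at most \<open>N\<^sub>k\<close> times, independently of \<open>\<epsilon>\<close>.
\<close>

text \<open>Joint distributions are handled through characteristic functions of linear combinations:
  finite-dimensional uniqueness is built from Levy's one-dimensional theorem, and conditioning on a
  coordinate becomes regression plus an independent copy on a product space. Peeling off one
  coordinate at a time, log-concavity rests on the Prekopa-Leindler inequality on the line.

  The numbers: a centred normal variable of standard deviation s exceeds s * sqrt (2 log (1/p)) in
  absolute value with probability at most 2p. Points of a parent cell may be 2 * 2^-m D apart,
  whence 2 sqrt 2; between centres sqrt (3/2) replaces the 2, whence sqrt 3 < 7/4. The remaining
  quarter is three times 1/12: one part for a designated centre, one for the link to it, one for the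
  last step from a very fine centre to the point itself. The choice p = \<mu>(cell) / v(m) makes the
  failure probabilities of level m add up to at most 2 / v(m), however many cells there are.\<close>

section \<open>Minimax points of finite sets\<close>

text \<open>Weights are pinned to 0 outside \<open>I\<close>, so that the simplex is a closed subset
  of a product of compact intervals and Tychonoff's theorem applies over an arbitrary index
  type.\<close>

lemma compact_standard_simplex:
  fixes I :: "'i set"
  assumes "finite I"
  shows "compact {l :: 'i \<Rightarrow> real. (\<forall>i\<in>I. 0 \<le> l i) \<and> (\<forall>i. i \<notin> I \<longrightarrow> l i = 0) \<and> sum l I = 1}"
    (is "compact ?S")
proof -
  let ?B = "PiE UNIV (\<lambda>i. if i \<in> I then {0..1} else {0 :: real})"
  have "compactin (product_topology (\<lambda>i. euclidean) UNIV) ?B"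
    by (subst compactin_PiE) auto
  then have cB: "compact ?B"
    by (simp add: euclidean_product_topology flip: compactin_euclidean_iff)
  have clS: "closed ?S"
  proof -
    have "?S = (\<Inter>i\<in>I. {l. 0 \<le> l i}) \<inter> (\<Inter>i\<in>-I. {l. l i = 0}) \<inter> {l. sum l I = 1}"
      by auto
    also have "closed \<dots>"
      by (intro closed_Int closed_INT ballI closed_Collect_le closed_Collect_eq continuous_on_sum
           continuous_on_const continuous_on_product_coordinates)
    finally show ?thesis .
  qed
  have sub: "?S \<subseteq> ?B"
  proof
    fix l assume l: "l \<in> ?S"
    have "l i \<le> 1" if "i \<in> I" for i
      using member_le_sum[of i I l] l that assms by auto
    with l show "l \<in> ?B" by auto
  qed
  show ?thesis
    using compact_Int_closed[OF cB clS] unfolding Int_absorb1[OF sub] .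
qed

text \<open>\<open>B\<close> is the Gram matrix of points with weighted barycentre \<open>c\<close>: the conclusion says that \<open>c\<close> is at
  squared distance at most \<open>\<rho> i\<close> from the \<open>i\<close>-th point, and the hypothesis that for any weights the
  mean of \<open>\<rho>\<close> dominates the variance. The minimax point is read off the first-order conditions
  at the weights for which the difference of the two is smallest.\<close>
lemma gram_ball_intersection:
  fixes B :: "'i \<Rightarrow> 'i \<Rightarrow> real" and \<rho> :: "'i \<Rightarrow> real"
  assumes fin: "finite I" and ne: "I \<noteq> {}"
    and sym: "\<And>i j. B i j = B j i"
    and var: "\<And>l. (\<And>i. i \<in> I \<Longrightarrow> 0 \<le> l i) \<Longrightarrow> sum l I = 1 \<Longrightarrow>
      (\<Sum>i\<in>I. l i * B i i) - (\<Sum>i\<in>I. \<Sum>j\<in>I. l i * l j * B i j) \<le> (\<Sum>i\<in>I. l i * \<rho> i)"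
  obtains l where "\<And>i. i \<in> I \<Longrightarrow> 0 \<le> l i" "sum l I = 1"
    "\<And>i. i \<in> I \<Longrightarrow>
      B i i - 2 * (\<Sum>j\<in>I. l j * B i j) + (\<Sum>j\<in>I. \<Sum>k\<in>I. l j * l k * B j k) \<le> \<rho> i"
proof -
  define S where "S = {l :: 'i \<Rightarrow> real. (\<forall>i\<in>I. 0 \<le> l i) \<and> (\<forall>i. i \<notin> I \<longrightarrow> l i = 0) \<and> sum l I = 1}"
  define Q where "Q l = (\<Sum>i\<in>I. \<Sum>j\<in>I. l i * l j * B i j)" for l
  define V where "V l = (\<Sum>i\<in>I. l i * (B i i - \<rho> i)) - Q l" for l
  obtain i0 where i0: "i0 \<in> I" using ne by auto
  have "(\<lambda>i. if i = i0 then 1 else 0) \<in> S" using i0 fin by (auto simp: S_def)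
  then have "S \<noteq> {}" by blast
  moreover have "continuous_on S V"
    unfolding V_def Q_def
    by (intro continuous_on_diff continuous_on_sum continuous_on_mult continuous_on_const
        continuous_on_subset[OF continuous_on_product_coordinates subset_UNIV])
  ultimately obtain l where l: "l \<in> S" and max: "\<And>l'. l' \<in> S \<Longrightarrow> V l' \<le> V l"
    using continuous_attains_sup[OF compact_standard_simplex[OF fin, folded S_def]] by blast
  have V0: "V l \<le> 0"
    using var[of l] l by (auto simp: S_def V_def Q_def right_diff_distrib sum_subtractf)
  have "B i i - 2 * (\<Sum>j\<in>I. l j * B i j) + Q l \<le> \<rho> i" if i: "i \<in> I" for i
  proof -
    define P where "P = (\<Sum>j\<in>I. l j * B i j)"
    define \<delta> where "\<delta> = B i i - 2 * P + Q l"
    \<comment> \<open>Moving a fraction \<open>s\<close> of the weight to the vertex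
      \<open>i\<close> changes \<open>V\<close> by \<open>s * (\<delta> - \<rho> i - V l)\<close>
      minus a term of second order, and maximality makes the change nonpositive. Small
      \<open>s\<close> then gives \<open>\<delta> \<le> \<rho> i + V l\<close>, and
      \<open>V l\<close> is at most 0 by the hypothesis on the variance.\<close>
    have step: "s * (\<delta> - \<rho> i - V l) \<le> s\<^sup>2 * \<delta>" if s: "0 < s" "s < 1" for s
    proof -
      define l' where "l' = (\<lambda>j. (1 - s) * l j + s * (if j = i then 1 else 0))"
      have "l' \<in> S"
        using l i s fin by (auto simp: S_def l'_def sum.distrib sum_distrib_left[symmetric])
      then have le: "V l' \<le> V l" by (rule max)
      have lin: "(\<Sum>j\<in>I. l' j * f j) = (1 - s) * (\<Sum>j\<in>I. l j * f j) + s * f i" for f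
      proof -
        have "(\<Sum>j\<in>I. l' j * f j) = (\<Sum>j\<in>I. (1 - s) * (l j * f j) + (if j = i then s * f j else 0))"
          by (intro sum.cong) (auto simp: l'_def algebra_simps)
        then show ?thesis using i fin by (simp add: sum.distrib sum_distrib_left)
      qed
      have Qeq: "Q m = (\<Sum>j\<in>I. m j * (\<Sum>k\<in>I. m k * B j k))" for m
        by (simp add: Q_def sum_distrib_left mult.assoc)
      have "Q l' = (1 - s)\<^sup>2 * Q l + 2 * s * (1 - s) * P + s\<^sup>2 * B i i"
      proof -
        have "(\<Sum>j\<in>I. l j * B j i) = P" unfolding P_def using sym by (metis (no_types))
        moreover have "Q l' = (1 - s) * (\<Sum>j\<in>I. l j * ((1 - s) * (\<Sum>k\<in>I. l k * B j k) + s * B j i))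
             + s * ((1 - s) * P + s * B i i)"
          unfolding Qeq lin P_def ..
        moreover have "(\<Sum>j\<in>I. l j * ((1 - s) * (\<Sum>k\<in>I. l k * B j k) + s * B j i))
            = (1 - s) * Q l + s * (\<Sum>j\<in>I. l j * B j i)"
          unfolding Qeq[of l] by (simp add: distrib_left sum.distrib sum_distrib_left algebra_simps)
        ultimately have "Q l' = (1 - s) * ((1 - s) * Q l + s * P) + s * ((1 - s) * P + s * B i i)"
          by simp
        then show ?thesis by (simp add: algebra_simps power2_eq_square)
      qed
      then have "V l' = V l + s * (\<delta> - \<rho> i - V l) - s\<^sup>2 * \<delta>"
        unfolding V_def lin \<delta>_def by (simp add: algebra_simps power2_eq_square)
      with le show ?thesis by simp
    qed
    have "\<delta> - \<rho> i - V l \<le> 0"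
    proof (rule ccontr)
      assume "\<not> \<delta> - \<rho> i - V l \<le> 0"
      then have g: "\<delta> - \<rho> i - V l > 0" (is "?g > 0") by simp
      \<comment> \<open>The second entry keeps s times the absolute value of \<open>\<delta>\<close>
        within half of the supposed gap, which contradicts \<open>step\<close>.\<close>
      define s where "s = min (1/2) (?g / (2 * (\<bar>\<delta>\<bar> + 1)))"
      have s: "0 < s" "s < 1" using g by (auto simp: s_def)
      have "?g \<le> s * \<delta>" using step[OF s] s by (simp add: power2_eq_square)
      also have "\<dots> \<le> s * (\<bar>\<delta>\<bar> + 1)" using s by (intro mult_left_mono) auto
      also have "\<dots> \<le> ?g / (2 * (\<bar>\<delta>\<bar> + 1)) * (\<bar>\<delta>\<bar> + 1)"
        by (intro mult_right_mono) (auto simp: s_def)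
      also have "\<dots> = ?g / 2" by (simp add: field_simps)
      finally show False using g by simp
    qed
    with V0 show ?thesis unfolding \<delta>_def P_def by simp
  qed
  with l show thesis by (intro that[of l]) (auto simp: S_def Q_def)
qed

section \<open>The Prekopa--Leindler inequality on the line\<close>

lemma emeasure_bounded_interval_le:
  fixes F :: "real set"
  assumes "F \<noteq> {}" "bounded F" "F \<in> sets borel"
  shows "emeasure lborel F \<le> ennreal (Sup F - Inf F)"
proof -
  have "bdd_above F" "bdd_below F" using assms(2) by (auto intro: bounded_imp_bdd_above bounded_imp_bdd_below)
  then have "F \<subseteq> {Inf F..Sup F}" by (auto intro: cInf_lower cSup_upper)
  then have "emeasure lborel F \<le> emeasure lborel {Inf F..Sup F}"
    by (intro emeasure_mono) auto
  also have "\<dots> = ennreal (Sup F - Inf F)"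
    using cInf_le_cSup[OF assms(1) \<open>bdd_above F\<close> \<open>bdd_below F\<close>] by simp
  finally show ?thesis .
qed

text \<open>The one-dimensional Brunn-Minkowski inequality. Convexity makes \<open>K\<close> an
  interval, so it is enough that combinations of points of \<open>F\<close> and \<open>G\<close>
  come arbitrarily close to both ends \<open>a\<close> and \<open>b\<close>: everything strictly
  between then lies in \<open>K\<close>.\<close>

lemma brunn_minkowski_interval:
  fixes F G K :: "real set"
  assumes F: "F \<noteq> {}" "bounded F" "F \<in> sets borel"
    and G: "G \<noteq> {}" "bounded G" "G \<in> sets borel"
    and K: "convex K" "K \<in> sets borel"
    and \<theta>: "0 < \<theta>" "\<theta> < 1"
    and FGK: "\<And>x y. x \<in> F \<Longrightarrow> y \<in> G \<Longrightarrow> (1 - \<theta>) * x + \<theta> * y \<in> K"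
  shows "ennreal (1 - \<theta>) * emeasure lborel F + ennreal \<theta> * emeasure lborel G \<le> emeasure lborel K"
proof -
  have bF: "bdd_above F" "bdd_below F" and bG: "bdd_above G" "bdd_below G"
    using F G by (auto intro: bounded_imp_bdd_above bounded_imp_bdd_below)
  have lF: "Inf F \<le> Sup F" and lG: "Inf G \<le> Sup G"
    by (rule cInf_le_cSup[OF F(1) bF] cInf_le_cSup[OF G(1) bG])+
  define a b where "a = (1 - \<theta>) * Inf F + \<theta> * Inf G" and "b = (1 - \<theta>) * Sup F + \<theta> * Sup G"
  have "{a<..<b} \<subseteq> K"
  proof
    fix z assume z: "z \<in> {a<..<b}"
    define e where "e = min (z - a) (b - z)"
    have e: "e > 0" using z by (auto simp: e_def)
    obtain x1 where x1: "x1 \<in> F" "x1 < Inf F + e" using cInf_lessD[OF F(1), of "Inf F + e"] e by auto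
    obtain x2 where x2: "x2 \<in> F" "Sup F - e < x2" using less_cSupD[OF F(1), of "Sup F - e"] e by auto
    obtain y1 where y1: "y1 \<in> G" "y1 < Inf G + e" using cInf_lessD[OF G(1), of "Inf G + e"] e by auto
    obtain y2 where y2: "y2 \<in> G" "Sup G - e < y2" using less_cSupD[OF G(1), of "Sup G - e"] e by auto
    have "(1 - \<theta>) * x1 + \<theta> * y1 \<le> (1 - \<theta>) * (Inf F + e) + \<theta> * (Inf G + e)"
      using \<theta> x1 y1 by (intro add_mono mult_left_mono) auto
    also have "\<dots> = a + e" by (simp add: a_def algebra_simps)
    finally have 1: "(1 - \<theta>) * x1 + \<theta> * y1 \<le> z" by (auto simp: e_def)
    have "b - e = (1 - \<theta>) * (Sup F - e) + \<theta> * (Sup G - e)" by (simp add: b_def algebra_simps)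
    also have "\<dots> \<le> (1 - \<theta>) * x2 + \<theta> * y2"
      using \<theta> x2 y2 by (intro add_mono mult_left_mono) auto
    finally have 2: "z \<le> (1 - \<theta>) * x2 + \<theta> * y2" by (auto simp: e_def)
    have "is_interval K" using K(1) by (simp add: is_interval_convex_1)
    then show "z \<in> K"
      using 1 2 FGK[OF x1(1) y1(1)] FGK[OF x2(1) y2(1)] by (rule_tac mem_is_interval_1_I)
  qed
  then have le: "emeasure lborel {a<..<b} \<le> emeasure lborel K" using K by (intro emeasure_mono) auto
  have ab: "b - a = (1 - \<theta>) * (Sup F - Inf F) + \<theta> * (Sup G - Inf G)"
    by (simp add: a_def b_def algebra_simps)
  have "0 \<le> (1 - \<theta>) * (Sup F - Inf F)" "0 \<le> \<theta> * (Sup G - Inf G)"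
    using lF lG \<theta> by simp_all
  with ab have "a \<le> b" by linarith
  have "ennreal (1 - \<theta>) * emeasure lborel F + ennreal \<theta> * emeasure lborel G
      \<le> ennreal (1 - \<theta>) * ennreal (Sup F - Inf F) + ennreal \<theta> * ennreal (Sup G - Inf G)"
    using emeasure_bounded_interval_le F G by (intro add_mono mult_left_mono) auto
  also have "\<dots> = ennreal (b - a)"
    unfolding ab using \<theta> lF lG by (simp add: ennreal_mult ennreal_plus)
  also have "\<dots> = emeasure lborel {a<..<b}" using \<open>a \<le> b\<close> by simp
  finally show ?thesis using le by simp
qed

text \<open>Only positive levels are integrated, which matches the truncation of negative values by
  \<open>ennreal\<close>; so \<open>f\<close> may take either sign.\<close>

lemma nn_integral_layer_cake:
  fixes f :: "real \<Rightarrow> real"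
  assumes [measurable]: "f \<in> borel_measurable borel"
  shows "(\<integral>\<^sup>+x. ennreal (f x) \<partial>lborel) = (\<integral>\<^sup>+t\<in>{0<..}. emeasure lborel {x. t < f x} \<partial>lborel)"
proof -
  have "(\<integral>\<^sup>+x. ennreal (f x) \<partial>lborel) = (\<integral>\<^sup>+x. (\<integral>\<^sup>+t. indicator {0<..} t * indicator {(x, t). t < f x} (x, t) \<partial>lborel) \<partial>lborel)"
  proof (intro nn_integral_cong)
    fix x
    have "(\<integral>\<^sup>+t. indicator {0<..} t * indicator {(x, t). t < f x} (x, t) \<partial>lborel)
        = (\<integral>\<^sup>+t. indicator {0<..<f x} t \<partial>lborel)"
      by (intro nn_integral_cong) (auto simp: indicator_def)
    also have "\<dots> = ennreal (f x)"
      by (cases "0 \<le> f x") (auto simp: ennreal_neg)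
    finally show "ennreal (f x) = (\<integral>\<^sup>+t. indicator {0<..} t * indicator {(x, t). t < f x} (x, t) \<partial>lborel)" ..
  qed
  also have "\<dots> = (\<integral>\<^sup>+t. (\<integral>\<^sup>+x. indicator {0<..} t * indicator {(x, t). t < f x} (x, t) \<partial>lborel) \<partial>lborel)"
    by (rule lborel_pair.Fubini'[symmetric]) measurable
  also have "\<dots> = (\<integral>\<^sup>+t\<in>{0<..}. emeasure lborel {x. t < f x} \<partial>lborel)"
  proof (intro nn_integral_cong)
    fix t :: real
    have "(\<integral>\<^sup>+x. indicator {0<..} t * indicator {(x, t). t < f x} (x, t) \<partial>lborel)
      = indicator {0<..} t * (\<integral>\<^sup>+x. indicator {x. t < f x} x \<partial>lborel)"
      by (subst nn_integral_cmult[symmetric]) (auto intro!: nn_integral_cong simp: indicator_def)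
    also have "(\<integral>\<^sup>+x. indicator {x. t < f x} x \<partial>lborel) = emeasure lborel {x. t < f x}"
      by (subst nn_integral_indicator) auto
    finally show "(\<integral>\<^sup>+x. indicator {0<..} t * indicator {(x, t). t < f x} (x, t) \<partial>lborel)
        = emeasure lborel {x. t < f x} * indicator {0<..} t"
      by (simp add: mult.commute)
  qed
  finally show ?thesis .
qed

lemma weighted_am_gm:
  fixes a b \<theta> :: real
  assumes "0 < \<theta>" "\<theta> < 1" "0 \<le> a" "0 \<le> b"
  shows "a powr (1 - \<theta>) * b powr \<theta> \<le> (1 - \<theta>) * a + \<theta> * b"
proof (cases "a = 0 \<or> b = 0")
  case True then show ?thesis using assms by auto
next
  case False
  then have ab: "0 < a" "0 < b" using assms by auto
  have "exp ((1 - \<theta>) *\<^sub>R ln a + \<theta> *\<^sub>R ln b) \<le> (1 - \<theta>) * exp (ln a) + \<theta> * exp (ln b)"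
    using assms convex_onD[OF exp_convex, of \<theta> "ln a" "ln b"] by simp
  then show ?thesis using ab by (simp add: powr_def exp_add)
qed

text \<open>Both functions have supremum 1, so every level below 1 is exceeded by both and the
  Brunn-Minkowski inequality applies level by level; at the other levels the left side vanishes.
  Integration over the levels yields an arithmetic mean on the left, stronger than the geometric
  mean wanted in the end.\<close>

lemma prekopa_leindler_normalised:
  fixes f g h :: "real \<Rightarrow> real"
  assumes [measurable]: "f \<in> borel_measurable borel" "g \<in> borel_measurable borel" "h \<in> borel_measurable borel"
    and \<theta>: "0 < \<theta>" "\<theta> < 1"
    and bf: "\<And>t. 0 < t \<Longrightarrow> bounded {x. t < f x}" and bg: "\<And>t. 0 < t \<Longrightarrow> bounded {x. t < g x}"
    and f1: "\<And>x. f x \<le> 1" and g1: "\<And>x. g x \<le> 1"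
    and fs: "\<And>t. t < 1 \<Longrightarrow> \<exists>x. t < f x" and gs: "\<And>t. t < 1 \<Longrightarrow> \<exists>x. t < g x"
    and ch: "\<And>t. 0 < t \<Longrightarrow> convex {x. t < h x}"
    and fgh: "\<And>x y t. 0 < t \<Longrightarrow> t < f x \<Longrightarrow> t < g y \<Longrightarrow> t < h ((1 - \<theta>) * x + \<theta> * y)"
  shows "ennreal (1 - \<theta>) * (\<integral>\<^sup>+x. f x \<partial>lborel) + ennreal \<theta> * (\<integral>\<^sup>+x. g x \<partial>lborel) \<le> (\<integral>\<^sup>+x. h x \<partial>lborel)"
proof -
  have [measurable]: "(\<lambda>t. emeasure lborel {x. t < k x}) \<in> borel_measurable borel"
    if [measurable]: "k \<in> borel_measurable borel" for k :: "real \<Rightarrow> real"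
  proof -
    have "(\<lambda>t. \<integral>\<^sup>+x. indicator {(t, x). t < k x} (t, x) \<partial>lborel) \<in> borel_measurable borel"
      by measurable
    also have "(\<lambda>t. \<integral>\<^sup>+x. indicator {(t, x). t < k x} (t, x) \<partial>lborel) = (\<lambda>t. emeasure lborel {x. t < k x})"
    proof
      fix t
      have "(\<integral>\<^sup>+x. indicator {(t, x). t < k x} (t, x) \<partial>lborel) = (\<integral>\<^sup>+x. indicator {x. t < k x} x \<partial>lborel)"
        by (intro nn_integral_cong) (auto simp: indicator_def)
      then show "(\<integral>\<^sup>+x. indicator {(t, x). t < k x} (t, x) \<partial>lborel) = emeasure lborel {x. t < k x}"
        by (subst (asm) nn_integral_indicator) auto
    qed
    finally show ?thesis .
  qed
  have "ennreal (1 - \<theta>) * (\<integral>\<^sup>+x. f x \<partial>lborel) + ennreal \<theta> * (\<integral>\<^sup>+x. g x \<partial>lborel)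
     = (\<integral>\<^sup>+t\<in>{0<..}. (ennreal (1 - \<theta>) * emeasure lborel {x. t < f x} + ennreal \<theta> * emeasure lborel {x. t < g x}) \<partial>lborel)"
    unfolding nn_integral_layer_cake[OF assms(1)] nn_integral_layer_cake[OF assms(2)]
    by (subst (1 2) nn_integral_cmult[symmetric], simp, simp, subst nn_integral_add[symmetric])
       (auto intro!: nn_integral_cong simp: algebra_simps)
  also have "\<dots> \<le> (\<integral>\<^sup>+t\<in>{0<..}. emeasure lborel {x. t < h x} \<partial>lborel)"
  proof (intro nn_integral_mono)
    fix t :: real
    have "ennreal (1 - \<theta>) * emeasure lborel {x. t < f x} + ennreal \<theta> * emeasure lborel {x. t < g x}
        \<le> emeasure lborel {x. t < h x}" if "0 < t"
    proof (cases "t < 1")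
      case True
      show ?thesis
        using fs[OF True] gs[OF True] bf[OF \<open>0 < t\<close>] bg[OF \<open>0 < t\<close>] ch[OF \<open>0 < t\<close>] \<theta> fgh[OF \<open>0 < t\<close>]
        by (intro brunn_minkowski_interval) auto
    next
      case False
      have "\<not> t < f x" "\<not> t < g x" for x using False f1[of x] g1[of x] by linarith+
      then have e: "{x. t < f x} = {}" "{x. t < g x} = {}" by auto
      show ?thesis unfolding e by simp
    qed
    then show "(ennreal (1 - \<theta>) * emeasure lborel {x. t < f x} + ennreal \<theta> * emeasure lborel {x. t < g x}) * indicator {0<..} t
       \<le> emeasure lborel {x. t < h x} * indicator {0<..} t"
      by (auto simp: indicator_def)
  qed
  also have "\<dots> = (\<integral>\<^sup>+x. h x \<partial>lborel)" by (rule nn_integral_layer_cake[symmetric]) simp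
  finally show ?thesis .
qed

text \<open>Functions of different heights share no common range of levels with nonempty superlevel
  sets. Division by the suprema repairs this, and the scaling can be undone at the end because the
  conclusion is multiplicative.\<close>

lemma prekopa_leindler:
  fixes f g h :: "real \<Rightarrow> real"
  assumes [measurable]: "f \<in> borel_measurable borel" "g \<in> borel_measurable borel" "h \<in> borel_measurable borel"
    and int: "integrable lborel f" "integrable lborel g" "integrable lborel h"
    and nn: "\<And>x. 0 \<le> f x" "\<And>x. 0 \<le> g x" "\<And>x. 0 \<le> h x"
    and bdd: "bdd_above (range f)" "bdd_above (range g)"
    and supp: "bounded {x. f x \<noteq> 0}" "bounded {x. g x \<noteq> 0}"
    and ch: "\<And>t. convex {x. t < h x}"
    and \<theta>: "0 < \<theta>" "\<theta> < 1"
    and fgh: "\<And>x y. f x powr (1 - \<theta>) * g y powr \<theta> \<le> h ((1 - \<theta>) * x + \<theta> * y)"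
  shows "(\<integral>x. f x \<partial>lborel) powr (1 - \<theta>) * (\<integral>x. g x \<partial>lborel) powr \<theta> \<le> (\<integral>x. h x \<partial>lborel)"
proof (cases "(\<integral>x. f x \<partial>lborel) = 0 \<or> (\<integral>x. g x \<partial>lborel) = 0")
  case True
  then show ?thesis using \<theta> nn by (auto simp: integral_nonneg_AE)
next
  case False
  define a b where "a = Sup (range f)" and "b = Sup (range g)"
  have fa: "f x \<le> a" and gb: "g x \<le> b" for x
    using bdd by (auto simp: a_def b_def intro: cSup_upper)
  have "\<exists>x. f x \<noteq> 0"
    using False by (metis (mono_tags, lifting) Bochner_Integration.integral_cong integral_zero)
  moreover have "\<exists>x. g x \<noteq> 0"
    using False by (metis (mono_tags, lifting) Bochner_Integration.integral_cong integral_zero)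
  ultimately
  have a: "0 < a" and b: "0 < b"
    using nn fa gb by (metis less_eq_real_def order_le_less_trans)+
  \<comment> \<open>The scale of \<open>h\<close> that preserves the pointwise hypothesis when
    \<open>f\<close> is divided by \<open>a\<close> and \<open>g\<close> by
    \<open>b\<close>.\<close>
  define c where "c = a powr (1 - \<theta>) * b powr \<theta>"
  have c: "0 < c" using a b by (simp add: c_def)
  have main: "ennreal (1 - \<theta>) * (\<integral>\<^sup>+x. f x / a \<partial>lborel) + ennreal \<theta> * (\<integral>\<^sup>+x. g x / b \<partial>lborel) \<le> (\<integral>\<^sup>+x. h x / c \<partial>lborel)"
  proof (rule prekopa_leindler_normalised)
    fix t :: real
    assume t: "0 < t"
    show "bounded {x. t < f x / a}" "bounded {x. t < g x / b}"
      by (rule bounded_subset[OF supp(1)] bounded_subset[OF supp(2)]; use t in auto)+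
    have "{x. t < h x / c} = {x. t * c < h x}" using c by (auto simp: field_simps)
    then show "convex {x. t < h x / c}" using ch by simp
    fix x y assume fg: "t < f x / a" "t < g y / b"
    have ta: "0 < t * a" "0 < t * b" using t a b by simp_all
    have "t * c = (t * a) powr (1 - \<theta>) * (t * b) powr \<theta>"
      using t a b by (simp add: c_def powr_mult powr_add[symmetric] mult_ac)
    also have "\<dots> < f x powr (1 - \<theta>) * g y powr \<theta>"
      using fg ta a b \<theta> by (intro mult_strict_mono powr_less_mono2) (auto simp: pos_less_divide_eq)
    also have "\<dots> \<le> h ((1 - \<theta>) * x + \<theta> * y)" by (rule fgh)
    finally show "t < h ((1 - \<theta>) * x + \<theta> * y) / c" using c by (simp add: field_simps)
  next
    fix t :: real assume t: "t < 1"
    then have "t * a < a" "t * b < b" using a b by auto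
    then have "\<exists>y\<in>range f. t * a < y" "\<exists>y\<in>range g. t * b < y"
      unfolding a_def b_def by (metis UNIV_not_empty empty_is_image less_cSupD)+
    then show "\<exists>x. t < f x / a" "\<exists>x. t < g x / b" using a b by (auto simp: field_simps)
  qed (use fa gb a b \<theta> in auto)
  define F G where "F = (\<integral>x. f x / a \<partial>lborel)" and "G = (\<integral>x. g x / b \<partial>lborel)"
  have FG: "0 \<le> F" "0 \<le> G" using nn a b by (auto simp: F_def G_def intro!: integral_nonneg_AE)
  have "(\<integral>\<^sup>+x. f x / a \<partial>lborel) = ennreal F" "(\<integral>\<^sup>+x. g x / b \<partial>lborel) = ennreal G"
    "(\<integral>\<^sup>+x. h x / c \<partial>lborel) = ennreal (\<integral>x. h x / c \<partial>lborel)"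
    unfolding F_def G_def by (rule nn_integral_eq_integral; use int nn a b c in simp)+
  then have "ennreal ((1 - \<theta>) * F + \<theta> * G) \<le> ennreal (\<integral>x. h x / c \<partial>lborel)"
    using main \<theta> FG by (simp add: ennreal_mult ennreal_plus)
  then have "(1 - \<theta>) * F + \<theta> * G \<le> (\<integral>x. h x / c \<partial>lborel)"
    using nn c by (subst (asm) ennreal_le_iff) (auto intro!: integral_nonneg_AE)
  then have "F powr (1 - \<theta>) * G powr \<theta> \<le> (\<integral>x. h x \<partial>lborel) / c"
    using weighted_am_gm[OF \<theta> FG] by simp
  moreover have "(\<integral>x. f x \<partial>lborel) = a * F" "(\<integral>x. g x \<partial>lborel) = b * G"
    using a b by (simp_all add: F_def G_def)
  ultimately show ?thesis
    using a b c FG by (simp add: c_def powr_mult field_simps)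
qed

section \<open>The Cramer--Wold device\<close>

lemma distr_eq_of_char_eq:
  fixes Y :: "'a \<Rightarrow> real" and Y' :: "'b \<Rightarrow> real"
  assumes "prob_space M" "prob_space N"
    and [measurable]: "Y \<in> borel_measurable M" "Y' \<in> borel_measurable N"
    and "\<And>t. (CLINT x|M. iexp (t * Y x)) = (CLINT x|N. iexp (t * Y' x))"
  shows "distr M borel Y = distr N borel Y'"
proof (rule Levy_uniqueness)
  interpret M: prob_space M by fact
  interpret N: prob_space N by fact
  show "real_distribution (distr M borel Y)" "real_distribution (distr N borel Y')" by auto
  show "char (distr M borel Y) = char (distr N borel Y')"
    using assms(5) by (auto simp: char_def integral_distr)
qed

lemma cos_iexp_product:
  "complex_of_real (cos (z + \<theta>)) * iexp y
     = (iexp \<theta> * iexp (y + z) + iexp (- \<theta>) * iexp (y - z)) / 2"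
proof -
  have "complex_of_real (cos (z + \<theta>)) = (iexp (z + \<theta>) + iexp (- (z + \<theta>))) / 2"
    by (simp only: cos_of_real[symmetric] cos_exp_eq of_real_minus mult_minus_right)
  then show ?thesis by (simp add: exp_add[symmetric] algebra_simps add_divide_distrib)
qed

text \<open>Both measures are tilted by the density \<open>(2 + cos (Z + \<theta>)) / c\<close>. By
  Euler's formula the characteristic function of \<open>Y\<close> under the tilted measure involves
  only the joint one at the second arguments 0, 1 and -1, so one-dimensional Levy uniqueness
  identifies the tilted laws of \<open>Y\<close>. Subtracting the untilted part leaves the
  cosine.\<close>

lemma cos_weighted_eq_of_char_eq:
  fixes Y Z :: "'a \<Rightarrow> real" and Y' Z' :: "'b \<Rightarrow> real"
  assumes "prob_space M" "prob_space N"
    and [measurable]: "Y \<in> borel_measurable M" "Z \<in> borel_measurable M"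
      "Y' \<in> borel_measurable N" "Z' \<in> borel_measurable N"
    and char_eq: "\<And>s t. (CLINT x|M. iexp (s * Y x + t * Z x)) = (CLINT x|N. iexp (s * Y' x + t * Z' x))"
    and [measurable]: "A \<in> sets borel"
  shows "(\<integral>x. indicator A (Y x) * cos (Z x + \<theta>) \<partial>M) = (\<integral>x. indicator A (Y' x) * cos (Z' x + \<theta>) \<partial>N)"
proof -
  interpret M: prob_space M by fact
  interpret N: prob_space N by fact
  have eq_cos: "(CLINT x|M. complex_of_real (cos (Z x + \<theta>)) * iexp (s * Y x))
      = (CLINT x|N. complex_of_real (cos (Z' x + \<theta>)) * iexp (s * Y' x))" for s
  proof -
    have "(CLINT x|M. complex_of_real (cos (Z x + \<theta>)) * iexp (s * Y x))
        = (iexp \<theta> * (CLINT x|M. iexp (s * Y x + 1 * Z x)) + iexp (- \<theta>) * (CLINT x|M. iexp (s * Y x + (-1) * Z x))) / 2"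
      unfolding cos_iexp_product
      by (subst integral_divide_zero, subst Bochner_Integration.integral_add)
         (auto intro!: M.integrable_iexp integrable_mult_right simp del: of_real_add of_real_diff)
    also have "\<dots> = (iexp \<theta> * (CLINT x|N. iexp (s * Y' x + 1 * Z' x)) + iexp (- \<theta>) * (CLINT x|N. iexp (s * Y' x + (-1) * Z' x))) / 2"
      by (simp only: char_eq)
    also have "\<dots> = (CLINT x|N. complex_of_real (cos (Z' x + \<theta>)) * iexp (s * Y' x))"
      unfolding cos_iexp_product
      by (subst integral_divide_zero, subst Bochner_Integration.integral_add)
         (auto intro!: N.integrable_iexp integrable_mult_right simp del: of_real_add of_real_diff)
    finally show ?thesis .
  qed
  have eq1: "(CLINT x|M. iexp (s * Y x)) = (CLINT x|N. iexp (s * Y' x))" for s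
    using char_eq[of s 0] by simp
  have iM: "integrable M (\<lambda>x. cos (Z x + \<theta>))" and iN: "integrable N (\<lambda>x. cos (Z' x + \<theta>))"
    by (auto intro!: M.integrable_const_bound[of _ 1] N.integrable_const_bound[of _ 1])
  have "of_real (\<integral>x. cos (Z x + \<theta>) \<partial>M) = complex_of_real (\<integral>x. cos (Z' x + \<theta>) \<partial>N)"
    using eq_cos[of 0] by (simp flip: integral_complex_of_real)
  then have eq0: "(\<integral>x. cos (Z x + \<theta>) \<partial>M) = (\<integral>x. cos (Z' x + \<theta>) \<partial>N)"
    using of_real_eq_iff by blast
  \<comment> \<open>The constant 2 keeps the weight nonnegative and its integral \<open>c\<close> at
    least 1. By \<open>eq0\<close> the same \<open>c\<close> normalises on both sides.\<close>
  define c where "c = 2 + (\<integral>x. cos (Z x + \<theta>) \<partial>M)"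
  have "-1 \<le> (\<integral>x. cos (Z x + \<theta>) \<partial>M)"
    using M.integral_ge_const[OF iM, of "-1"] by simp
  then have c: "0 < c" by (simp add: c_def)
  define w where "w z = (2 + cos (z + \<theta>)) / c" for z :: real
  have w0: "0 \<le> w z" for z using c cos_ge_minus_one[of "z + \<theta>"] by (simp add: w_def del: cos_ge_minus_one)
  have [measurable]: "w \<in> borel_measurable borel" unfolding w_def by measurable
  define M' where "M' = density M (\<lambda>x. ennreal (w (Z x)))"
  define N' where "N' = density N (\<lambda>x. ennreal (w (Z' x)))"
  have wM: "integrable M (\<lambda>x. w (Z x))" "(\<integral>x. w (Z x) \<partial>M) = 1"
    using iM c by (auto simp: w_def c_def M.prob_space)
  have wN: "integrable N (\<lambda>x. w (Z' x))" "(\<integral>x. w (Z' x) \<partial>N) = 1"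
    using iN c eq0 by (auto simp: w_def c_def N.prob_space)
  have pM: "prob_space M'"
    using wM w0 by (intro prob_spaceI) (simp add: M'_def emeasure_density nn_integral_eq_integral cong: nn_integral_cong)
  have pN: "prob_space N'"
    using wN w0 by (intro prob_spaceI) (simp add: N'_def emeasure_density nn_integral_eq_integral cong: nn_integral_cong)
  have w_split: "w z *\<^sub>R iexp y = (2 * iexp y + complex_of_real (cos (z + \<theta>)) * iexp y) / of_real c" for z y
    by (simp add: w_def scaleR_conv_of_real field_simps)
  have iMc: "integrable M (\<lambda>x. complex_of_real (cos (Z x + \<theta>)) * iexp (s * Y x))" for s
    by (intro M.integrable_const_bound[of _ 1]) (auto simp: norm_mult)
  have iNc: "integrable N (\<lambda>x. complex_of_real (cos (Z' x + \<theta>)) * iexp (s * Y' x))" for s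
    by (intro N.integrable_const_bound[of _ 1]) (auto simp: norm_mult)
  have "distr M' borel Y = distr N' borel Y'"
  proof (rule distr_eq_of_char_eq[OF pM pN])
    show "Y \<in> borel_measurable M'" "Y' \<in> borel_measurable N'" by (simp_all add: M'_def N'_def)
    fix s
    have "(CLINT x|M'. iexp (s * Y x)) = (CLINT x|M. w (Z x) *\<^sub>R iexp (s * Y x))"
      unfolding M'_def using w0 by (subst integral_density) auto
    also have "\<dots> = (2 * (CLINT x|M. iexp (s * Y x)) + (CLINT x|M. complex_of_real (cos (Z x + \<theta>)) * iexp (s * Y x))) / of_real c"
      unfolding w_split using iMc[of s]
      by (subst integral_divide_zero, subst Bochner_Integration.integral_add)
         (auto intro!: M.integrable_iexp integrable_mult_right)
    also have "\<dots> = (2 * (CLINT x|N. iexp (s * Y' x)) + (CLINT x|N. complex_of_real (cos (Z' x + \<theta>)) * iexp (s * Y' x))) / of_real c"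
      by (simp only: eq1 eq_cos)
    also have "\<dots> = (CLINT x|N. w (Z' x) *\<^sub>R iexp (s * Y' x))"
      unfolding w_split using iNc[of s]
      by (subst integral_divide_zero, subst Bochner_Integration.integral_add)
         (auto intro!: N.integrable_iexp integrable_mult_right)
    also have "\<dots> = (CLINT x|N'. iexp (s * Y' x))"
      unfolding N'_def using w0 by (subst integral_density) auto
    finally show "(CLINT x|M'. iexp (s * Y x)) = (CLINT x|N'. iexp (s * Y' x))" .
  qed
  then have 1: "(\<integral>y. indicator A y \<partial>distr M' borel Y) = (\<integral>y. indicator A y \<partial>distr N' borel Y' :: real)"
    by simp
  have "(\<integral>y. indicator A y \<partial>distr M' borel Y) = (\<integral>x. w (Z x) * indicator A (Y x) \<partial>M)"
    unfolding M'_def using w0 by (subst integral_distr) (auto simp: integral_density)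
  moreover have "(\<integral>y. indicator A y \<partial>distr N' borel Y') = (\<integral>x. w (Z' x) * indicator A (Y' x) \<partial>N)"
    unfolding N'_def using w0 by (subst integral_distr) (auto simp: integral_density)
  moreover have "(\<integral>x. w (Z x) * indicator A (Y x) \<partial>M)
      = (2 * (\<integral>x. indicator A (Y x) \<partial>M) + (\<integral>x. indicator A (Y x) * cos (Z x + \<theta>) \<partial>M)) / c"
  proof -
    have "(\<lambda>x. w (Z x) * indicator A (Y x)) = (\<lambda>x. (2 * indicator A (Y x) + indicator A (Y x) * cos (Z x + \<theta>)) / c)"
      by (auto simp: w_def indicator_def)
    moreover have "integrable M (\<lambda>x. indicator A (Y x) * cos (Z x + \<theta>))" "integrable M (\<lambda>x. indicator A (Y x) :: real)"
      by (auto intro!: M.integrable_const_bound[of _ 1] simp: indicator_def)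
    ultimately show ?thesis by simp
  qed
  moreover have "(\<integral>x. w (Z' x) * indicator A (Y' x) \<partial>N)
      = (2 * (\<integral>x. indicator A (Y' x) \<partial>N) + (\<integral>x. indicator A (Y' x) * cos (Z' x + \<theta>) \<partial>N)) / c"
  proof -
    have "(\<lambda>x. w (Z' x) * indicator A (Y' x)) = (\<lambda>x. (2 * indicator A (Y' x) + indicator A (Y' x) * cos (Z' x + \<theta>)) / c)"
      by (auto simp: w_def indicator_def)
    moreover have "integrable N (\<lambda>x. indicator A (Y' x) * cos (Z' x + \<theta>))" "integrable N (\<lambda>x. indicator A (Y' x) :: real)"
      by (auto intro!: N.integrable_const_bound[of _ 1] simp: indicator_def)
    ultimately show ?thesis by simp
  qed
  moreover have "(\<integral>x. indicator A (Y x) \<partial>M) = (\<integral>x. indicator A (Y' x) \<partial>N :: real)"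
  proof -
    have "distr M borel Y = distr N borel Y'"
      using eq1 assms by (intro distr_eq_of_char_eq) auto
    then have "(\<integral>y. indicator A y \<partial>distr M borel Y) = (\<integral>y. indicator A y \<partial>distr N borel Y' :: real)" by simp
    then show ?thesis by (subst (asm) (1 2) integral_distr) auto
  qed
  ultimately show ?thesis using 1 c by simp
qed

text \<open>Sine is a shifted cosine, so cosine-weighted integrals with arbitrary phase determine a
  characteristic function.\<close>

lemma iexp_cos_shift: "iexp z = of_real (cos (z + 0)) + \<i> * of_real (cos (z + (- pi / 2)))"
  by (simp add: complex_eq_iff Re_exp Im_exp cos_diff)

text \<open>In the induction step the laws are conditioned on the value of one coordinate lying in its set,
  and the remaining coordinates still satisfy the hypothesis.\<close>
lemma cramer_wold:
  fixes V :: "'i \<Rightarrow> 'a \<Rightarrow> real" and V' :: "'i \<Rightarrow> 'b \<Rightarrow> real"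
  assumes "finite I" "prob_space M" "prob_space N"
    and "\<And>i. i \<in> I \<Longrightarrow> V i \<in> borel_measurable M" "\<And>i. i \<in> I \<Longrightarrow> V' i \<in> borel_measurable N"
    and "\<And>i. i \<in> I \<Longrightarrow> A i \<in> sets borel"
    and "\<And>u. (CLINT x|M. iexp (\<Sum>i\<in>I. u i * V i x)) = (CLINT x|N. iexp (\<Sum>i\<in>I. u i * V' i x))"
  shows "measure M {x\<in>space M. \<forall>i\<in>I. V i x \<in> A i} = measure N {x\<in>space N. \<forall>i\<in>I. V' i x \<in> A i}"
  using assms
proof (induction I arbitrary: M N rule: finite_induct)
  case empty
  then show ?case by (simp add: prob_space.prob_space)
next
  case (insert j I)
  interpret M: prob_space M by fact
  interpret N: prob_space N by fact
  have [measurable]: "V j \<in> borel_measurable M" "V' j \<in> borel_measurable N" "A j \<in> sets borel"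
    using insert.prems by auto
  note [measurable] = insert.prems(3)[OF insertI2] insert.prems(4)[OF insertI2] insert.prems(5)[OF insertI2]
  let ?B = "{x\<in>space M. V j x \<in> A j}" and ?B' = "{x\<in>space N. V' j x \<in> A j}"
  have B: "?B \<in> sets M" "?B' \<in> sets N" by measurable
  have ch: "(CLINT x|M. iexp (s * V j x + (\<Sum>i\<in>I. u i * V i x)))
      = (CLINT x|N. iexp (s * V' j x + (\<Sum>i\<in>I. u i * V' i x)))" for s u
  proof -
    have "(\<Sum>i\<in>insert j I. (u(j := s)) i * f i) = s * f j + (\<Sum>i\<in>I. u i * f i)" for f :: "'i \<Rightarrow> real"
      using insert.hyps by (simp add: sum.insert) (intro sum.cong, auto)
    with insert.prems(6)[of "u(j := s)"] show ?thesis by (simp only:)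
  qed
  \<comment> \<open>With \<open>u = 0\<close> and phase 0 this equates the probabilities of the two
    conditioning events; with phases 0 and -pi/2 it equates the characteristic functions of the
    remaining coordinates after conditioning.\<close>
  have cw: "(\<integral>x. indicator (A j) (V j x) * cos ((\<Sum>i\<in>I. u i * V i x) + \<theta>) \<partial>M)
      = (\<integral>x. indicator (A j) (V' j x) * cos ((\<Sum>i\<in>I. u i * V' i x) + \<theta>) \<partial>N)" for u \<theta>
  proof (rule cos_weighted_eq_of_char_eq[OF insert.prems(1,2)])
    fix s t
    show "(CLINT x|M. iexp (s * V j x + t * (\<Sum>i\<in>I. u i * V i x)))
       = (CLINT x|N. iexp (s * V' j x + t * (\<Sum>i\<in>I. u i * V' i x)))"
      using ch[of s "\<lambda>i. t * u i"] by (simp add: sum_distrib_left mult.assoc)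
  qed measurable
  have ind: "(\<integral>x. indicator ?B x * f x \<partial>M) = (\<integral>x. indicator (A j) (V j x) * f x \<partial>M)"
      for f :: "'a \<Rightarrow> real"
    by (intro Bochner_Integration.integral_cong) (auto simp: indicator_def)
  have ind': "(\<integral>x. indicator ?B' x * f x \<partial>N) = (\<integral>x. indicator (A j) (V' j x) * f x \<partial>N)"
      for f :: "'b \<Rightarrow> real"
    by (intro Bochner_Integration.integral_cong) (auto simp: indicator_def)
  have p: "measure M ?B = measure N ?B'"
    using cw[of "\<lambda>_. 0" 0] ind[of "\<lambda>_. 1"] ind'[of "\<lambda>_. 1"] B by simp
  have int: "{x\<in>space M. \<forall>i\<in>insert j I. V i x \<in> A i} = ?B \<inter> {x\<in>space M. \<forall>i\<in>I. V i x \<in> A i}"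
    "{x\<in>space N. \<forall>i\<in>insert j I. V' i x \<in> A i} = ?B' \<inter> {x\<in>space N. \<forall>i\<in>I. V' i x \<in> A i}"
    by auto
  have C: "{x\<in>space M. \<forall>i\<in>I. V i x \<in> A i} \<in> sets M" "{x\<in>space N. \<forall>i\<in>I. V' i x \<in> A i} \<in> sets N"
    using insert.hyps by measurable
  show ?case
  proof (cases "measure M ?B = 0")
    case True
    then have "measure M (?B \<inter> {x\<in>space M. \<forall>i\<in>I. V i x \<in> A i}) = 0"
      using M.finite_measure_mono[of "?B \<inter> {x\<in>space M. \<forall>i\<in>I. V i x \<in> A i}" ?B] B
      by (simp add: measure_le_0_iff)
    moreover have "measure N (?B' \<inter> {x\<in>space N. \<forall>i\<in>I. V' i x \<in> A i}) = 0"
      using N.finite_measure_mono[of "?B' \<inter> {x\<in>space N. \<forall>i\<in>I. V' i x \<in> A i}" ?B'] B True p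
      by (simp add: measure_le_0_iff)
    ultimately show ?thesis unfolding int by simp
  next
    case False
    define q where "q = measure M ?B"
    have q: "0 < q" using False measure_nonneg[of M ?B] unfolding q_def by linarith
    define M' where "M' = uniform_measure M ?B"
    define N' where "N' = uniform_measure N ?B'"
    have eB: "emeasure M ?B \<noteq> 0" "emeasure M ?B \<noteq> \<infinity>" "emeasure N ?B' \<noteq> 0" "emeasure N ?B' \<noteq> \<infinity>"
      using q p by (auto simp: M.emeasure_eq_measure N.emeasure_eq_measure q_def)
    have P': "prob_space M'" "prob_space N'"
      unfolding M'_def N'_def using eB by (auto intro!: prob_space_uniform_measure)
    have M'_dens: "M' = density M (\<lambda>x. ennreal (indicator ?B x / q))"
      unfolding M'_def uniform_measure_def using q
      by (intro density_cong) (auto simp: M.emeasure_eq_measure q_def[symmetric] indicator_def divide_ennreal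
          simp del: ennreal_1 simp flip: ennreal_1)
    have N'_dens: "N' = density N (\<lambda>x. ennreal (indicator ?B' x / q))"
      unfolding N'_def uniform_measure_def using q p
      by (intro density_cong) (auto simp: N.emeasure_eq_measure q_def[symmetric] indicator_def divide_ennreal
          simp del: ennreal_1 simp flip: ennreal_1)
    have "measure M' {x\<in>space M'. \<forall>i\<in>I. V i x \<in> A i} = measure N' {x\<in>space N'. \<forall>i\<in>I. V' i x \<in> A i}"
    proof (rule insert.IH[OF P'])
      fix u
      let ?Z = "\<lambda>x. \<Sum>i\<in>I. u i * V i x" and ?Z' = "\<lambda>x. \<Sum>i\<in>I. u i * V' i x"
      have ZZ: "(\<integral>x. cos (?Z x + \<theta>) \<partial>M') = (\<integral>x. cos (?Z' x + \<theta>) \<partial>N')" for \<theta>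
      proof -
        have "(\<integral>x. cos (?Z x + \<theta>) \<partial>M') = (\<integral>x. (indicator ?B x * cos (?Z x + \<theta>)) / q \<partial>M)"
          unfolding M'_dens using q B by (subst integral_density) auto
        also have "\<dots> = (\<integral>x. (indicator ?B' x * cos (?Z' x + \<theta>)) / q \<partial>N)"
          using cw[of u \<theta>] by (simp add: ind ind')
        also have "\<dots> = (\<integral>x. cos (?Z' x + \<theta>) \<partial>N')"
          unfolding N'_dens using q B by (subst integral_density) auto
        finally show ?thesis .
      qed
      interpret M': prob_space M' by fact
      interpret N': prob_space N' by fact
      have [measurable]: "?Z \<in> borel_measurable M'" "?Z' \<in> borel_measurable N'"
        unfolding M'_def N'_def by (auto simp: measurable_def sets_uniform_measure) 
      have iM': "integrable M' (\<lambda>x. cos (?Z x + \<theta>))" and iN': "integrable N' (\<lambda>x. cos (?Z' x + \<theta>))" for \<theta>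
        by (auto intro!: M'.integrable_const_bound[of _ 1] N'.integrable_const_bound[of _ 1])
      show "(CLINT x|M'. iexp (?Z x)) = (CLINT x|N'. iexp (?Z' x))"
        unfolding iexp_cos_shift
        by (subst (1 2) Bochner_Integration.integral_add)
           (use iM'[of 0] iN'[of 0] iM'[of "-pi/2"] iN'[of "-pi/2"] ZZ[of 0] ZZ[of "-pi/2"]
             in \<open>auto intro!: integrable_mult_right\<close>)
    qed (use insert.prems in \<open>auto simp: M'_def N'_def\<close>)
    then have "measure M (?B \<inter> {x\<in>space M. \<forall>i\<in>I. V i x \<in> A i}) / q
        = measure N (?B' \<inter> {x\<in>space N. \<forall>i\<in>I. V' i x \<in> A i}) / q"
      unfolding M'_def N'_def using eB C p by (simp add: q_def)
    then show ?thesis unfolding int using q by simp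
  qed
qed

section \<open>Centred normal variables\<close>

text \<open>The law is the image of the standard normal one under scaling, so the point mass at 0 is
  the value \<open>s = 0\<close> and not a separate case.\<close>

definition centered_normal :: "'w measure \<Rightarrow> ('w \<Rightarrow> real) \<Rightarrow> bool" where
  "centered_normal M Y \<longleftrightarrow> Y \<in> borel_measurable M \<and>
     (\<exists>s\<ge>0. distr M borel Y = distr std_normal_distribution borel (\<lambda>x. s * x))"

lemma centered_normal_measurable[measurable_dest]: "centered_normal M Y \<Longrightarrow> Y \<in> borel_measurable M"
  by (simp add: centered_normal_def)

lemma (in prob_space) centered_normal_of_gaussian_rv:
  assumes Y: "gaussian_rv M Y" and zero: "expectation Y = 0"
  shows "centered_normal M Y"
proof -
  interpret std: real_distribution std_normal_distribution by (rule real_dist_normal_dist)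
  obtain m s where [measurable]: "Y \<in> borel_measurable M" and s: "0 \<le> s"
    and law: "distr M borel Y = (if s = 0 then return borel m else density lborel (normal_density m s))"
    using Y unfolding gaussian_rv_def by auto
  have "expectation Y = (\<integral>y. y \<partial>distr M borel Y)"
    by (simp add: integral_distr)
  with zero law have mean: "(\<integral>y. y \<partial>(if s = 0 then return borel m else density lborel (normal_density m s))) = 0"
    by simp
  show ?thesis
  proof (cases "s = 0")
    case True
    then have m: "m = 0" using mean by (simp add: integral_return)
    have "distr std_normal_distribution borel (\<lambda>x. s * x) = return borel m"
      unfolding True m mult_zero_left by (rule std.distr_const) simp
    moreover have "distr M borel Y = return borel m" using law True by simp
    ultimately have "distr M borel Y = distr std_normal_distribution borel (\<lambda>x. s * x)" by metis
    with s show ?thesis unfolding centered_normal_def by (blast intro: \<open>Y \<in> borel_measurable M\<close>)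
  next
    case False
    then have "0 < s" using s by simp
    then have m: "m = 0" using mean False
      by (simp add: integral_real_density integral_normal_moment_nz_1)
    have "distributed M lborel Y (normal_density 0 s)"
      using law False m by (auto simp: distributed_def cong: distr_cong)
    then have "distributed M lborel (\<lambda>x. Y x / s) std_normal_density"
      using normal_standard_normal_convert[OF \<open>0 < s\<close>, of Y 0] by simp
    then have "distr M borel (\<lambda>x. Y x / s) = std_normal_distribution"
      by (auto simp: distributed_def cong: distr_cong)
    then have "distr std_normal_distribution borel (\<lambda>x. s * x)
        = distr (distr M borel (\<lambda>x. Y x / s)) borel (\<lambda>x. s * x)" by simp
    also have "\<dots> = distr M borel Y"
      using \<open>0 < s\<close> by (subst distr_distr) (auto simp: comp_def)
    finally show ?thesis using \<open>0 < s\<close> by (auto simp: centered_normal_def intro!: exI[of _ s])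
  qed
qed

lemma std_normal_second_moment:
  "integrable std_normal_distribution (\<lambda>x. x\<^sup>2)" "(\<integral>x. x\<^sup>2 \<partial>std_normal_distribution) = 1"
  using std_normal_distribution_even_moments[of 1] by (simp_all add: eval_nat_numeral)

context prob_space
begin

lemma centered_normal_law:
  assumes "centered_normal M Y"
  obtains s where "0 \<le> s" "s\<^sup>2 = expectation (\<lambda>x. (Y x)\<^sup>2)"
    "distr M borel Y = distr std_normal_distribution borel (\<lambda>x. s * x)"
proof -
  obtain s where s: "0 \<le> s" "distr M borel Y = distr std_normal_distribution borel (\<lambda>x. s * x)"
    using assms by (auto simp: centered_normal_def)
  have [measurable]: "Y \<in> borel_measurable M" using assms by (rule centered_normal_measurable)
  have "expectation (\<lambda>x. (Y x)\<^sup>2) = (\<integral>y. y\<^sup>2 \<partial>distr M borel Y)"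
    by (simp add: integral_distr)
  also have "\<dots> = s\<^sup>2"
    unfolding s(2) by (subst integral_distr) (auto simp: power_mult_distrib std_normal_second_moment)
  finally show thesis using s that by simp
qed

lemma centered_normal_square_integrable:
  assumes "centered_normal M Y"
  shows "integrable M (\<lambda>x. (Y x)\<^sup>2)"
proof -
  obtain s where s: "distr M borel Y = distr std_normal_distribution borel (\<lambda>x. s * x)"
    using assms by (auto simp: centered_normal_def)
  have [measurable]: "Y \<in> borel_measurable M" using assms by (rule centered_normal_measurable)
  have "integrable (distr std_normal_distribution borel (\<lambda>x. s * x)) (\<lambda>y. y\<^sup>2)"
    by (subst integrable_distr_eq) (auto simp: power_mult_distrib std_normal_second_moment)
  then show ?thesis unfolding s[symmetric] by (subst (asm) integrable_distr_eq) auto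
qed

lemma centered_normal_char:
  assumes "centered_normal M Y"
  shows "(CLINT x|M. iexp (Y x)) = exp (- (expectation (\<lambda>x. (Y x)\<^sup>2) / 2))"
proof -
  obtain s where s: "s\<^sup>2 = expectation (\<lambda>x. (Y x)\<^sup>2)" "distr M borel Y = distr std_normal_distribution borel (\<lambda>x. s * x)"
    using centered_normal_law[OF assms] .
  have [measurable]: "Y \<in> borel_measurable M" using assms by (rule centered_normal_measurable)
  have "(CLINT x|M. iexp (Y x)) = (CLINT y|distr M borel Y. iexp y)"
    by (simp add: integral_distr)
  also have "\<dots> = char std_normal_distribution s"
    unfolding s(2) char_def by (subst integral_distr) auto
  also have "\<dots> = exp (- (s\<^sup>2 / 2))" by (simp add: char_std_normal_distribution)
  finally show ?thesis by (simp add: s)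
qed

end

text \<open>After translation by \<open>r\<close> the cross term \<open>r * x\<close> in the square
  is nonnegative on the half-line, which lets the factor \<open>exp (- r\<^sup>2 / 2)\<close> come
  out of the density.\<close>

lemma std_normal_tail:
  assumes "0 \<le> r"
  shows "measure std_normal_distribution {r<..} \<le> exp (- r\<^sup>2 / 2)"
proof -
  interpret std: real_distribution std_normal_distribution by (rule real_dist_normal_dist)
  have "emeasure std_normal_distribution {r<..} = (\<integral>\<^sup>+x. ennreal (std_normal_density x) * indicator {r<..} x \<partial>lborel)"
    by (subst emeasure_density) auto
  also have "\<dots> = (\<integral>\<^sup>+x. ennreal (std_normal_density (r + x)) * indicator {r<..} (r + x) \<partial>lborel)"
    by (subst nn_integral_real_affine[where c = 1 and t = r]) auto
  also have "\<dots> \<le> (\<integral>\<^sup>+x. ennreal (exp (- r\<^sup>2 / 2)) * ennreal (std_normal_density x) \<partial>lborel)"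
  proof (intro nn_integral_mono)
    fix x
    have "std_normal_density (r + x) \<le> exp (- r\<^sup>2 / 2) * std_normal_density x" if "0 < x"
    proof -
      have "0 \<le> r * x" using assms that by simp
      then have "exp (- (r + x)\<^sup>2 / 2) \<le> exp (- r\<^sup>2 / 2 + - x\<^sup>2 / 2)"
        by (subst exp_le_cancel_iff) (simp add: power2_sum field_simps)
      then show ?thesis
        by (simp add: std_normal_density_def exp_add[symmetric] divide_right_mono)
    qed
    then show "ennreal (std_normal_density (r + x)) * indicator {r<..} (r + x)
        \<le> ennreal (exp (- r\<^sup>2 / 2)) * ennreal (std_normal_density x)"
      by (auto simp: indicator_def ennreal_mult[symmetric])
  qed
  also have "\<dots> = ennreal (exp (- r\<^sup>2 / 2))"
    by (subst nn_integral_cmult) (auto simp: nn_integral_eq_integral)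
  finally show ?thesis by (simp add: std.emeasure_eq_measure)
qed

lemma std_normal_symmetric: "distr std_normal_distribution borel uminus = std_normal_distribution"
proof (rule Levy_uniqueness)
  interpret std: real_distribution std_normal_distribution by (rule real_dist_normal_dist)
  show "real_distribution (distr std_normal_distribution borel uminus)"
    by (rule std.real_distribution_distr) simp
  show "char (distr std_normal_distribution borel uminus) = char std_normal_distribution"
  proof
    fix t
    have "char (distr std_normal_distribution borel uminus) t = char std_normal_distribution (- t)"
      unfolding char_def by (subst integral_distr) auto
    then show "char (distr std_normal_distribution borel uminus) t = char std_normal_distribution t"
      by (simp add: char_std_normal_distribution)
  qed
qed (rule real_dist_normal_dist)

lemma std_normal_interval_ge_tail:
  assumes "0 \<le> r"
  shows "1 - 2 * exp (- r\<^sup>2 / 2) \<le> measure std_normal_distribution {-r..r}"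
proof -
  interpret std: real_distribution std_normal_distribution by (rule real_dist_normal_dist)
  have "measure std_normal_distribution {..<-r} = measure (distr std_normal_distribution borel uminus) {..<-r}"
    by (simp add: std_normal_symmetric)
  also have "\<dots> = measure std_normal_distribution {r<..}"
    by (subst measure_distr) (auto intro!: arg_cong[where f = "measure _"])
  finally have 1: "measure std_normal_distribution {..<-r} \<le> exp (- r\<^sup>2 / 2)"
    using std_normal_tail[OF assms] by simp
  have "{-r..r} \<union> ({..<-r} \<union> {r<..}) = (UNIV :: real set)" by auto
  then have "1 = measure std_normal_distribution ({-r..r} \<union> ({..<-r} \<union> {r<..}))"
    using std.prob_space by simp
  also have "\<dots> \<le> measure std_normal_distribution {-r..r} + (measure std_normal_distribution {..<-r} + measure std_normal_distribution {r<..})"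
    by (intro order_trans[OF measure_Un_le] add_left_mono measure_Un_le) auto
  finally show ?thesis using 1 std_normal_tail[OF assms] by linarith
qed

lemma std_normal_interval_ge_linear:
  assumes "0 \<le> r"
  shows "min 1 r / 3 \<le> measure std_normal_distribution {-r..r}"
proof -
  interpret std: real_distribution std_normal_distribution by (rule real_dist_normal_dist)
  define q where "q = min 1 r"
  have q: "0 \<le> q" "q \<le> 1" "q \<le> r" using assms by (auto simp: q_def)
  \<comment> \<open>The factors are 1/3 for the normalising constant and 1/2 for the exponential on
    the unit interval. The length \<open>2 * q\<close> turns 1/6 into \<open>q / 3\<close>.\<close>
  have lower: "1 / 6 \<le> std_normal_density x" if "x \<in> {-q..q}" for x
  proof -
    have "\<bar>x\<bar> \<le> 1" using that q by auto
    then have "x\<^sup>2 \<le> 1" by (simp add: abs_square_le_1)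
    then have "1 / 2 \<le> exp (- x\<^sup>2 / 2)" using exp_ge_add_one_self[of "- x\<^sup>2 / 2"] by simp
    moreover have "sqrt (2 * pi) \<le> 3" using pi_less_4 by (intro real_le_lsqrt) auto
    then have "1 / 3 \<le> 1 / sqrt (2 * pi)" by (intro divide_left_mono) auto
    ultimately have "1 / 3 * (1 / 2) \<le> 1 / sqrt (2 * pi) * exp (- x\<^sup>2 / 2)"
      by (intro mult_mono) auto
    then show ?thesis by (simp add: std_normal_density_def)
  qed
  have "ennreal (q / 3) = (\<integral>\<^sup>+x. ennreal (1 / 6) * indicator {-q..q} x \<partial>lborel)"
    using q by (subst nn_integral_cmult_indicator) (auto simp: ennreal_mult[symmetric])
  also have "\<dots> \<le> (\<integral>\<^sup>+x. ennreal (std_normal_density x) * indicator {-q..q} x \<partial>lborel)"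
    using lower by (intro nn_integral_mono) (auto simp: indicator_def intro!: ennreal_leI)
  also have "\<dots> = emeasure std_normal_distribution {-q..q}"
    by (subst emeasure_density) auto
  finally have "q / 3 \<le> measure std_normal_distribution {-q..q}"
    using q by (simp add: std.emeasure_eq_measure)
  also have "\<dots> \<le> measure std_normal_distribution {-r..r}"
    using q by (intro std.finite_measure_mono) auto
  finally show ?thesis by (simp add: q_def)
qed

context prob_space
begin

lemma centered_normal_prob:
  assumes Y: "centered_normal M Y" and v: "expectation (\<lambda>x. (Y x)\<^sup>2) \<le> s\<^sup>2" and s: "0 < s" and x: "0 \<le> x"
  shows "measure std_normal_distribution {-(x / s)..x / s} \<le> prob {\<omega>\<in>space M. \<bar>Y \<omega>\<bar> \<le> x}"
proof -
  interpret std: real_distribution std_normal_distribution by (rule real_dist_normal_dist)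
  obtain \<tau> where \<tau>: "0 \<le> \<tau>" "\<tau>\<^sup>2 = expectation (\<lambda>x. (Y x)\<^sup>2)"
    and law: "distr M borel Y = distr std_normal_distribution borel (\<lambda>x. \<tau> * x)"
    using centered_normal_law[OF Y] .
  have [measurable]: "Y \<in> borel_measurable M" using Y by (rule centered_normal_measurable)
  have "\<tau> \<le> s" using \<tau> v s by (metis less_imp_le power2_le_imp_le)
  have "measure std_normal_distribution {-(x / s)..x / s} \<le> measure std_normal_distribution ((\<lambda>y. \<tau> * y) -` {-x..x})"
  proof (intro std.finite_measure_mono subsetI)
    fix y assume "y \<in> {-(x / s)..x / s}"
    then have "\<bar>y\<bar> \<le> x / s" by auto
    then have "\<bar>\<tau> * y\<bar> \<le> s * (x / s)"
      using \<tau> \<open>\<tau> \<le> s\<close> unfolding abs_mult by (intro mult_mono) auto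
    then show "y \<in> (\<lambda>y. \<tau> * y) -` {-x..x}" using s by auto
  next
    have "(\<lambda>y. \<tau> * y) \<in> borel_measurable borel" by measurable
    from measurable_sets[OF this, of "{-x..x}"]
    show "(\<lambda>y. \<tau> * y) -` {-x..x} \<in> sets std_normal_distribution" by simp
  qed
  also have "\<dots> = measure (distr M borel Y) {-x..x}"
    unfolding law by (subst measure_distr) auto
  also have "\<dots> = prob {\<omega>\<in>space M. \<bar>Y \<omega>\<bar> \<le> x}"
    by (subst measure_distr) (auto intro!: arg_cong[where f = prob])
  finally show ?thesis .
qed

lemma centered_normal_small_ball:
  assumes "centered_normal M Y" "expectation (\<lambda>x. (Y x)\<^sup>2) \<le> s\<^sup>2" "0 < s" "0 \<le> x"
  shows "min 1 (x / s) / 3 \<le> prob {\<omega>\<in>space M. \<bar>Y \<omega>\<bar> \<le> x}"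
  using centered_normal_prob[OF assms] std_normal_interval_ge_linear[of "x / s"] assms by simp

lemma centered_normal_concentration:
  assumes "centered_normal M Y" "expectation (\<lambda>x. (Y x)\<^sup>2) \<le> s\<^sup>2" "0 < s" "0 \<le> x"
  shows "1 - 2 * exp (- (x / s)\<^sup>2 / 2) \<le> prob {\<omega>\<in>space M. \<bar>Y \<omega>\<bar> \<le> x}"
  using centered_normal_prob[OF assms] std_normal_interval_ge_tail[of "x / s"] assms by simp

end

section \<open>Sidak's inequality\<close>

text \<open>Joint normality is expressed through linear combinations, which also makes sense for
  degenerate families.\<close>

definition gaussian_family :: "'w measure \<Rightarrow> 'i set \<Rightarrow> ('i \<Rightarrow> 'w \<Rightarrow> real) \<Rightarrow> bool" where
  "gaussian_family M I Y \<longleftrightarrow> (\<forall>u. centered_normal M (\<lambda>\<omega>. \<Sum>i\<in>I. u i * Y i \<omega>))"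

text \<open>The offsets \<open>c\<close> record the shift of the other coordinates once one
  coordinate has been conditioned on.\<close>

definition slab_prob :: "'w measure \<Rightarrow> 'i set \<Rightarrow> ('i \<Rightarrow> 'w \<Rightarrow> real) \<Rightarrow> ('i \<Rightarrow> real) \<Rightarrow> ('i \<Rightarrow> real) \<Rightarrow> real" where
  "slab_prob M I Y x c = measure M {\<omega>\<in>space M. \<forall>i\<in>I. \<bar>Y i \<omega> + c i\<bar> \<le> x i}"

lemma gaussian_family_component:
  assumes "gaussian_family M I Y" "finite I" "i \<in> I"
  shows "centered_normal M (Y i)"
proof -
  have "(\<lambda>\<omega>. \<Sum>k\<in>I. (if k = i then 1 else 0) * Y k \<omega>) = Y i"
    using assms(2,3) by (simp add: if_distrib[of "\<lambda>a. a * _"] cong: if_cong)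
  then show ?thesis
    using assms(1)[unfolded gaussian_family_def, rule_format, of "\<lambda>k. if k = i then 1 else 0"] by simp
qed

lemma gaussian_family_linear_image:
  assumes "gaussian_family M I Y"
    and "\<And>j. j \<in> J \<Longrightarrow> \<exists>c. Y' j = (\<lambda>\<omega>. \<Sum>i\<in>I. c i * Y i \<omega>)"
  shows "gaussian_family M J Y'"
proof -
  obtain c where c: "\<And>j. j \<in> J \<Longrightarrow> Y' j = (\<lambda>\<omega>. \<Sum>i\<in>I. c j i * Y i \<omega>)"
    using assms(2) by metis
  have "centered_normal M (\<lambda>\<omega>. \<Sum>j\<in>J. u j * Y' j \<omega>)" for u
  proof -
    have "(\<lambda>\<omega>. \<Sum>j\<in>J. u j * Y' j \<omega>) = (\<lambda>\<omega>. \<Sum>i\<in>I. (\<Sum>j\<in>J. u j * c j i) * Y i \<omega>)"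
    proof
      fix \<omega>
      have "(\<Sum>j\<in>J. u j * Y' j \<omega>) = (\<Sum>j\<in>J. \<Sum>i\<in>I. u j * c j i * Y i \<omega>)"
        by (intro sum.cong) (auto simp: c sum_distrib_left mult.assoc)
      also have "\<dots> = (\<Sum>i\<in>I. (\<Sum>j\<in>J. u j * c j i) * Y i \<omega>)"
        by (subst sum.swap) (simp add: sum_distrib_right)
      finally show "(\<Sum>j\<in>J. u j * Y' j \<omega>) = (\<Sum>i\<in>I. (\<Sum>j\<in>J. u j * c j i) * Y i \<omega>)" .
    qed
    then show ?thesis using assms(1) by (simp add: gaussian_family_def)
  qed
  then show ?thesis by (simp add: gaussian_family_def)
qed

lemma gaussian_family_subset:
  assumes "gaussian_family M I Y" "finite I" "J \<subseteq> I"
  shows "gaussian_family M J Y"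
proof (rule gaussian_family_linear_image[OF assms(1)])
  fix j assume "j \<in> J"
  show "\<exists>c. Y j = (\<lambda>\<omega>. \<Sum>i\<in>I. c i * Y i \<omega>)"
  proof (rule exI)
    show "Y j = (\<lambda>\<omega>. \<Sum>i\<in>I. (if i = j then 1 else 0) * Y i \<omega>)"
      using assms(2,3) \<open>j \<in> J\<close> by (auto simp: if_distrib[of "\<lambda>a. a * _"] cong: if_cong)
  qed
qed

lemma integrable_mult_of_squares:
  fixes f g :: "'a \<Rightarrow> real"
  assumes [measurable]: "f \<in> borel_measurable M" "g \<in> borel_measurable M"
    and "integrable M (\<lambda>x. (f x)\<^sup>2)" "integrable M (\<lambda>x. (g x)\<^sup>2)"
  shows "integrable M (\<lambda>x. f x * g x)"
proof (rule Bochner_Integration.integrable_bound)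
  show "integrable M (\<lambda>x. (f x)\<^sup>2 + (g x)\<^sup>2)" using assms by simp
  have "\<bar>a * b\<bar> \<le> a\<^sup>2 + b\<^sup>2" for a b :: real
  proof -
    have "2 * \<bar>a\<bar> * \<bar>b\<bar> \<le> \<bar>a\<bar>\<^sup>2 + \<bar>b\<bar>\<^sup>2" by (rule sum_squares_bound)
    moreover have "0 \<le> \<bar>a\<bar> * \<bar>b\<bar>" by simp
    ultimately show ?thesis unfolding abs_mult power2_abs by linarith
  qed
  then show "AE x in M. norm (f x * g x) \<le> norm ((f x)\<^sup>2 + (g x)\<^sup>2)" by simp
qed measurable

context prob_space
begin

text \<open>Regression on \<open>Z j\<close>: the residuals \<open>W\<close> are uncorrelated with
  \<open>Z j\<close>, hence jointly independent of it. Thus, given \<open>Z j\<close>, the other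
  coordinates are the residuals shifted by \<open>\<alpha> i * Z j\<close>, and the second claim is
  Fubini's theorem for this conditional description.\<close>

lemma gaussian_family_residual:
  fixes Z :: "'i \<Rightarrow> 'a \<Rightarrow> real"
  assumes fin: "finite J" and j: "j \<notin> J" and G: "gaussian_family M (insert j J) Z"
  defines "\<alpha> \<equiv> \<lambda>i. expectation (\<lambda>\<omega>. Z i \<omega> * Z j \<omega>) / expectation (\<lambda>\<omega>. (Z j \<omega>)\<^sup>2)"
  defines "W \<equiv> \<lambda>i \<omega>. Z i \<omega> - \<alpha> i * Z j \<omega>"
  shows "gaussian_family M J W"
    and "B \<in> sets borel \<Longrightarrow>
      prob {\<omega>\<in>space M. Z j \<omega> \<in> B \<and> (\<forall>i\<in>J. \<bar>Z i \<omega> + c i\<bar> \<le> x i)}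
        = expectation (\<lambda>\<omega>. indicator B (Z j \<omega>) * slab_prob M J W x (\<lambda>i. c i + \<alpha> i * Z j \<omega>))"
proof -
  have Zc: "centered_normal M (Z i)" if "i \<in> insert j J" for i
    using gaussian_family_component[OF G _ that] fin by simp
  have Zm[measurable]: "Z i \<in> borel_measurable M" if "i \<in> insert j J" for i
    using Zc[OF that] by (rule centered_normal_measurable)
  have Zsq: "integrable M (\<lambda>\<omega>. (Z i \<omega>)\<^sup>2)" if "i \<in> insert j J" for i
    using Zc[OF that] by (rule centered_normal_square_integrable)
  have Zj[measurable]: "Z j \<in> borel_measurable M" by (rule Zm) simp
  show W: "gaussian_family M J W"
  proof (rule gaussian_family_linear_image[OF G])
    fix i assume i: "i \<in> J"
    then have ij: "i \<noteq> j" using j by auto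
    show "\<exists>c. W i = (\<lambda>\<omega>. \<Sum>k\<in>insert j J. c k * Z k \<omega>)"
    proof (rule exI)
    show "W i = (\<lambda>\<omega>. \<Sum>k\<in>insert j J. (if k = i then 1 else if k = j then - \<alpha> i else 0) * Z k \<omega>)"
    proof
      fix \<omega>
      have "(\<Sum>k\<in>J. (if k = i then 1 else if k = j then - \<alpha> i else 0) * Z k \<omega>)
          = (\<Sum>k\<in>J. if k = i then Z k \<omega> else 0)"
        using j by (intro sum.cong) auto
      then show "W i \<omega> = (\<Sum>k\<in>insert j J. (if k = i then 1 else if k = j then - \<alpha> i else 0) * Z k \<omega>)"
        using fin j i ij by (simp add: W_def)
    qed
    qed
  qed
  have Wm[measurable]: "W i \<in> borel_measurable M" if "i \<in> J" for i
    using gaussian_family_component[OF W fin that] by (rule centered_normal_measurable)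
  have Wsq: "integrable M (\<lambda>\<omega>. (W i \<omega>)\<^sup>2)" if "i \<in> J" for i
    using gaussian_family_component[OF W fin that] by (rule centered_normal_square_integrable)
  have orth: "expectation (\<lambda>\<omega>. Z j \<omega> * W i \<omega>) = 0" if i: "i \<in> J" for i
  proof -
    have int: "integrable M (\<lambda>\<omega>. Z i \<omega> * Z j \<omega>)"
      using i by (intro integrable_mult_of_squares Zsq Zm) auto
    have "expectation (\<lambda>\<omega>. Z j \<omega> * W i \<omega>) = expectation (\<lambda>\<omega>. Z i \<omega> * Z j \<omega> - \<alpha> i * (Z j \<omega>)\<^sup>2)"
      by (intro Bochner_Integration.integral_cong) (auto simp: W_def power2_eq_square algebra_simps)
    also have "\<dots> = expectation (\<lambda>\<omega>. Z i \<omega> * Z j \<omega>) - \<alpha> i * expectation (\<lambda>\<omega>. (Z j \<omega>)\<^sup>2)"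
      using int Zsq[of j] by (subst Bochner_Integration.integral_diff) auto
    also have "\<dots> = 0"
    \<comment> \<open>If \<open>Z j\<close> has zero variance, it vanishes almost everywhere and so
      does its product with \<open>Z i\<close>; the orthogonality survives the division by zero in
      \<open>\<alpha>\<close>.\<close>
    proof (cases "expectation (\<lambda>\<omega>. (Z j \<omega>)\<^sup>2) = 0")
      case True
      then have "AE \<omega> in M. (Z j \<omega>)\<^sup>2 = 0"
        using Zsq[of j] by (subst (asm) integral_nonneg_eq_0_iff_AE) auto
      then have "AE \<omega> in M. Z i \<omega> * Z j \<omega> = 0" by (rule AE_mp) auto
      then have "expectation (\<lambda>\<omega>. Z i \<omega> * Z j \<omega>) = 0" by (rule integral_eq_zero_AE)
      with True show ?thesis by simp
    qed (simp add: \<alpha>_def)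
    finally show ?thesis .
  qed
  assume B: "B \<in> sets borel"
  let ?N = "M \<Otimes>\<^sub>M M"
  interpret MM: pair_prob_space M M by unfold_locales
  \<comment> \<open>The model with independence built in: \<open>Z j\<close> is read off the first
    factor of the product space, the residuals off the second. The Cramer-Wold device identifies its
    law with that of \<open>Z\<close>.\<close>
  define V' where "V' i p = (if i = j then Z j (fst p) else W i (snd p) + \<alpha> i * Z j (fst p))" for i and p :: "'a \<times> 'a"
  have V'j[measurable]: "V' j \<in> borel_measurable ?N" unfolding V'_def by simp
  have V'm[measurable]: "V' i \<in> borel_measurable ?N" if "i \<in> insert j J" for i
  proof (cases "i = j")
    case False
    then have [measurable]: "W i \<in> borel_measurable M" using that by (intro Wm) auto
    show ?thesis using False unfolding V'_def by simp
  qed simp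
  define A where "A i = (if i = j then B else {y. \<bar>y + c i\<bar> \<le> x i})" for i
  have A[measurable]: "A i \<in> sets borel" for i using B unfolding A_def by simp
  have "prob {\<omega>\<in>space M. \<forall>i\<in>insert j J. Z i \<omega> \<in> A i} = measure ?N {p\<in>space ?N. \<forall>i\<in>insert j J. V' i p \<in> A i}"
  proof (rule cramer_wold)
    fix u :: "'i \<Rightarrow> real"
    define a where "a = u j + (\<Sum>i\<in>J. u i * \<alpha> i)"
    define Y where "Y \<omega> = (\<Sum>i\<in>J. u i * W i \<omega>)" for \<omega>
    have Yc: "centered_normal M Y" using W unfolding Y_def gaussian_family_def by simp
    have Ym[measurable]: "Y \<in> borel_measurable M" using Yc by (rule centered_normal_measurable)
    have Ysq: "integrable M (\<lambda>\<omega>. (Y \<omega>)\<^sup>2)" using Yc by (rule centered_normal_square_integrable)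
    have aZc: "centered_normal M (\<lambda>\<omega>. a * Z j \<omega>)"
    proof -
      have "gaussian_family M {j} Z" using G by (rule gaussian_family_subset) (use fin in auto)
      then show ?thesis unfolding gaussian_family_def by (drule_tac spec[of _ "\<lambda>_. a"]) simp
    qed
    have dec: "(\<Sum>i\<in>insert j J. u i * Z i \<omega>) = a * Z j \<omega> + Y \<omega>" for \<omega>
    proof -
      have "(\<Sum>i\<in>J. u i * Z i \<omega>) = (\<Sum>i\<in>J. u i * W i \<omega> + u i * \<alpha> i * Z j \<omega>)"
        by (intro sum.cong) (auto simp: W_def algebra_simps)
      then show ?thesis
        using fin j by (simp add: a_def Y_def sum.distrib sum_distrib_right distrib_right)
    qed
    have dec': "(\<Sum>i\<in>insert j J. u i * V' i p) = a * Z j (fst p) + Y (snd p)" for p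
    proof -
      have "(\<Sum>i\<in>J. u i * V' i p) = (\<Sum>i\<in>J. u i * W i (snd p) + u i * \<alpha> i * Z j (fst p))"
        using j by (intro sum.cong) (auto simp: V'_def algebra_simps)
      then show ?thesis
        using fin j by (simp add: a_def Y_def V'_def sum.distrib sum_distrib_right distrib_right)
    qed
    have ZY: "integrable M (\<lambda>\<omega>. Z j \<omega> * Y \<omega>)"
      using Zsq[of j] Ysq by (intro integrable_mult_of_squares) auto
    have "expectation (\<lambda>\<omega>. Z j \<omega> * Y \<omega>) = (\<Sum>i\<in>J. u i * expectation (\<lambda>\<omega>. Z j \<omega> * W i \<omega>))"
    proof -
      have "integrable M (\<lambda>\<omega>. Z j \<omega> * W i \<omega>)" if "i \<in> J" for i
        using that by (intro integrable_mult_of_squares Zsq Wsq Wm) auto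
      then have "expectation (\<lambda>\<omega>. \<Sum>i\<in>J. u i * (Z j \<omega> * W i \<omega>)) = (\<Sum>i\<in>J. u i * expectation (\<lambda>\<omega>. Z j \<omega> * W i \<omega>))"
        by (subst Bochner_Integration.integral_sum) auto
      then show ?thesis by (simp add: Y_def sum_distrib_left algebra_simps)
    qed
    then have orthY: "expectation (\<lambda>\<omega>. Z j \<omega> * Y \<omega>) = 0" using orth by simp
    \<comment> \<open>Variances add by orthogonality, and since the characteristic function of a
      centred normal variable depends only on its variance, it factorises as in the product
      model.\<close>
    have var: "expectation (\<lambda>\<omega>. (a * Z j \<omega> + Y \<omega>)\<^sup>2)
        = expectation (\<lambda>\<omega>. (a * Z j \<omega>)\<^sup>2) + expectation (\<lambda>\<omega>. (Y \<omega>)\<^sup>2)"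
    proof -
      have "(\<lambda>\<omega>. (a * Z j \<omega> + Y \<omega>)\<^sup>2) = (\<lambda>\<omega>. ((a * Z j \<omega>)\<^sup>2 + (Y \<omega>)\<^sup>2) + 2 * a * (Z j \<omega> * Y \<omega>))"
        by (auto simp: power2_eq_square algebra_simps)
      moreover have "integrable M (\<lambda>\<omega>. (a * Z j \<omega>)\<^sup>2)"
        using Zsq[of j] by (simp add: power_mult_distrib)
      ultimately show ?thesis using ZY Ysq orthY by simp
    qed
    have "(CLINT \<omega>|M. iexp (\<Sum>i\<in>insert j J. u i * Z i \<omega>)) = (CLINT \<omega>|M. iexp (a * Z j \<omega> + Y \<omega>))"
      unfolding dec ..
    also have "\<dots> = exp (- (expectation (\<lambda>\<omega>. (a * Z j \<omega> + Y \<omega>)\<^sup>2) / 2))"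
    proof (rule centered_normal_char)
      show "centered_normal M (\<lambda>\<omega>. a * Z j \<omega> + Y \<omega>)"
        using G unfolding gaussian_family_def dec[symmetric] by blast
    qed
    also have "\<dots> = (CLINT \<omega>|M. iexp (a * Z j \<omega>)) * (CLINT \<omega>|M. iexp (Y \<omega>))"
      unfolding var centered_normal_char[OF aZc] centered_normal_char[OF Yc]
      by (simp add: exp_add[symmetric] exp_of_real[symmetric] add_divide_distrib algebra_simps del: exp_of_real)
    also have "\<dots> = (CLINT \<omega>|M. CLINT \<omega>'|M. iexp (a * Z j \<omega>) * iexp (Y \<omega>'))"
      by simp
    also have "\<dots> = (CLINT p|?N. iexp (a * Z j (fst p)) * iexp (Y (snd p)))"
      by (subst MM.integral_fst'[symmetric])
         (auto intro!: MM.P.integrable_const_bound[of _ 1] simp: norm_mult)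
    also have "\<dots> = (CLINT p|?N. iexp (\<Sum>i\<in>insert j J. u i * V' i p))"
      unfolding dec' by (simp add: exp_add[symmetric] algebra_simps)
    finally show "(CLINT \<omega>|M. iexp (\<Sum>i\<in>insert j J. u i * Z i \<omega>)) = (CLINT p|?N. iexp (\<Sum>i\<in>insert j J. u i * V' i p))" .
  qed (use fin Zm V'm A in \<open>auto intro: prob_space_axioms MM.P.prob_space_axioms\<close>)
  moreover have "{\<omega>\<in>space M. \<forall>i\<in>insert j J. Z i \<omega> \<in> A i}
      = {\<omega>\<in>space M. Z j \<omega> \<in> B \<and> (\<forall>i\<in>J. \<bar>Z i \<omega> + c i\<bar> \<le> x i)}"
    using j by (auto simp: A_def)
  moreover have "measure ?N {p\<in>space ?N. \<forall>i\<in>insert j J. V' i p \<in> A i}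
     = expectation (\<lambda>\<omega>. indicator B (Z j \<omega>) * slab_prob M J W x (\<lambda>i. c i + \<alpha> i * Z j \<omega>))"
  proof -
    let ?Q = "{p\<in>space ?N. \<forall>i\<in>insert j J. V' i p \<in> A i}"
    have "{p\<in>space ?N. V' i p \<in> A i} \<in> sets ?N" if "i \<in> insert j J" for i
      using measurable_sets[OF V'm[OF that] A[of i]] by (simp add: vimage_def Int_def conj_commute)
    then have Q[measurable]: "?Q \<in> sets ?N"
      using fin by (intro sets.sets_Collect_finite_All) auto
    have "measure ?N ?Q = (\<integral>p. indicator ?Q p \<partial>?N)"
      using sets.sets_into_space[OF Q] by (simp add: Int_absorb2)
    also have "\<dots> = (\<integral>\<omega>. \<integral>\<omega>'. indicator ?Q (\<omega>, \<omega>') \<partial>M \<partial>M)"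
      by (rule MM.integral_fst'[symmetric], rule MM.P.integrable_const_bound[of _ 1])
         (use Q in \<open>auto simp del: insert_iff\<close>)
    also have "\<dots> = expectation (\<lambda>\<omega>. indicator B (Z j \<omega>) * slab_prob M J W x (\<lambda>i. c i + \<alpha> i * Z j \<omega>))"
    proof (intro Bochner_Integration.integral_cong refl)
      fix \<omega> assume \<omega>: "\<omega> \<in> space M"
      have eq: "\<forall>i\<in>J. V' i (\<omega>, \<omega>') = W i \<omega>' + \<alpha> i * Z j \<omega>" for \<omega>'
        using j by (auto simp: V'_def)
      have "(\<integral>\<omega>'. indicator ?Q (\<omega>, \<omega>') \<partial>M) = (\<integral>\<omega>'. indicat_real B (Z j \<omega>)
          * indicator {\<omega>'\<in>space M. \<forall>i\<in>J. \<bar>W i \<omega>' + (c i + \<alpha> i * Z j \<omega>)\<bar> \<le> x i} \<omega>' \<partial>M)"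
        using \<omega> eq
        by (intro Bochner_Integration.integral_cong)
           (use j in \<open>auto simp: indicator_def space_pair_measure A_def V'_def add_ac split: if_splits\<close>)
      also have "\<dots> = indicator B (Z j \<omega>) * slab_prob M J W x (\<lambda>i. c i + \<alpha> i * Z j \<omega>)"
      proof -
        have "{\<omega>'\<in>space M. \<forall>i\<in>J. \<bar>W i \<omega>' + (c i + \<alpha> i * Z j \<omega>)\<bar> \<le> x i} \<in> sets M"
          using fin by measurable
        then show ?thesis by (simp add: slab_prob_def)
      qed
      finally show "(\<integral>\<omega>'. indicator ?Q (\<omega>, \<omega>') \<partial>M) = indicator B (Z j \<omega>) * slab_prob M J W x (\<lambda>i. c i + \<alpha> i * Z j \<omega>)" .
    qed
    finally show ?thesis .
  qed
  ultimately show "prob {\<omega>\<in>space M. Z j \<omega> \<in> B \<and> (\<forall>i\<in>J. \<bar>Z i \<omega> + c i\<bar> \<le> x i)}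
      = expectation (\<lambda>\<omega>. indicator B (Z j \<omega>) * slab_prob M J W x (\<lambda>i. c i + \<alpha> i * Z j \<omega>))"
    by simp
qed

end

section \<open>Log-concavity of slab probabilities in the offsets\<close>

context prob_space
begin

lemma slab_prob_nonneg: "0 \<le> slab_prob M J Z x c"
  by (simp add: slab_prob_def)

lemma slab_prob_le_1: "slab_prob M J Z x c \<le> 1"
  by (simp add: slab_prob_def)

lemma borel_measurable_slab_prob:
  assumes "finite J" "\<And>i. i \<in> J \<Longrightarrow> Z i \<in> borel_measurable M"
  shows "(\<lambda>t::real. slab_prob M J Z x (\<lambda>i. c i + b i * t)) \<in> borel_measurable borel"
proof -
  have [measurable]: "Measurable.pred (borel \<Otimes>\<^sub>M M) (\<lambda>(t, \<omega>). \<forall>i\<in>J. \<bar>Z i \<omega> + (c i + b i * t)\<bar> \<le> x i)"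
  proof -
    have "Measurable.pred (borel \<Otimes>\<^sub>M M) (\<lambda>p. \<forall>i\<in>J. \<bar>Z i (snd p) + (c i + b i * fst p)\<bar> \<le> x i)"
    proof (unfold pred_def, rule sets.sets_Collect_finite_All[OF _ assms(1)])
      fix i assume "i \<in> J"
      then have [measurable]: "Z i \<in> borel_measurable M" by (rule assms)
      show "{p \<in> space (borel \<Otimes>\<^sub>M M). \<bar>Z i (snd p) + (c i + b i * fst p)\<bar> \<le> x i} \<in> sets (borel \<Otimes>\<^sub>M M)"
        by measurable
    qed
    then show ?thesis by (simp add: split_beta)
  qed
  have "(\<lambda>t. \<integral>\<omega>. (if \<forall>i\<in>J. \<bar>Z i \<omega> + (c i + b i * t)\<bar> \<le> x i then 1 else 0 :: real) \<partial>M) \<in> borel_measurable borel"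
    by measurable
  also have "(\<lambda>t. \<integral>\<omega>. (if \<forall>i\<in>J. \<bar>Z i \<omega> + (c i + b i * t)\<bar> \<le> x i then 1 else 0 :: real) \<partial>M)
      = (\<lambda>t. slab_prob M J Z x (\<lambda>i. c i + b i * t))"
  proof
    fix t
    have "(\<integral>\<omega>. (if \<forall>i\<in>J. \<bar>Z i \<omega> + (c i + b i * t)\<bar> \<le> x i then 1 else 0 :: real) \<partial>M)
      = (\<integral>\<omega>. indicator {\<omega>\<in>space M. \<forall>i\<in>J. \<bar>Z i \<omega> + (c i + b i * t)\<bar> \<le> x i} \<omega> \<partial>M)"
      by (intro Bochner_Integration.integral_cong) (auto simp: indicator_def)
    also have "\<dots> = slab_prob M J Z x (\<lambda>i. c i + b i * t)"
      by (simp add: slab_prob_def Int_absorb2[OF Collect_subset])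
    finally show "(\<integral>\<omega>. (if \<forall>i\<in>J. \<bar>Z i \<omega> + (c i + b i * t)\<bar> \<le> x i then 1 else 0 :: real) \<partial>M)
      = slab_prob M J Z x (\<lambda>i. c i + b i * t)" .
  qed
  finally show ?thesis .
qed

end

lemma std_normal_density_log_concave:
  assumes \<theta>: "0 < \<theta>" "\<theta> < 1"
  shows "std_normal_density s powr (1 - \<theta>) * std_normal_density t powr \<theta>
    \<le> std_normal_density ((1 - \<theta>) * s + \<theta> * t)"
proof -
  define K where "K = 1 / sqrt (2 * pi)"
  have K: "0 < K" by (simp add: K_def)
  have d: "std_normal_density y = K * exp (- y\<^sup>2 / 2)" for y by (simp add: std_normal_density_def K_def)
  have "std_normal_density s powr (1 - \<theta>) * std_normal_density t powr \<theta>
      = (K powr (1 - \<theta>) * K powr \<theta>) * (exp (- s\<^sup>2 / 2) powr (1 - \<theta>) * exp (- t\<^sup>2 / 2) powr \<theta>)"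
    unfolding d using K by (simp add: powr_mult mult_ac)
  also have "\<dots> = K * exp ((1 - \<theta>) * (- s\<^sup>2 / 2) + \<theta> * (- t\<^sup>2 / 2))"
  proof -
    have "K powr (1 - \<theta>) * K powr \<theta> = K" using K by (simp add: powr_add[symmetric])
    then show ?thesis by (simp add: powr_def mult_exp_exp)
  qed
  also have "\<dots> \<le> K * exp (- ((1 - \<theta>) * s + \<theta> * t)\<^sup>2 / 2)"
  proof -
    have "(1 - \<theta>) * s\<^sup>2 + \<theta> * t\<^sup>2 - ((1 - \<theta>) * s + \<theta> * t)\<^sup>2 = \<theta> * (1 - \<theta>) * (s - t)\<^sup>2"
      by (simp add: power2_eq_square algebra_simps)
    moreover have "0 \<le> \<theta> * (1 - \<theta>) * (s - t)\<^sup>2" using \<theta> by simp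
    ultimately have "(1 - \<theta>) * (- s\<^sup>2 / 2) + \<theta> * (- t\<^sup>2 / 2) \<le> - ((1 - \<theta>) * s + \<theta> * t)\<^sup>2 / 2"
      by (simp add: field_simps)
    then show ?thesis using K by simp
  qed
  finally show ?thesis unfolding d .
qed

text \<open>Integrating out one coordinate at a time preserves log-concavity, by Prekopa's theorem on the line.\<close>
theorem (in prob_space) slab_prob_log_concave:
  fixes Z :: "'i \<Rightarrow> 'a \<Rightarrow> real"
  assumes "finite J" "gaussian_family M J Z" and \<theta>: "0 < \<theta>" "\<theta> < 1"
  shows "slab_prob M J Z x c powr (1 - \<theta>) * slab_prob M J Z x c' powr \<theta>
    \<le> slab_prob M J Z x (\<lambda>i. (1 - \<theta>) * c i + \<theta> * c' i)"
  using assms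
proof (induction J arbitrary: Z c c' \<theta> rule: finite_induct)
  case empty
  then show ?case by (simp add: slab_prob_def prob_space)
next
  case (insert j J)
  obtain s where s: "distr M borel (Z j) = distr std_normal_distribution borel (\<lambda>t. s * t)"
    using gaussian_family_component[OF insert.prems(1)] insert.hyps
    by (auto simp: centered_normal_def)
  have [measurable]: "Z j \<in> borel_measurable M"
    using gaussian_family_component[OF insert.prems(1)] insert.hyps by (auto intro: centered_normal_measurable)
  define \<alpha> where "\<alpha> i = expectation (\<lambda>\<omega>. Z i \<omega> * Z j \<omega>) / expectation (\<lambda>\<omega>. (Z j \<omega>)\<^sup>2)" for i
  define W where "W i \<omega> = Z i \<omega> - \<alpha> i * Z j \<omega>" for i \<omega>
  note res = gaussian_family_residual[OF insert.hyps insert.prems(1), folded \<alpha>_def, folded W_def]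
  have Wm: "W i \<in> borel_measurable M" if "i \<in> J" for i
    using gaussian_family_component[OF res(1) insert.hyps(1) that] by (rule centered_normal_measurable)
  \<comment> \<open>\<open>Z j\<close> is distributed as \<open>s * t\<close> with \<open>t\<close>
    standard normal, so \<open>k c\<close> is the integrand over Lebesgue measure whose integral is
    the slab probability. It is jointly log-concave in \<open>c\<close> and \<open>t\<close> by the
    induction hypothesis for the residuals.\<close>
  define k where "k c t = std_normal_density t * (indicator {y. \<bar>y + c j\<bar> \<le> x j} (s * t)
      * slab_prob M J W x (\<lambda>i. c i + \<alpha> i * (s * t)))" for c t
  have k0: "0 \<le> k c t" for c t by (simp add: k_def slab_prob_nonneg)
  have slabm[measurable]: "(\<lambda>t. slab_prob M J W x (\<lambda>i. c i + \<alpha> i * (s * t))) \<in> borel_measurable borel" for c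
    using borel_measurable_slab_prob[OF insert.hyps(1) Wm, where x = x and c = c and b = "\<lambda>i. \<alpha> i * s"] by (simp add: mult.assoc)
  have slabm'[measurable]: "(\<lambda>t. slab_prob M J W x (\<lambda>i. c i + \<alpha> i * t)) \<in> borel_measurable borel" for c
    by (rule borel_measurable_slab_prob[OF insert.hyps(1) Wm])
  have km[measurable]: "k c \<in> borel_measurable borel" for c unfolding k_def by measurable
  have k_le: "k c t \<le> std_normal_density t" for c t
    unfolding k_def by (intro mult_left_le mult_le_one) (auto simp: slab_prob_nonneg slab_prob_le_1 indicator_def)
  have kint: "integrable lborel (k c)" for c
    by (rule Bochner_Integration.integrable_bound[of _ std_normal_density]) (use k0 k_le in \<open>auto simp: abs_of_nonneg\<close>)
  have rep: "slab_prob M (insert j J) Z x c = (\<integral>t. k c t \<partial>lborel)" for c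
  proof -
    let ?g = "\<lambda>y. indicator {y. \<bar>y + c j\<bar> \<le> x j} y * slab_prob M J W x (\<lambda>i. c i + \<alpha> i * y)"
    have "slab_prob M (insert j J) Z x c
        = prob {\<omega>\<in>space M. Z j \<omega> \<in> {y. \<bar>y + c j\<bar> \<le> x j} \<and> (\<forall>i\<in>J. \<bar>Z i \<omega> + c i\<bar> \<le> x i)}"
      by (simp add: slab_prob_def)
    also have "\<dots> = expectation (\<lambda>\<omega>. ?g (Z j \<omega>))" by (rule res(2)) simp
    also have "\<dots> = (\<integral>y. ?g y \<partial>distr M borel (Z j))"
      by (subst integral_distr) auto
    also have "\<dots> = (\<integral>t. ?g (s * t) \<partial>std_normal_distribution)"
      unfolding s by (subst integral_distr) auto
    also have "\<dots> = (\<integral>t. k c t \<partial>lborel)"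
      unfolding k_def by (subst integral_density) auto
    finally show ?thesis .
  qed
  have k_lc: "k c t powr (1 - \<theta>) * k c' t' powr \<theta> \<le> k (\<lambda>i. (1 - \<theta>) * c i + \<theta> * c' i) ((1 - \<theta>) * t + \<theta> * t')"
    if \<theta>: "0 < \<theta>" "\<theta> < 1" for c c' t t' \<theta>
  proof (cases "\<bar>s * t + c j\<bar> \<le> x j \<and> \<bar>s * t' + c' j\<bar> \<le> x j")
    case False
    then have "k c t = 0 \<or> k c' t' = 0" by (auto simp: k_def)
    then show ?thesis using \<theta> k0 by auto
  next
    case True
    let ?c = "\<lambda>i. (1 - \<theta>) * c i + \<theta> * c' i" and ?t = "(1 - \<theta>) * t + \<theta> * t'"
    have in_slab: "\<bar>s * ?t + ?c j\<bar> \<le> x j"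
    proof -
      have "s * ?t + ?c j = (1 - \<theta>) * (s * t + c j) + \<theta> * (s * t' + c' j)" by (simp add: algebra_simps)
      also have "\<bar>\<dots>\<bar> \<le> (1 - \<theta>) * \<bar>s * t + c j\<bar> + \<theta> * \<bar>s * t' + c' j\<bar>"
        using \<theta> by (intro order_trans[OF abs_triangle_ineq]) (simp add: abs_mult)
      also have "\<dots> \<le> (1 - \<theta>) * x j + \<theta> * x j" using \<theta> True by (intro add_mono mult_left_mono) auto
      finally show ?thesis by (simp add: algebra_simps)
    qed
    have "k c t powr (1 - \<theta>) * k c' t' powr \<theta> = (std_normal_density t powr (1 - \<theta>) * std_normal_density t' powr \<theta>) *
        (slab_prob M J W x (\<lambda>i. c i + \<alpha> i * (s * t)) powr (1 - \<theta>) * slab_prob M J W x (\<lambda>i. c' i + \<alpha> i * (s * t')) powr \<theta>)"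
      using True by (simp add: k_def powr_mult slab_prob_nonneg)
    also have "\<dots> \<le> std_normal_density ?t * slab_prob M J W x (\<lambda>i. (1 - \<theta>) * (c i + \<alpha> i * (s * t)) + \<theta> * (c' i + \<alpha> i * (s * t')))"
      by (intro mult_mono std_normal_density_log_concave insert.IH res(1) \<theta>) auto
    also have "\<dots> = k ?c ?t"
      using in_slab by (simp add: k_def algebra_simps)
    finally show ?thesis .
  qed
  have bdd: "bdd_above (range (k c))" for c
  proof (rule bdd_aboveI2)
    fix t
    have "k c t \<le> std_normal_density t" by (rule k_le)
    also have "\<dots> \<le> 1 / sqrt (2 * pi)" by (simp add: std_normal_density_def divide_right_mono)
    finally show "k c t \<le> 1 / sqrt (2 * pi)" .
  qed
  show ?case
  \<comment> \<open>For \<open>s = 0\<close> the slab does not bound \<open>t\<close>, so the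
    support of \<open>k c\<close> need not be bounded. But then \<open>k c t\<close> is the density
    times a constant \<open>V c\<close>, and \<open>k_lc\<close> at \<open>t = t' = 0\<close>
    already gives the inequality for \<open>V\<close>.\<close>
  proof (cases "s = 0")
    case True
    define V where "V c = indicator {y. \<bar>y + c j\<bar> \<le> x j} (0::real) * slab_prob M J W x c" for c
    have V: "0 \<le> V c" for c by (simp add: V_def slab_prob_nonneg)
    have kV: "k c t = std_normal_density t * V c" for c t by (simp add: k_def V_def True)
    have "slab_prob M (insert j J) Z x c = V c" for c
      unfolding rep kV by simp
    moreover have "V c powr (1 - \<theta>) * V c' powr \<theta> \<le> V (\<lambda>i. (1 - \<theta>) * c i + \<theta> * c' i)"
    proof -
      define q where "q = std_normal_density 0"
      have q: "0 < q" by (simp add: q_def normal_density_pos)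
      have "(q powr (1 - \<theta>) * q powr \<theta>) * (V c powr (1 - \<theta>) * V c' powr \<theta>) \<le> q * V (\<lambda>i. (1 - \<theta>) * c i + \<theta> * c' i)"
        using k_lc[OF insert.prems(2,3), of c 0 c' 0] q V by (simp add: kV q_def[symmetric] powr_mult mult_ac)
      moreover have "q powr (1 - \<theta>) * q powr \<theta> = q" using q by (simp add: powr_add[symmetric])
      ultimately show ?thesis using q by simp
    qed
    ultimately show ?thesis by simp
  next
    case False
    have supp: "bounded {t. k c t \<noteq> 0}" for c
    proof (rule bounded_subset[of "{(- x j - c j) / s..(x j - c j) / s} \<union> {(x j - c j) / s..(- x j - c j) / s}"])
      show "{t. k c t \<noteq> 0} \<subseteq> {(- x j - c j) / s..(x j - c j) / s} \<union> {(x j - c j) / s..(- x j - c j) / s}"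
        using False by (cases "0 < s") (auto simp: k_def indicator_def abs_le_iff field_simps split: if_splits)
    qed auto
    \<comment> \<open>Log-concavity with \<open>c' = c\<close> bounds \<open>k c\<close> between two
      points from below by the smaller of the two end values.\<close>
    have conv: "convex {t. y < k c t}" for y c
    proof (rule convexI)
      fix t t' u v :: real
      assume t: "t \<in> {t. y < k c t}" "t' \<in> {t. y < k c t}" and uv: "0 \<le> u" "0 \<le> v" "u + v = 1"
      show "u *\<^sub>R t + v *\<^sub>R t' \<in> {t. y < k c t}"
      proof (cases "v = 0 \<or> v = 1")
        case True then show ?thesis using t uv by auto
      next
        case False
        then have v: "0 < v" "v < 1" and u: "u = 1 - v" using uv by auto
        let ?m = "min (k c t) (k c t')"
        have "?m = ?m powr (1 - v) * ?m powr v"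
          using k0[of c t] k0[of c t'] by (cases "?m = 0") (auto simp: powr_add[symmetric] simp del: min_less_iff_conj)
        also have "\<dots> \<le> k c t powr (1 - v) * k c t' powr v"
          using v k0 by (intro mult_mono powr_mono2) auto
        also have "\<dots> \<le> k c ((1 - v) * t + v * t')"
          using k_lc[OF v, of c t c t'] by (simp add: algebra_simps)
        finally show ?thesis using t u by auto
      qed
    qed
    show ?thesis
      unfolding rep by (rule prekopa_leindler) (use kint k0 bdd supp conv insert.prems(2,3) k_lc in auto)
  qed
qed

section \<open>Symmetry, monotonicity along rays and Sidak's inequality\<close>

context prob_space
begin

text \<open>Every combination of the \<open>Z i\<close> has the same variance as its negative, hence
  the same characteristic function, so the family and its negative have the same joint law.\<close>

lemma slab_prob_uminus:
  fixes Z :: "'i \<Rightarrow> 'a \<Rightarrow> real"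
  assumes fin: "finite J" and G: "gaussian_family M J Z"
  shows "slab_prob M J Z x (\<lambda>i. - c i) = slab_prob M J Z x c"
proof -
  have Zm: "Z i \<in> borel_measurable M" if "i \<in> J" for i
    using gaussian_family_component[OF G fin that] by (rule centered_normal_measurable)
  have "prob {\<omega>\<in>space M. \<forall>i\<in>J. Z i \<omega> \<in> {y. \<bar>y - c i\<bar> \<le> x i}}
      = prob {\<omega>\<in>space M. \<forall>i\<in>J. - Z i \<omega> \<in> {y. \<bar>y - c i\<bar> \<le> x i}}"
  proof (rule cramer_wold[OF fin prob_space_axioms prob_space_axioms])
    fix u :: "'i \<Rightarrow> real"
    have n: "(\<Sum>i\<in>J. u i * - Z i \<omega>) = (\<Sum>i\<in>J. - u i * Z i \<omega>)" for \<omega> by simp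
    note 1 = G[unfolded gaussian_family_def, rule_format, of u]
      and 2 = G[unfolded gaussian_family_def, rule_format, of "\<lambda>i. - u i"]
    show "(CLINT \<omega>|M. iexp (\<Sum>i\<in>J. u i * Z i \<omega>)) = (CLINT \<omega>|M. iexp (\<Sum>i\<in>J. u i * - Z i \<omega>))"
      unfolding n centered_normal_char[OF 1] centered_normal_char[OF 2] by (simp add: sum_negf)
  qed (use Zm in auto)
  moreover have "\<bar>- z - c\<bar> \<le> y \<longleftrightarrow> \<bar>z + c\<bar> \<le> y" for z c y :: real by linarith
  ultimately show ?thesis by (simp add: slab_prob_def)
qed

text \<open>The offset \<open>t * c\<close> is the convex combination of \<open>c\<close> and
  \<open>- c\<close> with weight \<open>(1 - t) / 2\<close> on the latter. The two end offsets have
  equal slab probabilities by symmetry, and log-concavity makes the value in between at least as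
  large.\<close>

lemma slab_prob_scale:
  fixes Z :: "'i \<Rightarrow> 'a \<Rightarrow> real"
  assumes fin: "finite J" and G: "gaussian_family M J Z" and t: "0 \<le> t" "t \<le> 1"
  shows "slab_prob M J Z x c \<le> slab_prob M J Z x (\<lambda>i. t * c i)"
proof (cases "t = 1")
  case False
  define \<theta> where "\<theta> = (1 - t) / 2"
  have \<theta>: "0 < \<theta>" "\<theta> < 1" using t False by (auto simp: \<theta>_def)
  let ?p = "slab_prob M J Z x c"
  have "?p = ?p powr (1 - \<theta>) * ?p powr \<theta>"
    using slab_prob_nonneg[of J Z x c] by (cases "?p = 0") (auto simp: powr_add[symmetric])
  also have "\<dots> = ?p powr (1 - \<theta>) * slab_prob M J Z x (\<lambda>i. - c i) powr \<theta>"
    by (simp add: slab_prob_uminus[OF fin G])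
  also have "\<dots> \<le> slab_prob M J Z x (\<lambda>i. (1 - \<theta>) * c i + \<theta> * - c i)"
    by (rule slab_prob_log_concave[OF fin G \<theta>])
  also have "(\<lambda>i. (1 - \<theta>) * c i + \<theta> * - c i) = (\<lambda>i. t * c i)"
    by (auto simp: \<theta>_def field_simps)
  finally show ?thesis .
qed simp

text \<open>Conditionally on \<open>Z j\<close>, the probability of the other slabs decreases with \<open>\<bar>Z j\<bar>\<close>.\<close>
lemma sidak_insert:
  fixes Z :: "'i \<Rightarrow> 'a \<Rightarrow> real"
  assumes fin: "finite J" and j: "j \<notin> J" and G: "gaussian_family M (insert j J) Z"
  shows "prob {\<omega>\<in>space M. \<bar>Z j \<omega>\<bar> \<le> x j} * prob {\<omega>\<in>space M. \<forall>i\<in>J. \<bar>Z i \<omega>\<bar> \<le> x i}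
    \<le> prob {\<omega>\<in>space M. \<forall>i\<in>insert j J. \<bar>Z i \<omega>\<bar> \<le> x i}"
proof -
  have Zj[measurable]: "Z j \<in> borel_measurable M"
    using gaussian_family_component[OF G] fin by (auto intro: centered_normal_measurable)
  define \<alpha> where "\<alpha> i = expectation (\<lambda>\<omega>. Z i \<omega> * Z j \<omega>) / expectation (\<lambda>\<omega>. (Z j \<omega>)\<^sup>2)" for i
  define W where "W i \<omega> = Z i \<omega> - \<alpha> i * Z j \<omega>" for i \<omega>
  note res = gaussian_family_residual[OF fin j G, folded \<alpha>_def, folded W_def]
  have Wm: "W i \<in> borel_measurable M" if "i \<in> J" for i
    using gaussian_family_component[OF res(1) fin that] by (rule centered_normal_measurable)
  define \<Psi> where "\<Psi> t = slab_prob M J W x (\<lambda>i. \<alpha> i * t)" for t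
  have \<Psi>m[measurable]: "\<Psi> \<in> borel_measurable borel"
    using borel_measurable_slab_prob[where Z = W and J = J and x = x and c = "\<lambda>_. 0" and b = \<alpha>] fin Wm
    by (simp add: \<Psi>_def[abs_def])
  have \<Psi>01: "0 \<le> \<Psi> t" "\<Psi> t \<le> 1" for t by (simp_all add: \<Psi>_def slab_prob_nonneg slab_prob_le_1)
  have \<Psi>_even: "\<Psi> (- t) = \<Psi> t" for t
    using slab_prob_uminus[OF fin res(1), of x "\<lambda>i. \<alpha> i * t"] by (simp add: \<Psi>_def)
  have \<Psi>_ray: "\<Psi> t \<le> \<Psi> s" if "0 \<le> s" "s \<le> t" for s t
  proof (cases "t = 0")
    case False
    then show ?thesis
      using slab_prob_scale[OF fin res(1), of "s / t" x "\<lambda>i. \<alpha> i * t"] that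
      by (simp add: \<Psi>_def mult.commute)
  qed (use that in simp)
  have \<Psi>_abs: "\<Psi> \<bar>t\<bar> = \<Psi> t" for t using \<Psi>_even[of t] by (simp add: abs_if)
  have rep: "prob {\<omega>\<in>space M. Z j \<omega> \<in> B \<and> (\<forall>i\<in>J. \<bar>Z i \<omega>\<bar> \<le> x i)} = expectation (\<lambda>\<omega>. indicator B (Z j \<omega>) * \<Psi> (Z j \<omega>))"
    if "B \<in> sets borel" for B
    using res(2)[OF that, of "\<lambda>_. 0" x] by (simp add: \<Psi>_def)
  define B where "B = {y. \<bar>y\<bar> \<le> x j}"
  have B[measurable]: "B \<in> sets borel" unfolding B_def by measurable
  define p where "p = prob {\<omega>\<in>space M. Z j \<omega> \<in> B}"
  define a where "a = expectation (\<lambda>\<omega>. indicator B (Z j \<omega>) * \<Psi> (Z j \<omega>))"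
  define b where "b = expectation (\<lambda>\<omega>. indicator (- B) (Z j \<omega>) * \<Psi> (Z j \<omega>))"
  have bnd: "integrable M (\<lambda>\<omega>. indicator A (Z j \<omega>) * \<Psi> (Z j \<omega>))" if [measurable]: "A \<in> sets borel" for A
    by (rule integrable_const_bound[of _ 1]) (auto simp: \<Psi>01 indicator_def)
  have ind: "integrable M (\<lambda>\<omega>. indicator A (Z j \<omega>) * m)" "expectation (\<lambda>\<omega>. indicator A (Z j \<omega>) * m) = prob {\<omega>\<in>space M. Z j \<omega> \<in> A} * m"
    if [measurable]: "A \<in> sets borel" for A and m :: real
  proof -
    have eq: "expectation (\<lambda>\<omega>. indicator A (Z j \<omega>)) = prob {\<omega>\<in>space M. Z j \<omega> \<in> A}"
    proof -
      have "expectation (\<lambda>\<omega>. indicator A (Z j \<omega>) :: real) = expectation (indicator {\<omega>\<in>space M. Z j \<omega> \<in> A})"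
        by (intro Bochner_Integration.integral_cong) (auto simp: indicator_def)
      then show ?thesis by (simp add: Int_absorb2[OF Collect_subset])
    qed
    show "integrable M (\<lambda>\<omega>. indicator A (Z j \<omega>) * m)"
      by (rule integrable_const_bound[of _ "\<bar>m\<bar>"]) (auto simp: indicator_def)
    show "expectation (\<lambda>\<omega>. indicator A (Z j \<omega>) * m) = prob {\<omega>\<in>space M. Z j \<omega> \<in> A} * m"
      using eq by simp
  qed
  have compl: "prob {\<omega>\<in>space M. Z j \<omega> \<in> - B} = 1 - p"
  proof -
    have "{\<omega>\<in>space M. Z j \<omega> \<in> - B} = space M - {\<omega>\<in>space M. Z j \<omega> \<in> B}" by auto
    then show ?thesis unfolding p_def by (simp add: prob_compl)
  qed
  have "p * (a + b) \<le> a"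
  proof (cases "0 \<le> x j")
    case True
    \<comment> \<open>The value of \<open>\<Psi>\<close> at the edge separates the two regions:
      \<open>\<Psi>\<close> is at least \<open>m\<close> inside the slab and at most
      \<open>m\<close> outside. So \<open>p * b\<close> is at most \<open>p * (1 - p) * m\<close>,
      which is at most \<open>(1 - p) * a\<close>.\<close>
    define m where "m = \<Psi> (x j)"
    have "p * m \<le> a" unfolding p_def a_def ind(2)[OF B, symmetric]
    proof (intro integral_mono ind(1) bnd B)
      fix \<omega> show "indicator B (Z j \<omega>) * m \<le> indicator B (Z j \<omega>) * \<Psi> (Z j \<omega>)"
        using \<Psi>_ray[of "\<bar>Z j \<omega>\<bar>" "x j"] by (auto simp: indicator_def B_def m_def \<Psi>_abs)
    qed
    moreover have "b \<le> (1 - p) * m" unfolding b_def compl[symmetric]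
    proof (subst ind(2)[symmetric])
      show "expectation (\<lambda>\<omega>. indicator (- B) (Z j \<omega>) * \<Psi> (Z j \<omega>)) \<le> expectation (\<lambda>\<omega>. indicator (- B) (Z j \<omega>) * m)"
      proof (intro integral_mono ind(1) bnd)
        fix \<omega> show "indicator (- B) (Z j \<omega>) * \<Psi> (Z j \<omega>) \<le> indicator (- B) (Z j \<omega>) * m"
          using \<Psi>_ray[of "x j" "\<bar>Z j \<omega>\<bar>"] True by (auto simp: indicator_def B_def m_def \<Psi>_abs)
      qed (use B in auto)
    qed (use B in auto)
    moreover have "0 \<le> p" "p \<le> 1" by (auto simp: p_def)
    ultimately have "p * b \<le> (1 - p) * a"
      using mult_left_mono[of b "(1 - p) * m" p] mult_left_mono[of "p * m" a "1 - p"]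
      by (simp add: mult_ac)
    then show ?thesis by (simp add: algebra_simps)
  next
    case False
    then have "B = {}" by (auto simp: B_def)
    then show ?thesis by (simp add: p_def a_def)
  qed
  moreover have "a + b = prob {\<omega>\<in>space M. \<forall>i\<in>J. \<bar>Z i \<omega>\<bar> \<le> x i}"
  proof -
    have "a + b = expectation (\<lambda>\<omega>. indicator B (Z j \<omega>) * \<Psi> (Z j \<omega>) + indicator (- B) (Z j \<omega>) * \<Psi> (Z j \<omega>))"
      unfolding a_def b_def using bnd[OF B] bnd[of "- B"] B by simp
    also have "\<dots> = expectation (\<lambda>\<omega>. indicator UNIV (Z j \<omega>) * \<Psi> (Z j \<omega>))"
      by (intro Bochner_Integration.integral_cong) (auto simp: indicator_def)
    also have "\<dots> = prob {\<omega>\<in>space M. \<forall>i\<in>J. \<bar>Z i \<omega>\<bar> \<le> x i}"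
      using rep[of UNIV] by simp
    finally show ?thesis .
  qed
  moreover have "a = prob {\<omega>\<in>space M. \<forall>i\<in>insert j J. \<bar>Z i \<omega>\<bar> \<le> x i}"
    unfolding a_def rep[OF B, symmetric] by (simp add: B_def)
  moreover have "p = prob {\<omega>\<in>space M. \<bar>Z j \<omega>\<bar> \<le> x j}" by (simp add: p_def B_def)
  ultimately show ?thesis by simp
qed

theorem sidak:
  fixes Z :: "'i \<Rightarrow> 'a \<Rightarrow> real"
  assumes "finite J" "gaussian_family M J Z"
  shows "(\<Prod>i\<in>J. prob {\<omega>\<in>space M. \<bar>Z i \<omega>\<bar> \<le> x i}) \<le> prob {\<omega>\<in>space M. \<forall>i\<in>J. \<bar>Z i \<omega>\<bar> \<le> x i}"
  using assms
proof (induction J rule: finite_induct)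
  case empty
  then show ?case by (simp add: prob_space)
next
  case (insert j J)
  have "gaussian_family M J Z" using insert.prems by (rule gaussian_family_subset) (use insert.hyps in auto)
  then have "prob {\<omega>\<in>space M. \<bar>Z j \<omega>\<bar> \<le> x j} * (\<Prod>i\<in>J. prob {\<omega>\<in>space M. \<bar>Z i \<omega>\<bar> \<le> x i})
      \<le> prob {\<omega>\<in>space M. \<bar>Z j \<omega>\<bar> \<le> x j} * prob {\<omega>\<in>space M. \<forall>i\<in>J. \<bar>Z i \<omega>\<bar> \<le> x i}"
    by (intro mult_left_mono insert.IH) auto
  also have "\<dots> \<le> prob {\<omega>\<in>space M. \<forall>i\<in>insert j J. \<bar>Z i \<omega>\<bar> \<le> x i}"
    by (rule sidak_insert[OF insert.hyps insert.prems])
  finally show ?case using insert.hyps by simp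
qed

end

section \<open>Chaining through centres\<close>

context prob_space
begin

text \<open>Jung's theorem is the case where \<open>p\<close> is far away. The control of the distance from \<open>p\<close> makes
  the squared radii telescope along a chain of centres.\<close>
lemma ball_center:
  fixes X :: "'t \<Rightarrow> 'a \<Rightarrow> real" and p :: "'a \<Rightarrow> real"
  assumes A: "finite A" "A \<noteq> {}"
    and Xm: "\<And>t. t \<in> A \<Longrightarrow> X t \<in> borel_measurable M" and Xsq: "\<And>t. t \<in> A \<Longrightarrow> integrable M (\<lambda>\<omega>. (X t \<omega>)\<^sup>2)"
    and pm: "p \<in> borel_measurable M" and psq: "integrable M (\<lambda>\<omega>. (p \<omega>)\<^sup>2)"
    and diam: "\<And>s t. s \<in> A \<Longrightarrow> t \<in> A \<Longrightarrow> expectation (\<lambda>\<omega>. (X s \<omega> - X t \<omega>)\<^sup>2) \<le> 2 * r"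
    and dist: "\<And>t. t \<in> A \<Longrightarrow> expectation (\<lambda>\<omega>. (X t \<omega> - p \<omega>)\<^sup>2) \<le> r'"
    and r: "r \<le> r'"
  obtains l q where
    "\<And>t. t \<in> A \<Longrightarrow> expectation (\<lambda>\<omega>. (X t \<omega> - ((\<Sum>s\<in>A. l s * X s \<omega>) + q * p \<omega>))\<^sup>2) \<le> r"
    "expectation (\<lambda>\<omega>. (p \<omega> - ((\<Sum>s\<in>A. l s * X s \<omega>) + q * p \<omega>))\<^sup>2) \<le> r' - r"
proof -
  \<comment> \<open>The point \<open>p\<close> is adjoined under the index \<open>None\<close>, so
    that it takes part in the minimax problem with its own admissible squared radius
    \<open>r' - r\<close>.\<close>
  define I where "I = insert None (Some ` A)"
  define y where "y i = (case i of None \<Rightarrow> p | Some t \<Rightarrow> X t)" for i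
  define B where "B i j = expectation (\<lambda>\<omega>. y i \<omega> * y j \<omega>)" for i j
  define \<rho> where "\<rho> i = (case i of None \<Rightarrow> r' - r | Some t \<Rightarrow> r)" for i :: "'t option"
  have I: "finite I" "I \<noteq> {}" using A by (auto simp: I_def)
  have sumI: "sum f I = f None + (\<Sum>t\<in>A. f (Some t))" for f :: "'t option \<Rightarrow> real"
    using A by (simp add: I_def sum.reindex)
  have ym: "y i \<in> borel_measurable M" and ysq: "integrable M (\<lambda>\<omega>. (y i \<omega>)\<^sup>2)" if "i \<in> I" for i
    using that Xm Xsq pm psq by (auto simp: I_def y_def)
  have yint: "integrable M (\<lambda>\<omega>. y i \<omega> * y j \<omega>)" if "i \<in> I" "j \<in> I" for i j
    using that by (intro integrable_mult_of_squares ym ysq)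
  have Bsym: "B i j = B j i" for i j by (simp add: B_def mult.commute)
  have dB: "expectation (\<lambda>\<omega>. (y i \<omega> - y j \<omega>)\<^sup>2) = B i i + B j j - 2 * B i j" if "i \<in> I" "j \<in> I" for i j
  proof -
    have "(\<lambda>\<omega>. (y i \<omega> - y j \<omega>)\<^sup>2) = (\<lambda>\<omega>. y i \<omega> * y i \<omega> + y j \<omega> * y j \<omega> - 2 * (y i \<omega> * y j \<omega>))"
      by (auto simp: power2_eq_square algebra_simps)
    then show ?thesis using yint that by (simp add: B_def)
  qed
  have var: "(\<Sum>i\<in>I. l i * B i i) - (\<Sum>i\<in>I. \<Sum>j\<in>I. l i * l j * B i j) \<le> (\<Sum>i\<in>I. l i * \<rho> i)"
    if l0: "\<And>i. i \<in> I \<Longrightarrow> 0 \<le> l i" and l1: "sum l I = 1" for l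
  proof -
    \<comment> \<open>Upper bounds for the squared distances: \<open>2 * r\<close> between points of
      the set, diagonal included, and \<open>r'\<close> between a point and
      \<open>p\<close>.\<close>
    define e where "e i j = (case (i, j) of (None, None) \<Rightarrow> 0 | (Some s, Some t) \<Rightarrow> 2 * r | _ \<Rightarrow> r')" for i j :: "'t option"
    have de: "B i i + B j j - 2 * B i j \<le> e i j" if "i \<in> I" "j \<in> I" for i j
    proof (cases i)
      case None
      show ?thesis
      proof (cases j)
        case None with \<open>i = None\<close> show ?thesis by (simp add: e_def)
      next
        case (Some t)
        then have "B j j + B i i - 2 * B j i \<le> r'"
          using that dist[of t] \<open>i = None\<close> unfolding dB[OF that(2,1), symmetric] by (auto simp: I_def y_def)
        with None Some show ?thesis by (simp add: e_def Bsym)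
      qed
    next
      case (Some s)
      then show ?thesis
        using that diam[of s] dist[of s] unfolding dB[OF that, symmetric]
        by (cases j) (auto simp: I_def y_def e_def)
    qed
    \<comment> \<open>Twice the variance of weighted points is the weighted double sum of their
      squared distances; only distances are controlled by the hypotheses.\<close>
    have "2 * ((\<Sum>i\<in>I. l i * B i i) - (\<Sum>i\<in>I. \<Sum>j\<in>I. l i * l j * B i j))
        = (\<Sum>i\<in>I. \<Sum>j\<in>I. l i * l j * (B i i + B j j - 2 * B i j))"
    proof -
      have "(\<Sum>i\<in>I. \<Sum>j\<in>I. l i * l j * B i i) = (\<Sum>i\<in>I. l i * B i i)"
      proof (rule sum.cong)
        fix i
        have "(\<Sum>j\<in>I. l i * l j * B i i) = (\<Sum>j\<in>I. l j) * (l i * B i i)"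
          by (subst sum_distrib_right) (simp add: mult_ac)
        then show "(\<Sum>j\<in>I. l i * l j * B i i) = l i * B i i" using l1 by simp
      qed simp
      moreover have "(\<Sum>i\<in>I. \<Sum>j\<in>I. l i * l j * B j j) = (\<Sum>j\<in>I. l j * B j j)"
      proof -
        have "(\<Sum>i\<in>I. \<Sum>j\<in>I. l i * l j * B j j) = (\<Sum>i\<in>I. l i) * (\<Sum>j\<in>I. l j * B j j)"
          by (simp add: sum_product mult.assoc)
        then show ?thesis using l1 by simp
      qed
      ultimately show ?thesis
        by (simp add: distrib_left right_diff_distrib sum.distrib sum_subtractf sum_distrib_left mult_ac)
    qed
    also have "\<dots> \<le> (\<Sum>i\<in>I. \<Sum>j\<in>I. l i * l j * e i j)"
      using l0 de by (intro sum_mono mult_left_mono) auto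
    also have "\<dots> = 2 * (l None * (\<Sum>t\<in>A. l (Some t)) * r' + (\<Sum>t\<in>A. l (Some t))\<^sup>2 * r)"
      by (simp add: sumI e_def sum.distrib sum_distrib_left sum_distrib_right power2_eq_square sum_product algebra_simps)
    also have "\<dots> \<le> 2 * (\<Sum>i\<in>I. l i * \<rho> i)"
    proof -
      define s where "s = (\<Sum>t\<in>A. l (Some t))"
      have ls: "l None = 1 - s" using l1 by (simp add: sumI s_def)
      \<comment> \<open>Here \<open>s\<close> is the total weight on the set. The radii
        \<open>r\<close> and \<open>r' - r\<close> are chosen so that the slack is this nonnegative
        multiple of a square.\<close>
      have "(\<Sum>i\<in>I. l i * \<rho> i) - (l None * s * r' + s\<^sup>2 * r) = (1 - s)\<^sup>2 * (r' - r)"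
      proof -
        have "(\<Sum>i\<in>I. l i * \<rho> i) = (1 - s) * (r' - r) + s * r"
          by (simp add: sumI \<rho>_def ls) (simp add: s_def sum_distrib_right)
        then show ?thesis by (simp add: ls power2_eq_square algebra_simps)
      qed
      moreover have "0 \<le> (1 - s)\<^sup>2 * (r' - r)" using r by simp
      ultimately show ?thesis by (simp add: s_def)
    qed
    finally show ?thesis by simp
  qed
  obtain l where l: "\<And>i. i \<in> I \<Longrightarrow>
      B i i - 2 * (\<Sum>j\<in>I. l j * B i j) + (\<Sum>j\<in>I. \<Sum>k\<in>I. l j * l k * B j k) \<le> \<rho> i"
  proof (rule gram_ball_intersection[OF I Bsym var])
    fix l
    assume "\<And>i. i \<in> I \<Longrightarrow>
      B i i - 2 * (\<Sum>j\<in>I. l j * B i j) + (\<Sum>j\<in>I. \<Sum>k\<in>I. l j * l k * B j k) \<le> \<rho> i"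
    then show thesis by (rule that)
  qed
  have E: "expectation (\<lambda>\<omega>. (y i \<omega> - (\<Sum>j\<in>I. l j * y j \<omega>))\<^sup>2) \<le> \<rho> i" if i: "i \<in> I" for i
  proof -
    have "(\<lambda>\<omega>. (y i \<omega> - (\<Sum>j\<in>I. l j * y j \<omega>))\<^sup>2)
        = (\<lambda>\<omega>. y i \<omega> * y i \<omega> - 2 * (\<Sum>j\<in>I. l j * (y i \<omega> * y j \<omega>)) + (\<Sum>j\<in>I. \<Sum>k\<in>I. l j * l k * (y j \<omega> * y k \<omega>)))"
    proof
      fix \<omega>
      have "(\<Sum>j\<in>I. \<Sum>k\<in>I. l j * l k * (y j \<omega> * y k \<omega>)) = (\<Sum>j\<in>I. l j * y j \<omega>) * (\<Sum>k\<in>I. l k * y k \<omega>)"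
        by (simp add: sum_product mult_ac)
      moreover have "(\<Sum>j\<in>I. l j * (y i \<omega> * y j \<omega>)) = y i \<omega> * (\<Sum>j\<in>I. l j * y j \<omega>)"
        by (simp add: sum_distrib_left mult_ac)
      ultimately show "(y i \<omega> - (\<Sum>j\<in>I. l j * y j \<omega>))\<^sup>2
          = y i \<omega> * y i \<omega> - 2 * (\<Sum>j\<in>I. l j * (y i \<omega> * y j \<omega>)) + (\<Sum>j\<in>I. \<Sum>k\<in>I. l j * l k * (y j \<omega> * y k \<omega>))"
        by (simp add: power2_eq_square algebra_simps)
    qed
    moreover have "integrable M (\<lambda>\<omega>. \<Sum>j\<in>I. l j * (y i \<omega> * y j \<omega>))"
      "integrable M (\<lambda>\<omega>. \<Sum>j\<in>I. \<Sum>k\<in>I. l j * l k * (y j \<omega> * y k \<omega>))"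
      using yint i by (auto intro!: Bochner_Integration.integrable_sum)
    moreover have "expectation (\<lambda>\<omega>. \<Sum>j\<in>I. l j * (y i \<omega> * y j \<omega>)) = (\<Sum>j\<in>I. l j * B i j)"
      using yint i by (subst Bochner_Integration.integral_sum) (auto simp: B_def)
    moreover have "expectation (\<lambda>\<omega>. \<Sum>j\<in>I. \<Sum>k\<in>I. l j * l k * (y j \<omega> * y k \<omega>)) = (\<Sum>j\<in>I. \<Sum>k\<in>I. l j * l k * B j k)"
    proof -
      have "expectation (\<lambda>\<omega>. \<Sum>j\<in>I. \<Sum>k\<in>I. l j * l k * (y j \<omega> * y k \<omega>)) = (\<Sum>j\<in>I. expectation (\<lambda>\<omega>. \<Sum>k\<in>I. l j * l k * (y j \<omega> * y k \<omega>)))"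
        using yint by (intro Bochner_Integration.integral_sum Bochner_Integration.integrable_sum) auto
      also have "\<dots> = (\<Sum>j\<in>I. \<Sum>k\<in>I. l j * l k * B j k)"
        using yint by (intro sum.cong refl, subst Bochner_Integration.integral_sum) (auto simp: B_def)
      finally show ?thesis .
    qed
    ultimately have "expectation (\<lambda>\<omega>. (y i \<omega> - (\<Sum>j\<in>I. l j * y j \<omega>))\<^sup>2)
        = B i i - 2 * (\<Sum>j\<in>I. l j * B i j) + (\<Sum>j\<in>I. \<Sum>k\<in>I. l j * l k * B j k)"
      using yint[OF i i] by (simp add: B_def)
    then show ?thesis using l[OF i] by simp
  qed
  show thesis
  proof (rule that[of "\<lambda>t. l (Some t)" "l None"])
    show "expectation (\<lambda>\<omega>. (X t \<omega> - ((\<Sum>s\<in>A. l (Some s) * X s \<omega>) + l None * p \<omega>))\<^sup>2) \<le> r" if "t \<in> A" for t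
      using E[of "Some t"] that by (simp add: sumI) (simp add: I_def y_def \<rho>_def add.commute)
    show "expectation (\<lambda>\<omega>. (p \<omega> - ((\<Sum>s\<in>A. l (Some s) * X s \<omega>) + l None * p \<omega>))\<^sup>2) \<le> r' - r"
      using E[of None] by (simp add: sumI) (simp add: I_def y_def \<rho>_def add.commute)
  qed
qed

end

definition lin_span :: "'t set \<Rightarrow> ('t \<Rightarrow> 'w \<Rightarrow> real) \<Rightarrow> ('w \<Rightarrow> real) set" where
  "lin_span F X = {Y. \<exists>l. Y = (\<lambda>\<omega>. \<Sum>t\<in>F. l t * X t \<omega>)}"

lemma lin_span_combination:
  assumes "Y \<in> lin_span F X" "Z \<in> lin_span F X"
  shows "(\<lambda>\<omega>. a * Y \<omega> + b * Z \<omega>) \<in> lin_span F X"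
proof -
  obtain l m where "Y = (\<lambda>\<omega>. \<Sum>t\<in>F. l t * X t \<omega>)" "Z = (\<lambda>\<omega>. \<Sum>t\<in>F. m t * X t \<omega>)"
    using assms unfolding lin_span_def by auto
  then have "(\<lambda>\<omega>. a * Y \<omega> + b * Z \<omega>) = (\<lambda>\<omega>. \<Sum>t\<in>F. (a * l t + b * m t) * X t \<omega>)"
    by (simp add: distrib_right sum.distrib sum_distrib_left mult.assoc)
  then show ?thesis unfolding lin_span_def by (intro CollectI exI)
qed

lemma lin_span_diff: "Y \<in> lin_span F X \<Longrightarrow> Z \<in> lin_span F X \<Longrightarrow> (\<lambda>\<omega>. Y \<omega> - Z \<omega>) \<in> lin_span F X"
  using lin_span_combination[of Y F X Z 1 "-1"] by simp

lemma lin_span_component: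
  assumes "finite F" "t \<in> F"
  shows "X t \<in> lin_span F X"
proof -
  have "X t = (\<lambda>\<omega>. \<Sum>s\<in>F. (if s = t then 1 else 0) * X s \<omega>)"
    using assms by (auto simp: if_distrib[of "\<lambda>a. a * _"] cong: if_cong)
  then show ?thesis unfolding lin_span_def by (intro CollectI exI)
qed

lemma lin_span_sum_subset:
  assumes "finite F" "A \<subseteq> F"
  shows "(\<lambda>\<omega>. \<Sum>t\<in>A. l t * X t \<omega>) \<in> lin_span F X"
proof -
  have "(\<lambda>\<omega>. \<Sum>t\<in>A. l t * X t \<omega>) = (\<lambda>\<omega>. \<Sum>t\<in>F. (if t \<in> A then l t else 0) * X t \<omega>)"
    using assms by (auto intro!: ext sum.mono_neutral_cong_left)
  then show ?thesis unfolding lin_span_def by (intro CollectI exI)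
qed

lemma gaussian_family_of_lin_span:
  assumes "gaussian_family M F X" "\<And>j. j \<in> J \<Longrightarrow> Z j \<in> lin_span F X"
  shows "gaussian_family M J Z"
  using assms(2) by (intro gaussian_family_linear_image[OF assms(1)]) (auto simp: lin_span_def)

lemma centered_normal_of_lin_span:
  "gaussian_family M F X \<Longrightarrow> Y \<in> lin_span F X \<Longrightarrow> centered_normal M Y"
  by (auto simp: lin_span_def gaussian_family_def)

context prob_space
begin

lemma expectation_square_sum2_le:
  fixes f g :: "'a \<Rightarrow> real"
  assumes "integrable M (\<lambda>\<omega>. (f \<omega>)\<^sup>2)" "integrable M (\<lambda>\<omega>. (g \<omega>)\<^sup>2)"
    "integrable M (\<lambda>\<omega>. (h \<omega>)\<^sup>2)" "\<And>\<omega>. h \<omega> = f \<omega> + g \<omega>"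
  shows "expectation (\<lambda>\<omega>. (h \<omega>)\<^sup>2) \<le> 2 * expectation (\<lambda>\<omega>. (f \<omega>)\<^sup>2) + 2 * expectation (\<lambda>\<omega>. (g \<omega>)\<^sup>2)"
proof -
  have "expectation (\<lambda>\<omega>. (h \<omega>)\<^sup>2) \<le> expectation (\<lambda>\<omega>. 2 * (f \<omega>)\<^sup>2 + 2 * (g \<omega>)\<^sup>2)"
  proof (rule integral_mono)
    fix \<omega>
    have "0 \<le> (f \<omega> - g \<omega>)\<^sup>2" by simp
    then show "(h \<omega>)\<^sup>2 \<le> 2 * (f \<omega>)\<^sup>2 + 2 * (g \<omega>)\<^sup>2"
      by (simp add: assms(4) power2_eq_square algebra_simps)
  qed (use assms in auto)
  then show ?thesis using assms by simp
qed

text \<open>Cells are represented by their labels: \<open>\<pi> m t\<close> is the label of the cell of level \<open>m\<close> containing \<open>t\<close>.\<close>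
lemma chaining_centers:
  fixes X :: "'t \<Rightarrow> 'a \<Rightarrow> real" and \<pi> :: "nat \<Rightarrow> 't \<Rightarrow> 'l"
  assumes fin: "finite F" and G: "gaussian_family M F X"
    and nest: "\<And>m s t. s \<in> F \<Longrightarrow> t \<in> F \<Longrightarrow> \<pi> (Suc m) s = \<pi> (Suc m) t \<Longrightarrow> \<pi> m s = \<pi> m t"
    and diam: "\<And>m s t. s \<in> F \<Longrightarrow> t \<in> F \<Longrightarrow> \<pi> m s = \<pi> m t \<Longrightarrow>
      expectation (\<lambda>\<omega>. (X s \<omega> - X t \<omega>)\<^sup>2) \<le> ((1/2)^m * D)\<^sup>2"
  obtains c where
    "\<And>m t. n \<le> m \<Longrightarrow> t \<in> F \<Longrightarrow> c m (\<pi> m t) \<in> lin_span F X"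
    "\<And>m t. n \<le> m \<Longrightarrow> t \<in> F \<Longrightarrow> expectation (\<lambda>\<omega>. (X t \<omega> - c m (\<pi> m t) \<omega>)\<^sup>2) \<le> ((1/2)^m * D)\<^sup>2 / 2"
    "\<And>m t. n \<le> m \<Longrightarrow> t \<in> F \<Longrightarrow>
      expectation (\<lambda>\<omega>. (c m (\<pi> m t) \<omega> - c (Suc m) (\<pi> (Suc m) t) \<omega>)\<^sup>2) \<le> 3/2 * ((1/2)^(Suc m) * D)\<^sup>2"
proof -
  \<comment> \<open>Half the squared diameter: Jung's bound for the squared radius, uniform in the
    dimension.\<close>
  define r where "r m = ((1/2)^m * D)\<^sup>2 / 2" for m
  have r_Suc: "r (Suc m) = r m / 4" for m by (simp add: r_def power2_eq_square)
  have r0: "0 \<le> r m" for m by (simp add: r_def)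
  have spanm: "Y \<in> borel_measurable M" and spansq: "integrable M (\<lambda>\<omega>. (Y \<omega>)\<^sup>2)" if "Y \<in> lin_span F X" for Y
    using centered_normal_of_lin_span[OF G that] by (auto intro: centered_normal_measurable centered_normal_square_integrable)
  have Xs: "X t \<in> lin_span F X" if "t \<in> F" for t using fin that by (rule lin_span_component)
  have step: "\<exists>c\<in>lin_span F X. (\<forall>t\<in>F. \<pi> m t = a \<longrightarrow> expectation (\<lambda>\<omega>. (X t \<omega> - c \<omega>)\<^sup>2) \<le> r m)
       \<and> expectation (\<lambda>\<omega>. (p \<omega> - c \<omega>)\<^sup>2) \<le> r' - r m"
    if a: "a \<in> \<pi> m ` F" and p: "p \<in> lin_span F X" and r': "r m \<le> r'"
      and dist: "\<And>t. t \<in> F \<Longrightarrow> \<pi> m t = a \<Longrightarrow> expectation (\<lambda>\<omega>. (X t \<omega> - p \<omega>)\<^sup>2) \<le> r'" for m a p r'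
  proof -
    let ?A = "{t\<in>F. \<pi> m t = a}"
    obtain l q where lq: "\<And>t. t \<in> ?A \<Longrightarrow> expectation (\<lambda>\<omega>. (X t \<omega> - ((\<Sum>s\<in>?A. l s * X s \<omega>) + q * p \<omega>))\<^sup>2) \<le> r m"
      "expectation (\<lambda>\<omega>. (p \<omega> - ((\<Sum>s\<in>?A. l s * X s \<omega>) + q * p \<omega>))\<^sup>2) \<le> r' - r m"
    proof (rule ball_center[of ?A X p "r m" r'])
      show "expectation (\<lambda>\<omega>. (X s \<omega> - X t \<omega>)\<^sup>2) \<le> 2 * r m" if "s \<in> ?A" "t \<in> ?A" for s t
        using diam[of s t m] that by (simp add: r_def)
      show "finite ?A" "?A \<noteq> {}" using a fin by auto
      show "X t \<in> borel_measurable M" "integrable M (\<lambda>\<omega>. (X t \<omega>)\<^sup>2)"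
        "expectation (\<lambda>\<omega>. (X t \<omega> - p \<omega>)\<^sup>2) \<le> r'" if "t \<in> ?A" for t
        using spanm[OF Xs] spansq[OF Xs] dist that by simp_all
      show "p \<in> borel_measurable M" "integrable M (\<lambda>\<omega>. (p \<omega>)\<^sup>2)"
        using spanm[OF p] spansq[OF p] by simp_all
      show "r m \<le> r'" by (rule r')
      fix l q
      assume "\<And>t. t \<in> ?A \<Longrightarrow> expectation (\<lambda>\<omega>. (X t \<omega> - ((\<Sum>s\<in>?A. l s * X s \<omega>) + q * p \<omega>))\<^sup>2) \<le> r m"
        "expectation (\<lambda>\<omega>. (p \<omega> - ((\<Sum>s\<in>?A. l s * X s \<omega>) + q * p \<omega>))\<^sup>2) \<le> r' - r m"
      then show thesis by (rule that)
    qed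
    let ?c = "\<lambda>\<omega>. (\<Sum>s\<in>?A. l s * X s \<omega>) + q * p \<omega>"
    have "?c \<in> lin_span F X"
      using lin_span_combination[OF lin_span_sum_subset[OF fin, of ?A l X] p, of 1 q] by simp
    then show ?thesis using lq by (intro bexI[of _ ?c]) auto
  qed
  define P where "P i c \<longleftrightarrow> (\<forall>t\<in>F. c (\<pi> (n + i) t) \<in> lin_span F X
      \<and> expectation (\<lambda>\<omega>. (X t \<omega> - c (\<pi> (n + i) t) \<omega>)\<^sup>2) \<le> r (n + i))" for i and c :: "'l \<Rightarrow> 'a \<Rightarrow> real"
  define Q where "Q i c c' \<longleftrightarrow> (\<forall>t\<in>F. expectation (\<lambda>\<omega>. (c (\<pi> (n + i) t) \<omega> - c' (\<pi> (n + Suc i) t) \<omega>)\<^sup>2)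
      \<le> r (n + i) - r (n + Suc i))" for i and c c' :: "'l \<Rightarrow> 'a \<Rightarrow> real"
  \<comment> \<open>Centres of one level are built relative to those of the preceding level, so the
    whole sequence has to be obtained by dependent choice.\<close>
  have "\<exists>f. \<forall>i. P i (f i) \<and> Q i (f i) (f (Suc i))"
  proof (rule dependent_nat_choice)
    have "\<exists>c. a \<in> \<pi> n ` F \<longrightarrow> c \<in> lin_span F X \<and> (\<forall>t\<in>F. \<pi> n t = a \<longrightarrow> expectation (\<lambda>\<omega>. (X t \<omega> - c \<omega>)\<^sup>2) \<le> r n)" for a
    proof (cases "a \<in> \<pi> n ` F")
      case True
      then obtain s where s: "s \<in> F" "a = \<pi> n s" by auto
      \<comment> \<open>At the starting level there is no parent. A point of the cell itself serves
        as \<open>p\<close>, with \<open>r' = 2 * r n\<close> from the diameter bound, and the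
        resulting estimate for the distance from \<open>p\<close> is discarded.\<close>
      have "\<exists>c\<in>lin_span F X. (\<forall>t\<in>F. \<pi> n t = a \<longrightarrow> expectation (\<lambda>\<omega>. (X t \<omega> - c \<omega>)\<^sup>2) \<le> r n)
         \<and> expectation (\<lambda>\<omega>. (X s \<omega> - c \<omega>)\<^sup>2) \<le> 2 * r n - r n"
        by (rule step[OF True Xs[OF s(1)]]) (use s r0[of n] diam in \<open>auto simp: r_def\<close>)
      then show ?thesis by blast
    qed simp
    then obtain c where c: "\<And>a. a \<in> \<pi> n ` F \<Longrightarrow> c a \<in> lin_span F X \<and> (\<forall>t\<in>F. \<pi> n t = a \<longrightarrow> expectation (\<lambda>\<omega>. (X t \<omega> - c a \<omega>)\<^sup>2) \<le> r n)"
      by metis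
    show "\<exists>c. P 0 c" by (rule exI[of _ c]) (use c in \<open>auto simp: P_def\<close>)
  next
    fix c i assume c: "P i c"
    let ?m = "n + i"
    define R where "R a c' \<longleftrightarrow> c' \<in> lin_span F X \<and> (\<forall>t\<in>F. \<pi> (Suc ?m) t = a \<longrightarrow>
        expectation (\<lambda>\<omega>. (X t \<omega> - c' \<omega>)\<^sup>2) \<le> r (Suc ?m) \<and>
        expectation (\<lambda>\<omega>. (c (\<pi> ?m t) \<omega> - c' \<omega>)\<^sup>2) \<le> r ?m - r (Suc ?m))" for a c'
    have "\<exists>c'. a \<in> \<pi> (Suc ?m) ` F \<longrightarrow> R a c'" for a
    proof (cases "a \<in> \<pi> (Suc ?m) ` F")
      case True
      then obtain s where s: "s \<in> F" "a = \<pi> (Suc ?m) s" by auto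
      have same: "\<pi> ?m t = \<pi> ?m s" if "t \<in> F" "\<pi> (Suc ?m) t = a" for t
        using nest[of t s ?m] that s by simp
      have "\<exists>c'\<in>lin_span F X. (\<forall>t\<in>F. \<pi> (Suc ?m) t = a \<longrightarrow> expectation (\<lambda>\<omega>. (X t \<omega> - c' \<omega>)\<^sup>2) \<le> r (Suc ?m))
         \<and> expectation (\<lambda>\<omega>. (c (\<pi> ?m s) \<omega> - c' \<omega>)\<^sup>2) \<le> r ?m - r (Suc ?m)"
      proof (rule step[OF True])
        show "c (\<pi> ?m s) \<in> lin_span F X" using c s by (simp add: P_def)
        show "r (Suc ?m) \<le> r ?m" using r0[of ?m] by (simp add: r_Suc)
        show "expectation (\<lambda>\<omega>. (X t \<omega> - c (\<pi> ?m s) \<omega>)\<^sup>2) \<le> r ?m" if "t \<in> F" "\<pi> (Suc ?m) t = a" for t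
          using c that same[OF that] by (auto simp: P_def)
      qed
      then obtain c' where "c' \<in> lin_span F X" "\<forall>t\<in>F. \<pi> (Suc ?m) t = a \<longrightarrow> expectation (\<lambda>\<omega>. (X t \<omega> - c' \<omega>)\<^sup>2) \<le> r (Suc ?m)"
        "expectation (\<lambda>\<omega>. (c (\<pi> ?m s) \<omega> - c' \<omega>)\<^sup>2) \<le> r ?m - r (Suc ?m)" by blast
      then show ?thesis using same by (intro exI[of _ c']) (simp add: R_def)
    qed simp
    then obtain c' where c': "\<And>a. a \<in> \<pi> (Suc ?m) ` F \<Longrightarrow> R a (c' a)"
      by metis
    show "\<exists>c'. P (Suc i) c' \<and> Q i c c'"
      by (rule exI[of _ c']) (use c' in \<open>auto simp: P_def Q_def R_def\<close>)
  qed
  then obtain f where f: "\<And>i. P i (f i)" "\<And>i. Q i (f i) (f (Suc i))" by blast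
  have f1: "f (m - n) (\<pi> m t) \<in> lin_span F X" "expectation (\<lambda>\<omega>. (X t \<omega> - f (m - n) (\<pi> m t) \<omega>)\<^sup>2) \<le> r m"
    if "n \<le> m" "t \<in> F" for m t
    using f(1)[of "m - n"] that by (auto simp: P_def)
  have f2: "expectation (\<lambda>\<omega>. (f (m - n) (\<pi> m t) \<omega> - f (Suc m - n) (\<pi> (Suc m) t) \<omega>)\<^sup>2) \<le> 3/2 * ((1/2)^(Suc m) * D)\<^sup>2"
    if "n \<le> m" "t \<in> F" for m t
  proof -
    \<comment> \<open>With d the diameter bound at the finer level, the two squared radii are 2 d^2
      and d^2 / 2. Their difference is 3/2 d^2, the bound on the squared link length.\<close>
    have eq: "3/2 * ((1/2)^(Suc m) * D)\<^sup>2 = r m - r (Suc m)" by (simp add: r_def power2_eq_square)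
    show ?thesis unfolding eq using f(2)[of "m - n"] that by (simp add: Q_def Suc_diff_le)
  qed
  show thesis
    by (rule that[of "\<lambda>m. f (m - n)"]) (use f1 f2 in \<open>auto simp: r_def\<close>)
qed

end

section \<open>The small ball estimate on finite index sets\<close>

context prob_space
begin

text \<open>Here \<open>\<eta>\<close> stands for \<epsilon> * \<sigma>, and
  \<open>2 * \<eta>\<close> is spent as \<open>7/4 * \<eta>\<close> on the links above level
  \<open>n\<close> and \<open>\<eta> / 12\<close> on each of three further steps. The hypotheses
  \<open>base\<close> and \<open>link\<close> are the small ball bounds for a designated centre and
  for a link to it; by \<open>psum\<close> all links above level \<open>n\<close> together succeed
  with probability at least 1/2. The bound depends on \<open>F\<close> only through numbers of
  cells, which is what permits the passage to an infinite index set.\<close>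

lemma gaussian_small_ball_finite:
  fixes X :: "'t \<Rightarrow> 'a \<Rightarrow> real" and \<pi> :: "nat \<Rightarrow> 't \<Rightarrow> 'l" and p :: "nat \<Rightarrow> 'l \<Rightarrow> real"
  assumes fin: "finite F" and G: "gaussian_family M F X"
    and nest: "\<And>m s t. s \<in> F \<Longrightarrow> t \<in> F \<Longrightarrow> \<pi> (Suc m) s = \<pi> (Suc m) t \<Longrightarrow> \<pi> m s = \<pi> m t"
    and diam: "\<And>m s t. s \<in> F \<Longrightarrow> t \<in> F \<Longrightarrow> \<pi> m s = \<pi> m t \<Longrightarrow>
      expectation (\<lambda>\<omega>. (X s \<omega> - X t \<omega>)\<^sup>2) \<le> ((1/2)^m * D)\<^sup>2"
    and sd: "\<And>t. t \<in> F \<Longrightarrow> 2 * expectation (\<lambda>\<omega>. (X t \<omega>)\<^sup>2) + D\<^sup>2 \<le> s0\<^sup>2"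
    and pos: "0 < D" "0 < \<eta>" "0 < s0" and kn: "k \<le> n"
    and \<kappa>: "0 < \<kappa>" "\<kappa> \<le> 1" and \<epsilon>: "0 < \<epsilon>" "\<epsilon> \<le> 1"
    and base: "\<kappa> * \<epsilon> \<le> min 1 (\<eta> / 12 / s0) / 3"
    and link: "\<epsilon> \<le> min 1 (\<eta> / 12 / (3 * ((1/2)^k * D))) / 3"
    and p01: "\<And>m t. n < m \<Longrightarrow> t \<in> F \<Longrightarrow> 0 < p m (\<pi> m t)" "\<And>m t. n < m \<Longrightarrow> t \<in> F \<Longrightarrow> p m (\<pi> m t) \<le> 1/2"
    and psum: "\<And>m'. (\<Sum>m\<in>{n<..m'}. \<Sum>a\<in>\<pi> m ` F. p m a) \<le> 1/4"
    and chain: "\<And>m' t. t \<in> F \<Longrightarrow> (\<Sum>m\<in>{n<..m'}. (1/2)^m * D * sqrt (ln (1 / p m (\<pi> m t)))) \<le> \<eta>"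
  shows "\<kappa> ^ card (\<pi> k ` F) * \<epsilon> ^ card (\<pi> n ` F) / 4 \<le> prob {\<omega>\<in>space M. \<forall>t\<in>F. \<bar>X t \<omega>\<bar> \<le> 2 * \<eta>}"
proof -
  have Xs: "X t \<in> lin_span F X" if "t \<in> F" for t using fin that by (rule lin_span_component)
  note cn = centered_normal_of_lin_span[OF G]
  have sq: "integrable M (\<lambda>\<omega>. (Y \<omega>)\<^sup>2)" if "Y \<in> lin_span F X" for Y
    using cn[OF that] by (rule centered_normal_square_integrable)
  obtain c where
    cs: "\<And>m t. n \<le> m \<Longrightarrow> t \<in> F \<Longrightarrow> c m (\<pi> m t) \<in> lin_span F X" and
    cX: "\<And>m t. n \<le> m \<Longrightarrow> t \<in> F \<Longrightarrow> expectation (\<lambda>\<omega>. (X t \<omega> - c m (\<pi> m t) \<omega>)\<^sup>2) \<le> ((1/2)^m * D)\<^sup>2 / 2" and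
    cc: "\<And>m t. n \<le> m \<Longrightarrow> t \<in> F \<Longrightarrow>
      expectation (\<lambda>\<omega>. (c m (\<pi> m t) \<omega> - c (Suc m) (\<pi> (Suc m) t) \<omega>)\<^sup>2) \<le> 3/2 * ((1/2)^(Suc m) * D)\<^sup>2"
  proof (rule chaining_centers[where \<pi> = \<pi> and D = D and n = n, OF fin G])
    show "\<pi> m s = \<pi> m t" if "s \<in> F" "t \<in> F" "\<pi> (Suc m) s = \<pi> (Suc m) t" for m s t
      using that by (rule nest)
    show "expectation (\<lambda>\<omega>. (X s \<omega> - X t \<omega>)\<^sup>2) \<le> ((1/2)^m * D)\<^sup>2" if "s \<in> F" "t \<in> F" "\<pi> m s = \<pi> m t" for m s t
      using that by (rule diam)
  qed (rule that)
  have nest_k: "\<pi> k s = \<pi> k t" if "s \<in> F" "t \<in> F" "\<pi> n s = \<pi> n t" for s t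
    using kn that by (induction n rule: dec_induct) (auto dest: nest)
  define \<rho> where "\<rho> m a = (SOME s. s \<in> F \<and> \<pi> m s = a)" for m a
  have \<rho>: "\<rho> m a \<in> F" "\<pi> m (\<rho> m a) = a" if "a \<in> \<pi> m ` F" for m a
    using someI_ex[of "\<lambda>s. s \<in> F \<and> \<pi> m s = a"] that by (auto simp: \<rho>_def)
  text \<open>Each cell of level \<open>k\<close> designates one of its subcells of level \<open>n\<close>; the others are linked to it.\<close>
  define des where "des b = \<pi> n (\<rho> k (\<pi> k (\<rho> n b)))" for b
  have des: "\<rho> k (\<pi> k (\<rho> n b)) \<in> F" "\<pi> k (\<rho> k (\<pi> k (\<rho> n b))) = \<pi> k (\<rho> n b)" if "b \<in> \<pi> n ` F" for b
    using \<rho>[of "\<pi> k (\<rho> n b)" k] \<rho>(1)[OF that] by auto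
  \<comment> \<open>\<open>b\<close> and \<open>des b\<close> lie in the same cell of level
    \<open>k\<close>, so a single link always ends at a centre that is bounded directly.\<close>
  have des_des: "des (des b) = des b" if "b \<in> \<pi> n ` F" for b
  proof -
    have "des b \<in> \<pi> n ` F" using des(1)[OF that] by (simp add: des_def)
    then have "\<pi> n (\<rho> n (des b)) = \<pi> n (\<rho> k (\<pi> k (\<rho> n b)))" "\<rho> n (des b) \<in> F"
      using \<rho> by (auto simp: des_def)
    then have "\<pi> k (\<rho> n (des b)) = \<pi> k (\<rho> n b)" using nest_k des[OF that] by metis
    then show ?thesis by (simp add: des_def)
  qed
  define S where "S = {b\<in>\<pi> n ` F. des b = b}"
  have "S \<subseteq> (\<lambda>a. \<pi> n (\<rho> k a)) ` \<pi> k ` F"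
  proof
    fix b assume "b \<in> S"
    then have "b \<in> \<pi> n ` F" "b = \<pi> n (\<rho> k (\<pi> k (\<rho> n b)))" by (auto simp: S_def des_def)
    then show "b \<in> (\<lambda>a. \<pi> n (\<rho> k a)) ` \<pi> k ` F" using \<rho>(1) by blast
  qed
  then have cardS: "card S \<le> card (\<pi> k ` F)"
    using fin by (meson card_image_le card_mono finite_imageI le_trans)
  define q where "q = \<eta> / (12 * D)"
  have q: "0 < q" using pos by (simp add: q_def)
  \<comment> \<open>The last level \<open>N\<close> may depend on \<open>F\<close>, because it does
    not enter the bound. It is taken so fine that for all points of \<open>F\<close> together the
    last step fails with probability at most 1/2. The threshold
    \<open>z = 4 * real (card F) + 2\<close> serves this through exp (-z) \<le> 1/z.\<close>
  obtain i where i: "(4 * real (card F) + 2) / q < 2 ^ i" using real_arch_pow[of 2] by auto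
  define N where "N = n + i"
  have nN: "n \<le> N" by (simp add: N_def)
  have term_small: "real (card F) * (2 * exp (- ((\<eta> / 12) / ((1/2)^N * D))\<^sup>2 / 2)) \<le> 1/2"
  proof -
    define z where "z = 4 * real (card F) + 2"
    define y where "y = (\<eta> / 12) / ((1/2)^N * D)"
    have "z < q * 2 ^ i" using i q by (simp add: z_def field_simps)
    also have "\<dots> \<le> q * 2 ^ N" using q by (simp add: N_def)
    also have "\<dots> = y" by (simp add: q_def y_def power_divide field_simps)
    finally have "z \<le> y" by simp
    then have "z * z \<le> y * y" by (intro mult_mono) (auto simp: z_def)
    moreover have "2 * z \<le> z * z" by (intro mult_right_mono) (auto simp: z_def)
    ultimately have "z \<le> y\<^sup>2 / 2" by (simp add: power2_eq_square)
    then have "exp (- y\<^sup>2 / 2) \<le> exp (- z)" by simp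
    also have "\<dots> \<le> 1 / z"
    proof -
      have "0 < z" "z \<le> exp z" using exp_ge_add_one_self[of z] by (auto simp: z_def)
      then show ?thesis unfolding exp_minus inverse_eq_divide by (intro divide_left_mono) auto
    qed
    finally have "real (card F) * (2 * exp (- y\<^sup>2 / 2)) \<le> real (card F) * (2 * (1 / z))"
      by (intro mult_left_mono) auto
    also have "\<dots> \<le> 1/2" by (simp add: z_def field_simps)
    finally show ?thesis by (simp add: y_def)
  qed
  define Y where "Y b = (if des b = b then c n b else (\<lambda>\<omega>. c n b \<omega> - c n (des b) \<omega>))" for b
  define L where "L m a = (\<lambda>\<omega>. c (m - 1) (\<pi> (m - 1) (\<rho> m a)) \<omega> - c m a \<omega>)" for m a
  define R where "R t = (\<lambda>\<omega>. X t \<omega> - c N (\<pi> N t) \<omega>)" for t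
  \<comment> \<open>The factor 7/4 is a rational upper bound for sqrt 3 = sqrt 2 * sqrt (3/2), the
    product of the Gaussian tail factor and the relative length of a link.\<close>
  define h where "h m a = 7/4 * ((1/2)^m * D) * sqrt (ln (1 / p m a))" for m a
  define J where "J = \<pi> n ` F <+> ((SIGMA m:{n<..N}. \<pi> m ` F) <+> F)"
  define Z where "Z = case_sum Y (case_sum (case_prod L) R)"
  define x where "x = case_sum (\<lambda>b :: 'l. \<eta> / 12) (case_sum (case_prod h) (\<lambda>t :: 't. \<eta> / 12))"
  have finJ: "finite J" using fin by (auto simp: J_def)
  have L_eq: "L (Suc m) (\<pi> (Suc m) t) = (\<lambda>\<omega>. c m (\<pi> m t) \<omega> - c (Suc m) (\<pi> (Suc m) t) \<omega>)" if "t \<in> F" for m t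
  proof -
    have a: "\<pi> (Suc m) t \<in> \<pi> (Suc m) ` F" using that by simp
    have "\<pi> m (\<rho> (Suc m) (\<pi> (Suc m) t)) = \<pi> m t"
      by (rule nest[OF \<rho>(1)[OF a] that \<rho>(2)[OF a]])
    then show ?thesis by (simp add: L_def)
  qed
  have cn_span: "c n b \<in> lin_span F X" if "b \<in> \<pi> n ` F" for b using cs[of n] that by auto
  have des_in: "des b \<in> \<pi> n ` F" if "b \<in> \<pi> n ` F" for b using des(1)[OF that] by (simp add: des_def)
  have Y_span: "Y b \<in> lin_span F X" if "b \<in> \<pi> n ` F" for b
    using cn_span[OF that] lin_span_diff[OF cn_span[OF that] cn_span[OF des_in[OF that]]] by (simp add: Y_def)
  have L_span: "L m a \<in> lin_span F X" if m: "n < m" and a: "a \<in> \<pi> m ` F" for m a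
  proof -
    obtain t m' where t: "t \<in> F" and am: "a = \<pi> m t" "m = Suc m'" using a m by (cases m) auto
    then have m': "n \<le> m'" "n \<le> Suc m'" using m by auto
    show ?thesis unfolding am L_eq[OF t] by (rule lin_span_diff[OF cs[OF m'(1) t] cs[OF m'(2) t]])
  qed
  have R_span: "R t \<in> lin_span F X" if "t \<in> F" for t
    using lin_span_diff[OF Xs cs] that nN by (simp add: R_def)
  have "gaussian_family M J Z"
    by (rule gaussian_family_of_lin_span[OF G]) (use Y_span L_span R_span in \<open>auto simp: J_def Z_def\<close>)
  then have "(\<Prod>i\<in>J. prob {\<omega>\<in>space M. \<bar>Z i \<omega>\<bar> \<le> x i}) \<le> prob {\<omega>\<in>space M. \<forall>i\<in>J. \<bar>Z i \<omega>\<bar> \<le> x i}"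
    by (rule sidak[OF finJ])
  also have "\<dots> \<le> prob {\<omega>\<in>space M. \<forall>t\<in>F. \<bar>X t \<omega>\<bar> \<le> 2 * \<eta>}"
  proof (rule finite_measure_mono)
    show "{\<omega>\<in>space M. \<forall>t\<in>F. \<bar>X t \<omega>\<bar> \<le> 2 * \<eta>} \<in> events"
    proof (rule sets.sets_Collect_finite_All[OF _ fin])
      fix t assume "t \<in> F"
      then have [measurable]: "X t \<in> borel_measurable M" using cn[OF Xs] by (auto intro: centered_normal_measurable)
      show "{\<omega>\<in>space M. \<bar>X t \<omega>\<bar> \<le> 2 * \<eta>} \<in> events" by measurable
    qed
    show "{\<omega>\<in>space M. \<forall>i\<in>J. \<bar>Z i \<omega>\<bar> \<le> x i} \<subseteq> {\<omega>\<in>space M. \<forall>t\<in>F. \<bar>X t \<omega>\<bar> \<le> 2 * \<eta>}"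
    proof safe
      fix \<omega> t assume \<omega>: "\<forall>i\<in>J. \<bar>Z i \<omega>\<bar> \<le> x i" and t: "t \<in> F"
      have Yb: "\<bar>Y b \<omega>\<bar> \<le> \<eta> / 12" if "b \<in> \<pi> n ` F" for b
        using \<omega>[rule_format, of "Inl b"] that by (auto simp: J_def Z_def x_def)
      have Lb: "\<bar>L m (\<pi> m t) \<omega>\<bar> \<le> h m (\<pi> m t)" if "n < m" "m \<le> N" for m
      proof -
        have "Inr (Inl (m, \<pi> m t)) \<in> J" unfolding J_def using that t by (intro InrI InlI SigmaI) auto
        with \<omega> have "\<bar>Z (Inr (Inl (m, \<pi> m t))) \<omega>\<bar> \<le> x (Inr (Inl (m, \<pi> m t)))" by blast
        then show ?thesis by (simp add: Z_def x_def)
      qed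
      have Rb: "\<bar>R t \<omega>\<bar> \<le> \<eta> / 12"
      proof -
        have "Inr (Inr t) \<in> J" unfolding J_def using t by (intro InrI)
        with \<omega> have "\<bar>Z (Inr (Inr t)) \<omega>\<bar> \<le> x (Inr (Inr t))" by blast
        then show ?thesis by (simp add: Z_def x_def)
      qed
      let ?b = "\<pi> n t"
      have b: "?b \<in> \<pi> n ` F" using t by simp
      have 1: "\<bar>c n ?b \<omega>\<bar> \<le> \<eta> / 6"
      proof (cases "des ?b = ?b")
        case True
        then show ?thesis using Yb[OF b] pos by (simp add: Y_def)
      next
        case False
        then have "\<bar>c n ?b \<omega> - c n (des ?b) \<omega>\<bar> \<le> \<eta> / 12" "\<bar>c n (des ?b) \<omega>\<bar> \<le> \<eta> / 12"
          using Yb[OF b] Yb[OF des_in[OF b]] des_des[OF b] by (simp_all add: Y_def)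
        then show ?thesis by linarith
      qed
      have 2: "\<bar>c n ?b \<omega> - c m (\<pi> m t) \<omega>\<bar> \<le> (\<Sum>j\<in>{n<..m}. h j (\<pi> j t))" if "n \<le> m" "m \<le> N" for m
        using that
      proof (induction m rule: dec_induct)
        case (step m)
        have "{n<..Suc m} = insert (Suc m) {n<..m}" using step by auto
        then show ?case
          using step Lb[of "Suc m"] unfolding L_eq[OF t] by simp
      qed simp
      have "(\<Sum>j\<in>{n<..N}. h j (\<pi> j t)) = 7/4 * (\<Sum>j\<in>{n<..N}. (1/2)^j * D * sqrt (ln (1 / p j (\<pi> j t))))"
        by (simp add: h_def sum_distrib_left mult.assoc)
      also have "\<dots> \<le> 7/4 * \<eta>" using chain[OF t, of N] by simp
      finally have "\<bar>c n ?b \<omega> - c N (\<pi> N t) \<omega>\<bar> \<le> 7/4 * \<eta>" using 2[OF nN] by simp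
      then show "\<bar>X t \<omega>\<bar> \<le> 2 * \<eta>" using 1 Rb unfolding R_def by linarith
    qed
  qed
  also have "(\<Prod>i\<in>J. prob {\<omega>\<in>space M. \<bar>Z i \<omega>\<bar> \<le> x i})
      = (\<Prod>b\<in>\<pi> n ` F. prob {\<omega>\<in>space M. \<bar>Y b \<omega>\<bar> \<le> \<eta> / 12})
        * ((\<Prod>(m, a)\<in>(SIGMA m:{n<..N}. \<pi> m ` F). prob {\<omega>\<in>space M. \<bar>L m a \<omega>\<bar> \<le> h m a})
        * (\<Prod>t\<in>F. prob {\<omega>\<in>space M. \<bar>R t \<omega>\<bar> \<le> \<eta> / 12}))"
    using fin by (simp add: J_def prod.Plus Z_def x_def split_beta)
  finally have sid: "(\<Prod>b\<in>\<pi> n ` F. prob {\<omega>\<in>space M. \<bar>Y b \<omega>\<bar> \<le> \<eta> / 12})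
        * ((\<Prod>(m, a)\<in>(SIGMA m:{n<..N}. \<pi> m ` F). prob {\<omega>\<in>space M. \<bar>L m a \<omega>\<bar> \<le> h m a})
        * (\<Prod>t\<in>F. prob {\<omega>\<in>space M. \<bar>R t \<omega>\<bar> \<le> \<eta> / 12})) \<le> prob {\<omega>\<in>space M. \<forall>t\<in>F. \<bar>X t \<omega>\<bar> \<le> 2 * \<eta>}" .
  \<comment> \<open>A loss of \<open>\<kappa>\<close> occurs only at the fixed points of
    \<open>des\<close>, of which there is at most one per cell of level \<open>k\<close>; as
    \<open>\<kappa>\<close> is at most 1, the number of those cells may replace
    \<open>card S\<close>.\<close>
  have "\<kappa> ^ card (\<pi> k ` F) * \<epsilon> ^ card (\<pi> n ` F) \<le> \<kappa> ^ card S * \<epsilon> ^ card (\<pi> n ` F)"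
    using cardS \<kappa> \<epsilon> by (intro mult_right_mono power_decreasing) auto
  also have "\<dots> = (\<Prod>b\<in>\<pi> n ` F. if des b = b then \<kappa> * \<epsilon> else \<epsilon>)"
  proof -
    have "(\<Prod>b\<in>\<pi> n ` F. if des b = b then \<kappa> * \<epsilon> else \<epsilon>) = (\<Prod>b\<in>\<pi> n ` F. (if des b = b then \<kappa> else 1) * \<epsilon>)"
      by (intro prod.cong) auto
    also have "\<dots> = (\<Prod>b\<in>\<pi> n ` F. if des b = b then \<kappa> else 1) * \<epsilon> ^ card (\<pi> n ` F)"
      by (simp add: prod.distrib)
    also have "(\<Prod>b\<in>\<pi> n ` F. if des b = b then \<kappa> else 1) = (\<Prod>b\<in>S. \<kappa>)"
      unfolding S_def using fin by (intro prod.inter_filter[symmetric]) simp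
    finally show ?thesis by simp
  qed
  also have "\<dots> \<le> (\<Prod>b\<in>\<pi> n ` F. prob {\<omega>\<in>space M. \<bar>Y b \<omega>\<bar> \<le> \<eta> / 12})"
  proof (intro prod_mono conjI)
    fix b assume b: "b \<in> \<pi> n ` F"
    then obtain t where t: "t \<in> F" "b = \<pi> n t" by auto
    have pow1: "((1/2)^n * D)\<^sup>2 \<le> ((1/2)^k * D)\<^sup>2"
      using kn pos by (intro power_mono mult_right_mono power_decreasing) auto
    have pow0: "((1/2)^n * D)\<^sup>2 \<le> D\<^sup>2"
      using pos by (intro power_mono mult_left_le_one_le) (auto intro: power_le_one)
    show "(if des b = b then \<kappa> * \<epsilon> else \<epsilon>) \<le> prob {\<omega>\<in>space M. \<bar>Y b \<omega>\<bar> \<le> \<eta> / 12}"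
    proof (cases "des b = b")
      case True
      \<comment> \<open>The centre lies within squared distance D^2 / 2 of \<open>X t\<close>, which
        is where the bound \<open>2 * expectation (\<lambda>\<omega>. (X t \<omega>)\<^sup>2) +
        D\<^sup>2\<close> in the hypothesis \<open>sd\<close> comes from.\<close>
      have "expectation (\<lambda>\<omega>. (c n b \<omega>)\<^sup>2) \<le> 2 * expectation (\<lambda>\<omega>. (X t \<omega>)\<^sup>2) + 2 * expectation (\<lambda>\<omega>. (c n b \<omega> - X t \<omega>)\<^sup>2)"
        by (rule expectation_square_sum2_le) (use sq[OF cn_span[OF b]] sq[OF Xs[OF t(1)]]
            sq[OF lin_span_diff[OF cn_span[OF b] Xs[OF t(1)]]] in auto)
      also have "\<dots> \<le> s0\<^sup>2" using cX[of n t] t pow0 sd[of t] by (simp add: power2_commute)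
      finally have "min 1 (\<eta> / 12 / s0) / 3 \<le> prob {\<omega>\<in>space M. \<bar>c n b \<omega>\<bar> \<le> \<eta> / 12}"
        using pos by (intro centered_normal_small_ball cn cn_span b) auto
      with base have "\<kappa> * \<epsilon> \<le> prob {\<omega>\<in>space M. \<bar>c n b \<omega>\<bar> \<le> \<eta> / 12}" by (rule order_trans)
      moreover have "Y b = c n b" using True by (simp add: Y_def)
      ultimately show ?thesis using True by (simp only: if_True refl)
    next
      case False
      define u where "u = \<rho> k (\<pi> k (\<rho> n b))"
      have u: "u \<in> F" "des b = \<pi> n u" using des(1)[OF b] by (auto simp: u_def des_def)
      have "\<pi> k (\<rho> n b) = \<pi> k t"
        by (rule nest_k[OF \<rho>(1)[OF b] t(1) trans[OF \<rho>(2)[OF b] t(2)]])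
      then have tu: "\<pi> k t = \<pi> k u" using des(2)[OF b] by (simp add: u_def)
      let ?f = "\<lambda>\<omega>. c n b \<omega> - X t \<omega>" and ?g = "\<lambda>\<omega>. X t \<omega> - X u \<omega>" and ?h = "\<lambda>\<omega>. X u \<omega> - c n (des b) \<omega>"
      let ?d = "((1/2)^k * D)\<^sup>2"
      have spans: "?f \<in> lin_span F X" "?g \<in> lin_span F X" "?h \<in> lin_span F X" "(\<lambda>\<omega>. ?g \<omega> + ?h \<omega>) \<in> lin_span F X"
        "(\<lambda>\<omega>. c n b \<omega> - c n (des b) \<omega>) \<in> lin_span F X"
        using lin_span_diff[OF Xs[OF t(1)] cn_span[OF des_in[OF b]]]
        by (auto intro!: lin_span_diff Xs t u cn_span b des_in)
      \<comment> \<open>Three hops: from the centre to its point \<open>t\<close>, from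
        \<open>t\<close> to \<open>u\<close> inside one cell of level \<open>k\<close>, and from
        \<open>u\<close> to the designated centre. Their bounds combine to 7 times
        \<open>?d\<close>, rounded up to the square of 3 * 2^-k D.\<close>
      have "expectation (\<lambda>\<omega>. (c n b \<omega> - c n (des b) \<omega>)\<^sup>2) \<le> 2 * expectation (\<lambda>\<omega>. (?f \<omega>)\<^sup>2) + 2 * expectation (\<lambda>\<omega>. (?g \<omega> + ?h \<omega>)\<^sup>2)"
        by (rule expectation_square_sum2_le) (use spans[THEN sq] in auto)
      also have "\<dots> \<le> 2 * expectation (\<lambda>\<omega>. (?f \<omega>)\<^sup>2) + 2 * (2 * expectation (\<lambda>\<omega>. (?g \<omega>)\<^sup>2) + 2 * expectation (\<lambda>\<omega>. (?h \<omega>)\<^sup>2))"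
        by (intro add_left_mono mult_left_mono expectation_square_sum2_le) (use spans[THEN sq] in auto)
      also have "\<dots> \<le> 2 * (?d / 2) + 2 * (2 * ?d + 2 * (?d / 2))"
      proof -
        have "expectation (\<lambda>\<omega>. (?f \<omega>)\<^sup>2) \<le> ?d / 2" using cX[of n t] t pow1 by (simp add: power2_commute)
        moreover have "expectation (\<lambda>\<omega>. (?g \<omega>)\<^sup>2) \<le> ?d" using diam[OF t(1) u(1) tu] .
        moreover have "expectation (\<lambda>\<omega>. (?h \<omega>)\<^sup>2) \<le> ?d / 2" using cX[of n u] u pow1 by simp
        ultimately show ?thesis by (intro add_mono mult_left_mono) auto
      qed
      also have "\<dots> \<le> (3 * ((1/2)^k * D))\<^sup>2" unfolding power_mult_distrib[of 3] by simp
      finally have "min 1 (\<eta> / 12 / (3 * ((1/2)^k * D))) / 3 \<le> prob {\<omega>\<in>space M. \<bar>c n b \<omega> - c n (des b) \<omega>\<bar> \<le> \<eta> / 12}"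
        using pos by (intro centered_normal_small_ball cn spans) auto
      with link have "\<epsilon> \<le> prob {\<omega>\<in>space M. \<bar>c n b \<omega> - c n (des b) \<omega>\<bar> \<le> \<eta> / 12}" by (rule order_trans)
      moreover have "Y b = (\<lambda>\<omega>. c n b \<omega> - c n (des b) \<omega>)" using False by (simp add: Y_def)
      ultimately show ?thesis using False by (simp only: if_False)
    qed
  qed (use \<kappa> \<epsilon> in auto)
  finally have P1: "\<kappa> ^ card (\<pi> k ` F) * \<epsilon> ^ card (\<pi> n ` F) \<le> (\<Prod>b\<in>\<pi> n ` F. prob {\<omega>\<in>space M. \<bar>Y b \<omega>\<bar> \<le> \<eta> / 12})" .
  let ?\<Sigma> = "SIGMA m:{n<..N}. \<pi> m ` F"
  have "1/2 \<le> 1 - (\<Sum>(m, a)\<in>?\<Sigma>. 2 * p m a)"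
  proof -
    have "(\<Sum>(m, a)\<in>?\<Sigma>. 2 * p m a) = 2 * (\<Sum>m\<in>{n<..N}. \<Sum>a\<in>\<pi> m ` F. p m a)"
      using fin by (subst sum.Sigma[symmetric]) (auto simp: sum_distrib_left)
    then show ?thesis using psum[of N] by simp
  qed
  also have "\<dots> = 1 - (\<Sum>i\<in>?\<Sigma>. 2 * p (fst i) (snd i))" by (simp add: split_beta)
  also have "\<dots> \<le> (\<Prod>i\<in>?\<Sigma>. 1 - 2 * p (fst i) (snd i))"
    by (rule Weierstrass_prod_ineq) (use p01 in \<open>force simp: less_imp_le\<close>)
  also have "\<dots> \<le> (\<Prod>i\<in>?\<Sigma>. prob {\<omega>\<in>space M. \<bar>L (fst i) (snd i) \<omega>\<bar> \<le> h (fst i) (snd i)})"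
  proof (intro prod_mono conjI)
    fix i assume i: "i \<in> ?\<Sigma>"
    then obtain m t where m: "n \<le> m" and t: "t \<in> F" and imt: "i = (Suc m, \<pi> (Suc m) t)"
      by (auto) (metis Suc_leI Suc_le_mono gr_implies_not0 less_Suc_eq_le not0_implies_Suc)
    let ?p = "p (Suc m) (\<pi> (Suc m) t)" and ?d = "(1/2)^(Suc m) * D"
    have p: "0 < ?p" "?p \<le> 1/2" using p01[of "Suc m" t] m t by auto
    then show "0 \<le> 1 - 2 * p (fst i) (snd i)" by (simp add: imt)
    define l where "l = ln (1 / ?p)"
    have l: "0 \<le> l" "exp (- l) = ?p" using p by (auto simp: l_def ln_div)
    \<comment> \<open>Chosen so that the half-width \<open>h\<close> is sqrt (2 log (1/p)) times
      \<open>s\<close>, whence the tail is exactly \<open>2 * ?p\<close>. It bounds the standard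
      deviation of the link because 3/2 = 48/32 is below 49/32.\<close>
    define s where "s = 7/4 * ?d / sqrt 2"
    have s: "0 < s" using pos by (simp add: s_def)
    have "1 - 2 * exp (- (h (Suc m) (\<pi> (Suc m) t) / s)\<^sup>2 / 2) \<le> prob {\<omega>\<in>space M. \<bar>L (Suc m) (\<pi> (Suc m) t) \<omega>\<bar> \<le> h (Suc m) (\<pi> (Suc m) t)}"
    proof (rule centered_normal_concentration)
      show "centered_normal M (L (Suc m) (\<pi> (Suc m) t))" by (rule cn[OF L_span]) (use m t in auto)
      have "expectation (\<lambda>\<omega>. (L (Suc m) (\<pi> (Suc m) t) \<omega>)\<^sup>2) \<le> 3/2 * ?d\<^sup>2"
        unfolding L_eq[OF t] using cc[OF m t] .
      also have "\<dots> \<le> 49/32 * ?d\<^sup>2" by (intro mult_right_mono) auto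
      also have "\<dots> = s\<^sup>2" by (simp add: s_def power_divide power_mult_distrib)
      finally show "expectation (\<lambda>\<omega>. (L (Suc m) (\<pi> (Suc m) t) \<omega>)\<^sup>2) \<le> s\<^sup>2" .
      show "0 \<le> h (Suc m) (\<pi> (Suc m) t)" using pos l by (simp add: h_def l_def[symmetric])
    qed (rule s)
    moreover have "h (Suc m) (\<pi> (Suc m) t) / s = sqrt 2 * sqrt l"
      using pos by (simp add: h_def s_def l_def)
    ultimately show "1 - 2 * p (fst i) (snd i) \<le> prob {\<omega>\<in>space M. \<bar>L (fst i) (snd i) \<omega>\<bar> \<le> h (fst i) (snd i)}"
      using l by (simp add: imt power_mult_distrib)
  qed
  finally have P2: "1/2 \<le> (\<Prod>(m, a)\<in>?\<Sigma>. prob {\<omega>\<in>space M. \<bar>L m a \<omega>\<bar> \<le> h m a})"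
    by (simp add: split_beta)
  define e where "e = 2 * exp (- ((\<eta> / 12) / ((1/2)^N * D))\<^sup>2 / 2)"
  have "1/2 \<le> (\<Prod>t\<in>F. prob {\<omega>\<in>space M. \<bar>R t \<omega>\<bar> \<le> \<eta> / 12})"
  proof (cases "F = {}")
    case False
    then have "1 \<le> real (card F)" using fin by (simp add: Suc_leI card_gt_0_iff)
    moreover have e0: "0 \<le> e" by (simp add: e_def)
    ultimately have "1 * e \<le> real (card F) * e" by (rule mult_right_mono)
    moreover have Fe: "real (card F) * e \<le> 1/2" unfolding e_def by (rule term_small)
    ultimately have e1: "0 \<le> e" "e \<le> 1" using e0 by auto
    have "1/2 \<le> 1 - (\<Sum>t\<in>F. e)" using Fe by simp
    also have "\<dots> \<le> (\<Prod>t\<in>F. 1 - e)" by (rule Weierstrass_prod_ineq) (use e1 in auto)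
    also have "\<dots> \<le> (\<Prod>t\<in>F. prob {\<omega>\<in>space M. \<bar>R t \<omega>\<bar> \<le> \<eta> / 12})"
    proof (intro prod_mono conjI)
      fix t assume t: "t \<in> F"
      have "expectation (\<lambda>\<omega>. (R t \<omega>)\<^sup>2) \<le> ((1/2)^N * D)\<^sup>2 / 2" unfolding R_def by (rule cX[OF nN t])
      also have "\<dots> \<le> ((1/2)^N * D)\<^sup>2" by simp
      finally show "1 - e \<le> prob {\<omega>\<in>space M. \<bar>R t \<omega>\<bar> \<le> \<eta> / 12}"
        unfolding e_def using pos t by (intro centered_normal_concentration cn R_span) auto
    qed (use e1 in simp)
    finally show ?thesis .
  qed simp
  then have "\<kappa> ^ card (\<pi> k ` F) * \<epsilon> ^ card (\<pi> n ` F) * (1/2 * (1/2))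
    \<le> (\<Prod>b\<in>\<pi> n ` F. prob {\<omega>\<in>space M. \<bar>Y b \<omega>\<bar> \<le> \<eta> / 12})
        * ((\<Prod>(m, a)\<in>?\<Sigma>. prob {\<omega>\<in>space M. \<bar>L m a \<omega>\<bar> \<le> h m a})
        * (\<Prod>t\<in>F. prob {\<omega>\<in>space M. \<bar>R t \<omega>\<bar> \<le> \<eta> / 12}))"
    using \<kappa> \<epsilon> P2 by (intro mult_mono P1) (auto intro!: prod_nonneg mult_nonneg_nonneg)
  with sid show ?thesis by simp
qed

end

section \<open>Separability and the chaining sums\<close>

lemma part_at_eq:
  assumes "partition_on T P" "A \<in> P" "t \<in> A"
  shows "part_at P t = A"
  unfolding part_at_def
proof (rule the_equality)
  fix B assume "B \<in> P \<and> t \<in> B"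
  then show "B = A" using assms by (metis IntI disjointD empty_iff partition_onD2)
qed (use assms in auto)

lemma part_at_mem:
  assumes "partition_on T P" "t \<in> T"
  shows "part_at P t \<in> P" "t \<in> part_at P t"
proof -
  obtain A where "A \<in> P" "t \<in> A" using assms by (auto simp: partition_on_def)
  then show "part_at P t \<in> P" "t \<in> part_at P t" using part_at_eq[OF assms(1)] by auto
qed

lemma part_at_refines:
  assumes "refines T P Q" "t \<in> T"
  shows "part_at P t \<subseteq> part_at Q t"
proof -
  have P: "partition_on T P" and Q: "partition_on T Q" using assms(1) by (auto simp: refines_def)
  obtain B where "B \<in> Q" "part_at P t \<subseteq> B"
    using assms(1) part_at_mem(1)[OF P assms(2)] by (auto simp: refines_def)
  then show ?thesis using part_at_eq[OF Q, of B t] part_at_mem(2)[OF P assms(2)] by auto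
qed

lemma part_at_mono:
  assumes "\<And>k. refines T (\<P> (Suc k)) (\<P> k)" "t \<in> T" "m \<le> m'"
  shows "part_at (\<P> m') t \<subseteq> part_at (\<P> m) t"
  using assms(3) by (induction m' rule: dec_induct) (use part_at_refines[OF assms(1,2)] in auto)

lemma (in prob_space) countable_slab_limit:
  fixes X :: "'t \<Rightarrow> 'a \<Rightarrow> real"
  assumes S: "countable S" and X: "\<And>t. t \<in> S \<Longrightarrow> X t \<in> borel_measurable M"
    and q: "\<And>F. finite F \<Longrightarrow> F \<subseteq> S \<Longrightarrow> q \<le> prob {\<omega>\<in>space M. \<forall>t\<in>F. \<bar>X t \<omega>\<bar> \<le> b}"
  shows "q \<le> prob {\<omega>\<in>space M. \<forall>t\<in>S. \<bar>X t \<omega>\<bar> \<le> b}"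
proof (cases "S = {}")
  case True
  then show ?thesis using q[of "{}"] by simp
next
  case False
  define A where "A k = {\<omega>\<in>space M. \<forall>t\<in>from_nat_into S ` {..k}. \<bar>X t \<omega>\<bar> \<le> b}" for k :: nat
  have inS: "from_nat_into S k \<in> S" for k using False by (rule from_nat_into)
  have A: "A k \<in> events" for k
    unfolding A_def
  proof (rule sets.sets_Collect_finite_All)
    fix t assume "t \<in> from_nat_into S ` {..k}"
    then have [measurable]: "X t \<in> borel_measurable M" using inS by (intro X) auto
    show "{\<omega>\<in>space M. \<bar>X t \<omega>\<bar> \<le> b} \<in> events" by measurable
  qed simp
  have "(\<Inter>k. A k) = {\<omega>\<in>space M. \<forall>t\<in>range (from_nat_into S). \<bar>X t \<omega>\<bar> \<le> b}"
    by (auto simp: A_def)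
  also have "range (from_nat_into S) = S" using False S by (rule range_from_nat_into)
  finally have eq: "(\<Inter>k. A k) = {\<omega>\<in>space M. \<forall>t\<in>S. \<bar>X t \<omega>\<bar> \<le> b}" .
  have "decseq A" unfolding decseq_def A_def by fastforce
  then have "(\<lambda>k. prob (A k)) \<longlonglongrightarrow> prob (\<Inter>k. A k)"
    using A by (intro finite_Lim_measure_decseq) auto
  moreover have "q \<le> prob (A k)" for k
    unfolding A_def using inS by (intro q) auto
  ultimately show ?thesis
    unfolding eq by (intro LIMSEQ_le_const) auto
qed

text \<open>The supremum over an uncountable \<open>T\<close> need not be measurable for
  \<open>M\<close>. Separability makes its event differ from the countable one by a subset of a null
  set only, so it is measurable for the completion and has the same probability there. The countable
  event is a decreasing limit of finite ones.\<close>

lemma (in prob_space) d_separable_sup_prob_ge: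
  fixes X :: "'t \<Rightarrow> 'a \<Rightarrow> real"
  assumes sep: "d_separable M T X" and X: "\<And>t. t \<in> T \<Longrightarrow> X t \<in> borel_measurable M"
    and q: "\<And>F. finite F \<Longrightarrow> F \<subseteq> T \<Longrightarrow> q \<le> prob {\<omega>\<in>space M. \<forall>t\<in>F. \<bar>X t \<omega>\<bar> \<le> b}"
  shows "q \<le> measure (completion M) {\<omega>\<in>space M. (SUP t\<in>T. ereal \<bar>X t \<omega>\<bar>) \<le> ereal b}"
proof -
  obtain S N where SN: "countable S \<and> S \<subseteq> T \<and> N \<in> null_sets M \<and>
      (\<forall>\<omega>\<in>space M - N. \<forall>t\<in>T. \<forall>\<delta>>0. X t \<omega> \<in> closure {X s \<omega> | s. s \<in> S \<and> proc_dist M X s t < \<delta>})"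
    using sep unfolding d_separable_def by (elim exE) (rule that)
  have S: "countable S" "S \<subseteq> T" and N: "N \<in> null_sets M" using SN by simp_all
  have cl: "X t \<omega> \<in> closure {X s \<omega> |s. s \<in> S \<and> proc_dist M X s t < \<delta>}"
    if "\<omega> \<in> space M - N" "t \<in> T" "0 < \<delta>" for \<omega> t \<delta>
    using SN[THEN conjunct2, THEN conjunct2, THEN conjunct2, rule_format, OF that] .
  let ?E = "{\<omega>\<in>space M. (SUP t\<in>T. ereal \<bar>X t \<omega>\<bar>) \<le> ereal b}"
  let ?A = "{\<omega>\<in>space M. \<forall>t\<in>S. \<bar>X t \<omega>\<bar> \<le> b}"
  have E: "?E = {\<omega>\<in>space M. \<forall>t\<in>T. \<bar>X t \<omega>\<bar> \<le> b}" by (simp add: SUP_le_iff)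
  have A: "?A \<in> events"
  proof (rule sets.sets_Collect_countable_All'[OF _ S(1)])
    fix t assume "t \<in> S"
    then have [measurable]: "X t \<in> borel_measurable M" using S by (intro X) auto
    show "{\<omega>\<in>space M. \<bar>X t \<omega>\<bar> \<le> b} \<in> events" by measurable
  qed
  have "\<bar>X t \<omega>\<bar> \<le> b" if \<omega>: "\<omega> \<in> ?A - N" and t: "t \<in> T" for \<omega> t
  proof -
    have "X t \<omega> \<in> closure {X s \<omega> |s. s \<in> S \<and> proc_dist M X s t < 1}" using \<omega> t by (intro cl) auto
    also have "\<dots> \<subseteq> {-b..b}"
      by (rule closure_minimal) (use \<omega> in \<open>auto simp: abs_le_iff\<close>)
    finally show ?thesis by auto
  qed
  then have sub: "?A - N \<subseteq> ?E" unfolding E by auto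
  have "?E \<subseteq> ?A" unfolding E using S by auto
  then have eqE: "?E = (?A - N) \<union> (?E \<inter> N)" using sub by auto
  have nul: "?E \<inter> N \<in> null_sets (completion M)"
    using N by (intro null_sets_completion_subset[OF Int_lower2] null_sets_completionI)
  have "?A - N \<in> sets (completion M)" using A N by auto
  then have "?E \<in> sets (completion M)"
    by (subst eqE) (intro sets.Un null_setsD2[OF nul])
  then have "measure (completion M) (?A - N) \<le> measure (completion M) ?E"
    using sub by (intro finite_measure.finite_measure_mono) (auto intro!: finite_measureI simp: emeasure_eq_measure)
  moreover have "measure (completion M) (?A - N) = prob (?A - N)" using A N by (intro measure_completion) auto
  moreover have "prob (?A - N) = prob ?A" using A N by (rule measure_Diff_null_set)
  moreover have "q \<le> prob ?A"
  proof (rule countable_slab_limit[OF S(1)])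
    show "X t \<in> borel_measurable M" if "t \<in> S" for t
      by (rule X) (use that S(2) in auto)
    show "q \<le> prob {\<omega>\<in>space M. \<forall>t\<in>F. \<bar>X t \<omega>\<bar> \<le> b}" if "finite F" "F \<subseteq> S" for F
      by (rule q) (use that S(2) in auto)
  qed
  ultimately show ?thesis by simp
qed

section \<open>Finiteness and monotonicity of the chaining sums\<close>

definition chain_term :: "(nat \<Rightarrow> 't set set) \<Rightarrow> 't measure \<Rightarrow> real \<Rightarrow> (nat \<Rightarrow> real) \<Rightarrow> 't \<Rightarrow> nat \<Rightarrow> ennreal" where
  "chain_term \<P> \<mu> a v t m = ennreal ((1 / 2) ^ m * a) * sqrt_log (v m) (measure \<mu> (part_at (\<P> m) t))"

lemma chain_tail_eq: "chain_tail T \<P> \<mu> a v n = (SUP t\<in>T. \<Sum>k. chain_term \<P> \<mu> a v t (n + 1 + k))"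
  by (simp add: chain_tail_def chain_term_def Let_def)

lemma chain_tail_ge_sum:
  assumes "t \<in> T"
  shows "(\<Sum>m\<in>{n<..m'}. chain_term \<P> \<mu> a v t m) \<le> chain_tail T \<P> \<mu> a v n"
proof -
  have "(\<Sum>m\<in>{n<..m'}. chain_term \<P> \<mu> a v t m) = (\<Sum>k<m' - n. chain_term \<P> \<mu> a v t (n + 1 + k))"
    by (rule sum.reindex_bij_witness[of _ "\<lambda>k. n + 1 + k" "\<lambda>m. m - (n + 1)"]) auto
  also have "\<dots> \<le> (\<Sum>k. chain_term \<P> \<mu> a v t (n + 1 + k))"
    by (intro sum_le_suminf) auto
  also have "\<dots> \<le> chain_tail T \<P> \<mu> a v n"
    unfolding chain_tail_eq using assms by (rule SUP_upper)
  finally show ?thesis .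
qed

lemma sum_lessThan_add:
  fixes f :: "nat \<Rightarrow> 'a :: comm_monoid_add"
  shows "sum f {..<n + N} = sum f {..<n} + (\<Sum>k<N. f (n + k))"
  by (induction N) (auto simp: add.assoc)

lemma suminf_le_split_ennreal:
  fixes f :: "nat \<Rightarrow> ennreal"
  shows "(\<Sum>k. f k) \<le> sum f {..<n} + (\<Sum>k. f (n + k))"
proof (rule suminf_le_const)
  fix N
  have "sum f {..<N} \<le> sum f {..<n + N}" by (intro sum_mono2) auto
  also have "\<dots> \<le> sum f {..<n} + (\<Sum>k. f (n + k))"
    unfolding sum_lessThan_add by (intro add_left_mono sum_le_suminf) auto
  finally show "sum f {..<N} \<le> sum f {..<n} + (\<Sum>k. f (n + k))" .
qed simp

lemma suminf_offset_le_ennreal: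
  fixes f :: "nat \<Rightarrow> ennreal"
  shows "(\<Sum>k. f (n + k)) \<le> (\<Sum>k. f k)"
proof (rule suminf_le_const)
  fix N
  have "(\<Sum>k<N. f (n + k)) \<le> sum f {..<n} + (\<Sum>k<N. f (n + k))" by simp
  also have "\<dots> \<le> (\<Sum>k. f k)"
    unfolding sum_lessThan_add[symmetric] by (intro sum_le_suminf) auto
  finally show "(\<Sum>k<N. f (n + k)) \<le> (\<Sum>k. f k)" .
qed simp

lemma chain_tail_antimono:
  assumes "n \<le> n'"
  shows "chain_tail T \<P> \<mu> a v n' \<le> chain_tail T \<P> \<mu> a v n"
  unfolding chain_tail_eq
proof (rule SUP_mono')
  fix t
  have "(\<Sum>k. chain_term \<P> \<mu> a v t (n + 1 + (n' - n + k))) \<le> (\<Sum>k. chain_term \<P> \<mu> a v t (n + 1 + k))"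
    by (rule suminf_offset_le_ennreal[of "\<lambda>k. chain_term \<P> \<mu> a v t (n + 1 + k)"])
  moreover have "n + 1 + (n' - n + k) = n' + 1 + k" for k using assms by simp
  ultimately show "(\<Sum>k. chain_term \<P> \<mu> a v t (n' + 1 + k)) \<le> (\<Sum>k. chain_term \<P> \<mu> a v t (n + 1 + k))"
    by (simp only:)
qed

lemma chain_term_le_tail:
  assumes "t \<in> T" "n < m"
  shows "chain_term \<P> \<mu> a v t m \<le> chain_tail T \<P> \<mu> a v n"
proof -
  have "chain_term \<P> \<mu> a v t m \<le> (\<Sum>j\<in>{n<..m}. chain_term \<P> \<mu> a v t j)"
    using assms by (intro member_le_sum) auto
  also have "\<dots> \<le> chain_tail T \<P> \<mu> a v n" by (rule chain_tail_ge_sum[OF assms(1)])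
  finally show ?thesis .
qed

lemma chain_term_eq_top_iff:
  assumes "0 < a"
  shows "chain_term \<P> \<mu> a v t m = \<infinity> \<longleftrightarrow> measure \<mu> (part_at (\<P> m) t) = 0"
  using assms by (auto simp: chain_term_def sqrt_log_def ennreal_mult_eq_top_iff)

text \<open>A null cell at a level above \<open>n\<close> contributes an infinite term to the tail.
  So the fine cells have positive measure, and a coarse cell contains a fine one around the same
  point.\<close>

lemma chain_tail_finite_imp_pos:
  fixes \<mu> :: "'t measure"
  assumes \<mu>: "finite_measure \<mu>" "\<And>k. \<P> k \<subseteq> sets \<mu>" and ref: "\<And>k. refines T (\<P> (Suc k)) (\<P> k)"
    and a: "0 < a" and H: "chain_tail T \<P> \<mu> a v n < \<infinity>" and t: "t \<in> T"
  shows "0 < measure \<mu> (part_at (\<P> m) t)"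
proof -
  have part: "partition_on T (\<P> k)" for k using ref by (auto simp: refines_def)
  define m' where "m' = max m (Suc n)"
  have "chain_term \<P> \<mu> a v t m' < \<infinity>"
    by (rule le_less_trans[OF chain_term_le_tail[OF t] H]) (simp add: m'_def)
  then have "measure \<mu> (part_at (\<P> m') t) \<noteq> 0"
    using chain_term_eq_top_iff[OF a, of \<P> \<mu> v t m'] by auto
  then have "0 < measure \<mu> (part_at (\<P> m') t)" using measure_nonneg[of \<mu>] by (simp add: less_le)
  also have "\<dots> \<le> measure \<mu> (part_at (\<P> m) t)"
  proof (rule finite_measure.finite_measure_mono[OF \<mu>(1)])
    show "part_at (\<P> m') t \<subseteq> part_at (\<P> m) t"
      by (rule part_at_mono[where \<P> = \<P>, OF ref t]) (simp add: m'_def)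
    show "part_at (\<P> m) t \<in> sets \<mu>" using part_at_mem(1)[OF part t] \<mu>(2) by blast
  qed
  finally show ?thesis .
qed

text \<open>A term depends on \<open>t\<close> only through its cell, and each level has finitely
  many cells; so the supremum of a single term is a maximum of finite values. Only finitely many
  terms separate the tail from 0 and the tail from \<open>n\<close>.\<close>

lemma chain_tail_0_finite:
  fixes \<mu> :: "'t measure"
  assumes \<mu>: "finite_measure \<mu>" "\<And>k. \<P> k \<subseteq> sets \<mu>" and ref: "\<And>k. refines T (\<P> (Suc k)) (\<P> k)"
    and fin: "\<And>k. finite (\<P> k)"
    and a: "0 < a" and H: "chain_tail T \<P> \<mu> a v n < \<infinity>"
  shows "chain_tail T \<P> \<mu> a v 0 < \<infinity>"
proof -
  have part: "partition_on T (\<P> k)" for k using ref by (auto simp: refines_def)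
  define f where "f = chain_term \<P> \<mu> a v"
  have f_fin: "f t m < \<infinity>" if "t \<in> T" for t m
    using chain_tail_finite_imp_pos[where \<P> = \<P>, OF \<mu> ref a H that, of m] chain_term_eq_top_iff[OF a, of \<P> \<mu> v t m]
    by (auto simp: f_def less_top)
  define B where "B m = (SUP t\<in>T. f t m)" for m
  have B_fin: "B m < \<infinity>" for m
  proof (cases "T = {}")
    case False
    have "(\<lambda>t. f t m) ` T \<subseteq> (\<lambda>A. ennreal ((1 / 2) ^ m * a) * sqrt_log (v m) (measure \<mu> A)) ` \<P> m"
      using part_at_mem(1)[OF part] by (auto simp: f_def chain_term_def)
    then have "finite ((\<lambda>t. f t m) ` T)" using fin by (meson finite_imageI finite_subset)
    then have "B m \<in> (\<lambda>t. f t m) ` T"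
      unfolding B_def using False by (subst Max_Sup[symmetric]) auto
    then show ?thesis using f_fin by auto
  qed (simp add: B_def bot_ennreal)
  have "chain_tail T \<P> \<mu> a v 0 \<le> (\<Sum>k<n. B (0 + 1 + k)) + chain_tail T \<P> \<mu> a v n"
    unfolding chain_tail_eq[of T \<P> \<mu> a v 0]
  proof (rule SUP_least)
    fix t assume t: "t \<in> T"
    have "(\<Sum>k. f t (0 + 1 + k)) \<le> (\<Sum>k<n. f t (0 + 1 + k)) + (\<Sum>k. f t (0 + 1 + (n + k)))"
      by (rule suminf_le_split_ennreal)
    also have "\<dots> = (\<Sum>k<n. f t (0 + 1 + k)) + (\<Sum>k. f t (n + 1 + k))" by simp
    also have "\<dots> \<le> (\<Sum>k<n. B (0 + 1 + k)) + chain_tail T \<P> \<mu> a v n"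
      unfolding B_def chain_tail_eq f_def using t by (intro add_mono sum_mono SUP_upper)
    finally show "(\<Sum>k. chain_term \<P> \<mu> a v t (0 + 1 + k)) \<le> (\<Sum>k<n. B (0 + 1 + k)) + chain_tail T \<P> \<mu> a v n"
      unfolding f_def .
  qed
  also have "\<dots> < \<infinity>" using B_fin H by simp
  finally show ?thesis .
qed

lemma L2norm_le_imp:
  assumes "L2norm M Y \<le> r"
  shows "(LINT \<omega>|M. (Y \<omega>)\<^sup>2) \<le> r\<^sup>2"
  using assms unfolding L2norm_def by (rule sqrt_le_D)

lemma (in prob_space) gaussian_family_of_process:
  assumes X: "centered_gaussian_process M T X" and F: "finite F" "F \<subseteq> T"
  shows "gaussian_family M F X"
proof -
  have G: "gaussian_rv M (\<lambda>\<omega>. \<Sum>t\<in>F'. c t * X t \<omega>)" if "finite F'" "F' \<subseteq> T" for F' c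
    using X that unfolding centered_gaussian_process_def gaussian_process_def by blast
  have int: "integrable M (X t)" if "t \<in> T" for t
  proof -
    have "gaussian_rv M (X t)" using G[of "{t}" "\<lambda>_. 1"] that by simp
    moreover have "expectation (X t) = 0" using X that by (simp add: centered_gaussian_process_def)
    ultimately have cn: "centered_normal M (X t)" by (rule centered_normal_of_gaussian_rv)
    show ?thesis
      by (rule square_integrable_imp_integrable[OF centered_normal_measurable[OF cn] centered_normal_square_integrable[OF cn]])
  qed
  have "centered_normal M (\<lambda>\<omega>. \<Sum>t\<in>F. u t * X t \<omega>)" for u
  proof (rule centered_normal_of_gaussian_rv[OF G[OF F]])
    have "expectation (\<lambda>\<omega>. \<Sum>t\<in>F. u t * X t \<omega>) = (\<Sum>t\<in>F. u t * expectation (X t))"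
      using int F by (subst Bochner_Integration.integral_sum) auto
    also have "\<dots> = 0"
      using X F by (intro sum.neutral) (auto simp: centered_gaussian_process_def)
    finally show "expectation (\<lambda>\<omega>. \<Sum>t\<in>F. u t * X t \<omega>) = 0" .
  qed
  then show ?thesis by (simp add: gaussian_family_def)
qed

text \<open>Chaining is used for small \<epsilon>, where \<open>n \<epsilon>\<close> lies beyond any
  level fixed in advance. For larger \<epsilon> the event contains the one for a fixed small value,
  and the constant has to absorb the right-hand side. Up to \<epsilon> = 1 the power of \<epsilon>
  is at most 1; beyond, it is bounded because \<epsilon> * \<sigma> stays below the finite
  \<open>H 0\<close> and \<open>n\<close> is bounded there.\<close>

theorem theorem3p1:
  fixes M :: "'w measure" and T :: "'t set" and X :: "'t \<Rightarrow> 'w \<Rightarrow> real"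
    and \<P> :: "nat \<Rightarrow> 't set set" and \<mu> :: "'t measure"
    and v :: "nat \<Rightarrow> real" and n :: "real \<Rightarrow> nat"
    and D \<sigma> :: real and H :: "nat \<Rightarrow> ennreal"
  defines "D \<equiv> proc_diam M T X"
    and "\<sigma> \<equiv> proc_sigma M T X"
    and "H \<equiv> chain_tail T \<P> \<mu> D v"
  assumes "prob_space M"
    and "centered_gaussian_process M T X"
    and "bdd_above ((\<lambda>t. L2norm M (X t)) ` T)"
    and "d_separable M T X"
    and "prob_space \<mu>" and "space \<mu> = T"
    and "\<And>k. partition_on T (\<P> k)"
    and "\<And>k. finite (\<P> k)"
    and "\<And>k. \<P> k \<subseteq> sets \<mu>"
    and "\<And>k. refines T (\<P> (Suc k)) (\<P> k)"
    and "\<And>k A u w. A \<in> \<P> k \<Longrightarrow> u \<in> A \<Longrightarrow> w \<in> A \<Longrightarrow> proc_dist M X u w \<le> (1 / 2) ^ k * D"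
    and "chain_tail T \<P> \<mu> 1 (\<lambda>_. 1) \<longlonglongrightarrow> 0"
    and "\<And>m. 0 < v m"
    and "summable (\<lambda>m. 1 / v m)"
    and "\<And>\<epsilon>. 0 < \<epsilon> * \<sigma> \<Longrightarrow> ennreal (\<epsilon> * \<sigma>) < H 0 \<Longrightarrow> H (n \<epsilon>) \<le> ennreal (\<epsilon> * \<sigma>)"
    and "bdd_above (n ` {\<epsilon>. 1 < \<epsilon> \<and> 0 < \<epsilon> * \<sigma> \<and> ennreal (\<epsilon> * \<sigma>) < H 0})"
  shows "\<exists>C>0. \<forall>\<epsilon>. 0 < \<epsilon> * \<sigma> \<and> ennreal (\<epsilon> * \<sigma>) < H 0 \<longrightarrow>
           measure (completion M)
             {\<omega> \<in> space M. (SUP t\<in>T. ereal \<bar>X t \<omega>\<bar>) \<le> ereal (2 * \<epsilon> * \<sigma>)}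
           \<ge> C * exp (- (real (card (\<P> (n \<epsilon>))) * ln (1 / \<epsilon>)))"
proof (cases "\<exists>\<epsilon>. 0 < \<epsilon> * \<sigma> \<and> ennreal (\<epsilon> * \<sigma>) < H 0")
  case False
  then show ?thesis by (intro exI[of _ 1]) auto
next
  case True
  then obtain \<epsilon>' where \<epsilon>': "0 < \<epsilon>' * \<sigma>" "ennreal (\<epsilon>' * \<sigma>) < H 0" by blast
  interpret prob_space M by fact
  interpret \<mu>: prob_space \<mu> by fact
  note part = assms(10) and finP = assms(11) and Psets = assms(12) and ref = assms(13)
    and cell = assms(14) and vpos = assms(16) and n_eps = assms(18) and n_bdd = assms(19)
  obtain t0 where t0: "t0 \<in> T" using \<mu>.not_empty assms(9) by auto
  have D0: "0 \<le> D"
  proof -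
    have "proc_dist M X t0 t0 \<le> (1 / 2) ^ 0 * D"
      using part_at_mem[OF part t0, of 0] by (intro cell[of "part_at (\<P> 0) t0"]) auto
    then show ?thesis by (simp add: proc_dist_def L2norm_def)
  qed
  \<comment> \<open>A zero diameter would make every term of \<open>H 0\<close>, and hence the range
    of admissible \<epsilon>, trivial.\<close>
  have "D \<noteq> 0"
  proof
    assume "D = 0"
    then have "H 0 = (SUP t\<in>T. 0)" by (simp add: H_def chain_tail_def Let_def)
    also have "\<dots> = 0" by (intro antisym SUP_least) auto
    finally show False using \<epsilon>' by simp
  qed
  with D0 have D: "0 < D" by simp
  have \<sigma>_ge: "L2norm M (X t) \<le> \<sigma>" if "t \<in> T" for t
    unfolding \<sigma>_def proc_sigma_def using assms(6) that by (rule cSUP_upper2) auto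
  have "0 \<le> \<sigma>" using order_trans[OF _ \<sigma>_ge[OF t0], of 0] by (simp add: L2norm_def)
  with \<epsilon>' have \<sigma>: "0 < \<sigma>" by (cases "\<sigma> = 0") auto
  have Hfin: "H (n \<epsilon>') < \<infinity>" using n_eps[OF \<epsilon>'] by (auto intro: le_less_trans)
  have \<mu>f: "finite_measure \<mu>" by unfold_locales
  have \<mu>pos: "0 < measure \<mu> (part_at (\<P> m) t)" if "t \<in> T" for t m
    using chain_tail_finite_imp_pos[where \<P> = \<P>, OF \<mu>f Psets ref D Hfin[unfolded H_def] that] .
  have H0fin: "H 0 < \<infinity>"
    using chain_tail_0_finite[where \<P> = \<P>, OF \<mu>f Psets ref finP D Hfin[unfolded H_def]] by (simp add: H_def)
  have Hanti: "H m' \<le> H m" if "m \<le> m'" for m m'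
    unfolding H_def by (rule chain_tail_antimono[OF that])
  \<comment> \<open>From \<open>n0\<close> on, tails of the series stay below 1/4. This gives both
    the bound \<open>psum\<close> on the total failure and \<open>4 \<le> v m\<close>, which makes
    each failure parameter at most 1/2 and each logarithm nonnegative.\<close>
  obtain n0 where n0: "\<And>i m. n0 \<le> i \<Longrightarrow> norm (\<Sum>k=i..m. 1 / v k) < 1/4"
    using summable_partial_sum_bound[OF assms(17), of "1/4"] by auto
  have v4: "4 \<le> v m" if "n0 \<le> m" for m
    using n0[OF that, of m] vpos[of m] by (simp add: field_simps)
  \<comment> \<open>The number 108 is 12 * 3 * 3: the part \<epsilon> * \<sigma> / 12 of the budget,
    the factor 3 in the length of a link to a designated centre, and the 1/3 of the small ball
    bound. With this \<open>k\<close> such a link costs at most \<epsilon>.\<close>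
  obtain k where k: "108 * D / \<sigma> < 2 ^ k" using real_arch_pow[of 2] by auto
  define N0 where "N0 = max n0 k"
  \<comment> \<open>Positivity leaves room for \<epsilon> with \<epsilon> * \<sigma> < H(N0); for
    these, monotonicity of \<open>H\<close> forces \<open>n \<epsilon>\<close> beyond
    \<open>N0\<close>.\<close>
  have HN0: "0 < H N0"
  proof -
    have "4 \<le> v (Suc N0)" by (rule v4) (simp add: N0_def)
    moreover have "measure \<mu> (part_at (\<P> (Suc N0)) t0) \<le> 1" by simp
    ultimately have "measure \<mu> (part_at (\<P> (Suc N0)) t0) < v (Suc N0)" by linarith
    then have "1 < v (Suc N0) / measure \<mu> (part_at (\<P> (Suc N0)) t0)"
      using \<mu>pos[OF t0, of "Suc N0"] by (simp add: field_simps)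
    then have "0 < chain_term \<P> \<mu> D v t0 (Suc N0)"
      using D \<mu>pos[OF t0, of "Suc N0"] by (simp add: chain_term_def sqrt_log_def ennreal_zero_less_mult_iff)
    also have "\<dots> \<le> H N0" unfolding H_def by (rule chain_term_le_tail[OF t0]) simp
    finally show ?thesis .
  qed
  define s0 where "s0 = sqrt (2 * \<sigma>\<^sup>2 + D\<^sup>2)"
  have s0: "0 < s0" "s0\<^sup>2 = 2 * \<sigma>\<^sup>2 + D\<^sup>2" using D \<sigma> by (auto simp: s0_def add_pos_pos)
  \<comment> \<open>The number 36 is 12 * 3, from the share \<epsilon> * \<sigma> / 12 and the 1/3
    of the small ball bound, so that a designated centre costs
    \<open>\<kappa> * \<epsilon>\<close>.\<close>
  define \<kappa> where "\<kappa> = min 1 (\<sigma> / (36 * s0))"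
  have \<kappa>: "0 < \<kappa>" "\<kappa> \<le> 1" using \<sigma> s0 by (auto simp: \<kappa>_def)
  define P where "P \<epsilon> = measure (completion M) {\<omega> \<in> space M. (SUP t\<in>T. ereal \<bar>X t \<omega>\<bar>) \<le> ereal (2 * \<epsilon> * \<sigma>)}" for \<epsilon>
  define C1 where "C1 = \<kappa> ^ card (\<P> k) / 4"
  have C1: "0 < C1" using \<kappa> by (simp add: C1_def)
  have Xm: "X t \<in> borel_measurable M" if "t \<in> T" for t
  proof -
    have "gaussian_family M {t} X" by (rule gaussian_family_of_process[OF assms(5)]) (use that in auto)
    then show ?thesis by (intro centered_normal_measurable gaussian_family_component[of M "{t}"]) auto
  qed
  have small_fin: "C1 * \<epsilon> ^ card (\<P> (n \<epsilon>)) \<le> prob {\<omega>\<in>space M. \<forall>t\<in>F. \<bar>X t \<omega>\<bar> \<le> 2 * \<epsilon> * \<sigma>}"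
    if \<epsilon>: "0 < \<epsilon>" "\<epsilon> \<le> 1/3" and HN: "ennreal (\<epsilon> * \<sigma>) < H N0" and F: "finite F" "F \<subseteq> T" for \<epsilon> F
  proof -
    have \<eta>: "0 < \<epsilon> * \<sigma>" using \<epsilon> \<sigma> by simp
    have "ennreal (\<epsilon> * \<sigma>) < H 0" using HN Hanti[of 0 N0] by (rule less_le_trans) simp
    then have Hn: "H (n \<epsilon>) \<le> ennreal (\<epsilon> * \<sigma>)" using n_eps \<eta> by blast
    have nN0: "N0 < n \<epsilon>"
    proof (rule ccontr)
      assume "\<not> N0 < n \<epsilon>"
      then have "H N0 \<le> H (n \<epsilon>)" by (intro Hanti) simp
      with Hn HN show False by (metis leD order_trans)
    qed
    define \<pi> where "\<pi> m t = part_at (\<P> m) t" for m t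
    have \<pi>eq: "t \<in> \<pi> m s" if "t \<in> T" "\<pi> m s = \<pi> m t" for m s t
      using part_at_mem(2)[OF part that(1)] that(2) by (simp add: \<pi>_def)
      have \<pi>sub: "\<pi> m ` F \<subseteq> \<P> m" for m
        using part_at_mem(1)[OF part] F by (auto simp: \<pi>_def)
      have "\<kappa> ^ card (\<pi> k ` F) * \<epsilon> ^ card (\<pi> (n \<epsilon>) ` F) / 4 \<le> prob {\<omega>\<in>space M. \<forall>t\<in>F. \<bar>X t \<omega>\<bar> \<le> 2 * (\<epsilon> * \<sigma>)}"
      \<comment> \<open>The failure parameter \<mu>(A) / v(m) turns \<open>sqrt (ln (1 / p))\<close>
        into the summand of \<open>H\<close>, and disjointness of the cells bounds its sum over a
        level by 1 / v(m).\<close>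
      proof (rule gaussian_small_ball_finite[where D = D and ?s0.0 = s0 and p = "\<lambda>m A. measure \<mu> A / v m"])
        show "finite F" by fact
        show "gaussian_family M F X" by (rule gaussian_family_of_process[OF assms(5) F])
        fix s t assume st: "s \<in> F" "t \<in> F"
        then have stT: "s \<in> T" "t \<in> T" using F by auto
        { fix m assume "\<pi> (Suc m) s = \<pi> (Suc m) t"
          then have "t \<in> part_at (\<P> (Suc m)) s" using \<pi>eq[OF stT(2)] by (simp add: \<pi>_def)
          then have "t \<in> part_at (\<P> m) s" using part_at_refines[OF ref stT(1)] by blast
          then show "\<pi> m s = \<pi> m t"
            unfolding \<pi>_def using part_at_eq[OF part part_at_mem(1)[OF part stT(1)]] by simp }
        { fix m assume "\<pi> m s = \<pi> m t"
          then have "t \<in> part_at (\<P> m) s" using \<pi>eq[OF stT(2)] by (simp add: \<pi>_def)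
          then have "proc_dist M X s t \<le> (1/2)^m * D"
            using part_at_mem[OF part stT(1)] by (intro cell)
          then show "expectation (\<lambda>\<omega>. (X s \<omega> - X t \<omega>)\<^sup>2) \<le> ((1/2)^m * D)\<^sup>2"
            unfolding proc_dist_def by (rule L2norm_le_imp) }
      next
        show "2 * expectation (\<lambda>\<omega>. (X t \<omega>)\<^sup>2) + D\<^sup>2 \<le> s0\<^sup>2" if "t \<in> F" for t
          using L2norm_le_imp[OF \<sigma>_ge[of t]] that F by (auto simp: s0)
        show "0 < D" "0 < \<epsilon> * \<sigma>" "0 < s0" "0 < \<kappa>" "\<kappa> \<le> 1" "0 < \<epsilon>" "\<epsilon> \<le> 1" by (use D \<eta> s0 \<kappa> \<epsilon> in auto)
        show "k \<le> n \<epsilon>" using nN0 by (simp add: N0_def)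
        show "\<kappa> * \<epsilon> \<le> min 1 (\<epsilon> * \<sigma> / 12 / s0) / 3"
        proof -
          have "\<kappa> * \<epsilon> \<le> 1 * (1/3)" using \<kappa> \<epsilon> by (intro mult_mono) auto
          moreover have "\<kappa> * \<epsilon> \<le> \<sigma> / (36 * s0) * \<epsilon>" using \<epsilon> by (intro mult_right_mono) (auto simp: \<kappa>_def)
          ultimately show ?thesis by (simp add: min_def field_simps)
        qed
        show "\<epsilon> \<le> min 1 (\<epsilon> * \<sigma> / 12 / (3 * ((1/2)^k * D))) / 3"
        proof -
          have "108 * D \<le> \<sigma> * 2 ^ k" using k \<sigma> by (simp add: field_simps)
          then have "1 \<le> \<sigma> * 2 ^ k / (108 * D)" using D by (simp add: field_simps)
          then have "\<epsilon> * 1 \<le> \<epsilon> * (\<sigma> * 2 ^ k / (108 * D))" using \<epsilon> by (intro mult_left_mono) auto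
          also have "\<dots> = \<epsilon> * \<sigma> / 12 / (3 * ((1/2)^k * D)) / 3" using D by (simp add: power_divide field_simps)
          finally have "\<epsilon> \<le> \<epsilon> * \<sigma> / 12 / (3 * ((1/2)^k * D)) / 3" by simp
          then show ?thesis using \<epsilon> by (auto simp: min_def)
        qed
      next
        fix m t assume m: "n \<epsilon> < m" and t: "t \<in> F"
        have v: "4 \<le> v m" using m nN0 by (intro v4) (simp add: N0_def)
        show "0 < measure \<mu> (\<pi> m t) / v m" using \<mu>pos[of t m] t F vpos[of m] by (auto simp: \<pi>_def)
        have "measure \<mu> (\<pi> m t) \<le> 1" by simp
        also have "1 \<le> 1/2 * v m" using v by simp
        finally show "measure \<mu> (\<pi> m t) / v m \<le> 1/2" using vpos[of m] by (simp add: field_simps)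
      next
        fix m'
        have "(\<Sum>m\<in>{n \<epsilon><..m'}. \<Sum>A\<in>\<pi> m ` F. measure \<mu> A / v m) \<le> (\<Sum>m\<in>{n \<epsilon><..m'}. 1 / v m)"
        proof (rule sum_mono)
          fix m
          have "(\<Sum>A\<in>\<pi> m ` F. measure \<mu> A) = measure \<mu> (\<Union>A\<in>\<pi> m ` F. A)"
          proof (rule \<mu>.finite_measure_finite_Union[symmetric])
            show "disjoint_family_on (\<lambda>A. A) (\<pi> m ` F)"
              unfolding disjoint_family_on_def
              using disjointD[OF partition_onD2[OF part[of m]]] subsetD[OF \<pi>sub[of m]] by blast
            show "(\<lambda>A. A) ` \<pi> m ` F \<subseteq> sets \<mu>" using \<pi>sub[of m] Psets[of m] by simp
          qed (use F in simp)
          also have "\<dots> \<le> 1" by simp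
          finally show "(\<Sum>A\<in>\<pi> m ` F. measure \<mu> A / v m) \<le> 1 / v m"
            using vpos[of m] by (simp add: sum_divide_distrib[symmetric] divide_right_mono)
        qed
        also have "\<dots> = (\<Sum>m=Suc (n \<epsilon>)..m'. 1 / v m)" by (intro sum.cong) auto
        also have "\<dots> \<le> 1/4" using n0[of "Suc (n \<epsilon>)" m'] nN0 by (simp add: N0_def)
        finally show "(\<Sum>m\<in>{n \<epsilon><..m'}. \<Sum>A\<in>\<pi> m ` F. measure \<mu> A / v m) \<le> 1/4" .
      next
        fix m' t assume t: "t \<in> F"
        then have tT: "t \<in> T" using F by auto
        have ct: "chain_term \<P> \<mu> D v t m = ennreal ((1/2)^m * D * sqrt (ln (1 / (measure \<mu> (\<pi> m t) / v m))))"
          "0 \<le> (1/2)^m * D * sqrt (ln (1 / (measure \<mu> (\<pi> m t) / v m)))" if "m \<in> {n \<epsilon><..m'}" for m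
        proof -
          have "4 \<le> v m" using that nN0 by (intro v4) (simp add: N0_def)
          moreover have "measure \<mu> (\<pi> m t) \<le> 1" by simp
          ultimately have le: "measure \<mu> (\<pi> m t) \<le> v m" by linarith
          have pos: "0 < measure \<mu> (\<pi> m t)" using \<mu>pos[OF tT] by (simp add: \<pi>_def)
          then have "0 \<le> ln (v m / measure \<mu> (\<pi> m t))" using le by (intro ln_ge_zero) (simp add: field_simps)
          then show "chain_term \<P> \<mu> D v t m = ennreal ((1/2)^m * D * sqrt (ln (1 / (measure \<mu> (\<pi> m t) / v m))))"
            "0 \<le> (1/2)^m * D * sqrt (ln (1 / (measure \<mu> (\<pi> m t) / v m)))"
            using D pos by (auto simp: chain_term_def sqrt_log_def \<pi>_def ennreal_mult[symmetric])
        qed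
        have "ennreal (\<Sum>m\<in>{n \<epsilon><..m'}. (1/2)^m * D * sqrt (ln (1 / (measure \<mu> (\<pi> m t) / v m))))
            = (\<Sum>m\<in>{n \<epsilon><..m'}. chain_term \<P> \<mu> D v t m)"
          using ct by (subst sum_ennreal[symmetric]) (auto intro: sum.cong)
        also have "\<dots> \<le> H (n \<epsilon>)" unfolding H_def by (rule chain_tail_ge_sum[OF tT])
        also note Hn
        finally show "(\<Sum>m\<in>{n \<epsilon><..m'}. (1/2)^m * D * sqrt (ln (1 / (measure \<mu> (\<pi> m t) / v m)))) \<le> \<epsilon> * \<sigma>"
          using \<eta> by (simp add: ennreal_le_iff)
      qed
      moreover have "C1 * \<epsilon> ^ card (\<P> (n \<epsilon>)) \<le> \<kappa> ^ card (\<pi> k ` F) * \<epsilon> ^ card (\<pi> (n \<epsilon>) ` F) / 4"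
      proof -
        have "\<kappa> ^ card (\<P> k) * \<epsilon> ^ card (\<P> (n \<epsilon>)) \<le> \<kappa> ^ card (\<pi> k ` F) * \<epsilon> ^ card (\<pi> (n \<epsilon>) ` F)"
          using \<kappa> \<epsilon> card_mono[OF finP \<pi>sub] by (intro mult_mono power_decreasing) auto
        then show ?thesis by (simp add: C1_def)
      qed
      ultimately show ?thesis by (simp add: mult.assoc)
  qed
  obtain z where z: "0 < z" "z < H N0" using HN0 dense by blast
  then obtain r where r: "0 < r" "z = ennreal r"
    by (cases z) (auto simp: less_top[symmetric])
  \<comment> \<open>The bound 1/3 is what the truncation at 1 in the small ball estimates allows;
    the bound \<open>r / \<sigma>\<close> keeps \<epsilon> * \<sigma> below
    \<open>H N0\<close>.\<close>
  define \<epsilon>1 where "\<epsilon>1 = min (1/3) (r / \<sigma>)"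
  have \<epsilon>1: "0 < \<epsilon>1" "\<epsilon>1 \<le> 1/3" "\<epsilon>1 * \<sigma> \<le> r" using r \<sigma> by (auto simp: \<epsilon>1_def min_def field_simps)
  have HN1: "ennreal (\<epsilon> * \<sigma>) < H N0" if "\<epsilon> \<le> \<epsilon>1" for \<epsilon>
  proof -
    have "\<epsilon> * \<sigma> \<le> \<epsilon>1 * \<sigma>" using that \<sigma> by simp
    then have "ennreal (\<epsilon> * \<sigma>) \<le> ennreal r" using \<epsilon>1 by (intro ennreal_leI) simp
    also have "\<dots> < H N0" using z(2) r(2) by simp
    finally show ?thesis .
  qed
  define p0 where "p0 = C1 * \<epsilon>1 ^ card (\<P> (n \<epsilon>1))"
  have p0: "0 < p0" using C1 \<epsilon>1 by (simp add: p0_def)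
  have small: "C1 * \<epsilon> ^ card (\<P> (n \<epsilon>)) \<le> P \<epsilon>" if "0 < \<epsilon>" "\<epsilon> \<le> \<epsilon>1" for \<epsilon>
    unfolding P_def
  proof (rule d_separable_sup_prob_ge[OF assms(7) Xm])
    show "C1 * \<epsilon> ^ card (\<P> (n \<epsilon>)) \<le> prob {\<omega>\<in>space M. \<forall>t\<in>F. \<bar>X t \<omega>\<bar> \<le> 2 * \<epsilon> * \<sigma>}" if "finite F" "F \<subseteq> T" for F
      using \<open>0 < \<epsilon>\<close> \<open>\<epsilon> \<le> \<epsilon>1\<close> \<epsilon>1 that by (intro small_fin HN1) auto
  qed
  have large: "p0 \<le> P \<epsilon>" if "\<epsilon>1 \<le> \<epsilon>" for \<epsilon>
    unfolding P_def
  proof (rule d_separable_sup_prob_ge[OF assms(7) Xm])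
    fix F assume F: "finite F" "F \<subseteq> T"
    have "p0 \<le> prob {\<omega>\<in>space M. \<forall>t\<in>F. \<bar>X t \<omega>\<bar> \<le> 2 * \<epsilon>1 * \<sigma>}"
      unfolding p0_def using \<epsilon>1 F by (intro small_fin HN1) auto
    also have "\<dots> \<le> prob {\<omega>\<in>space M. \<forall>t\<in>F. \<bar>X t \<omega>\<bar> \<le> 2 * \<epsilon> * \<sigma>}"
    proof (rule finite_measure_mono)
      have "2 * \<epsilon>1 * \<sigma> \<le> 2 * \<epsilon> * \<sigma>" using that \<sigma> by simp
      then show "{\<omega>\<in>space M. \<forall>t\<in>F. \<bar>X t \<omega>\<bar> \<le> 2 * \<epsilon>1 * \<sigma>} \<subseteq> {\<omega>\<in>space M. \<forall>t\<in>F. \<bar>X t \<omega>\<bar> \<le> 2 * \<epsilon> * \<sigma>}"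
        by (auto intro: order_trans)
      show "{\<omega>\<in>space M. \<forall>t\<in>F. \<bar>X t \<omega>\<bar> \<le> 2 * \<epsilon> * \<sigma>} \<in> events"
      proof (rule sets.sets_Collect_finite_All[OF _ F(1)])
        fix t assume "t \<in> F"
        then have [measurable]: "X t \<in> borel_measurable M" using F by (intro Xm) auto
        show "{\<omega>\<in>space M. \<bar>X t \<omega>\<bar> \<le> 2 * \<epsilon> * \<sigma>} \<in> events" by measurable
      qed
    qed
    finally show "p0 \<le> prob {\<omega>\<in>space M. \<forall>t\<in>F. \<bar>X t \<omega>\<bar> \<le> 2 * \<epsilon> * \<sigma>}" .
  qed
  obtain h where h: "0 \<le> h" "H 0 = ennreal h"
    using H0fin by (cases "H 0") auto
  obtain nB where nB: "\<And>\<epsilon>. 1 < \<epsilon> \<Longrightarrow> 0 < \<epsilon> * \<sigma> \<Longrightarrow> ennreal (\<epsilon> * \<sigma>) < H 0 \<Longrightarrow> n \<epsilon> \<le> nB"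
    using n_bdd by (auto simp: bdd_above_def)
  define E where "E = max 1 (h / \<sigma>)"
  \<comment> \<open>The sum of the numbers of cells up to level \<open>nB\<close> dominates the
    exponent for every admissible \<epsilon> > 1, whichever level \<open>n \<epsilon>\<close> is.
    Together with \<open>\<epsilon> \<le> E\<close> it bounds the growing power by
    \<open>E ^ K\<close>.\<close>
  define K where "K = (\<Sum>j\<le>nB. card (\<P> j))"
  define C where "C = min C1 (p0 / E ^ K)"
  have E1: "1 \<le> E" by (simp add: E_def)
  then have EK: "1 \<le> E ^ K" by (rule one_le_power)
  have C: "0 < C" "C \<le> C1" using C1 p0 E1 by (auto simp: C_def)
  have "C \<le> p0 / E ^ K" by (simp add: C_def)
  then have CE: "C * E ^ K \<le> p0" using EK by (simp add: pos_le_divide_eq)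
  have "C * 1 \<le> C * E ^ K" using C EK by (intro mult_left_mono) auto
  with CE have Cp0: "C \<le> p0" by linarith
  have "C * \<epsilon> ^ card (\<P> (n \<epsilon>)) \<le> P \<epsilon>" if \<epsilon>: "0 < \<epsilon> * \<sigma>" "ennreal (\<epsilon> * \<sigma>) < H 0" for \<epsilon>
  proof -
    have pos: "0 < \<epsilon>" using \<epsilon>(1) \<sigma> by (simp add: zero_less_mult_iff)
    consider "\<epsilon> \<le> \<epsilon>1" | "\<epsilon>1 \<le> \<epsilon>" "\<epsilon> \<le> 1" | "\<epsilon>1 \<le> \<epsilon>" "1 < \<epsilon>" by linarith
    then show ?thesis
    proof cases
      case 1
      have "C * \<epsilon> ^ card (\<P> (n \<epsilon>)) \<le> C1 * \<epsilon> ^ card (\<P> (n \<epsilon>))" using C pos by (intro mult_right_mono) auto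
      with small[OF pos 1] show ?thesis by simp
    next
      case 2
      have "C * \<epsilon> ^ card (\<P> (n \<epsilon>)) \<le> C * 1" using C pos 2 by (intro mult_left_mono power_le_one) auto
      with large[OF 2(1)] Cp0 show ?thesis by simp
    next
      case 3
      have "\<epsilon> * \<sigma> < h" using \<epsilon> h by (simp add: ennreal_less_iff)
      then have "\<epsilon> \<le> E" using \<sigma> by (simp add: E_def pos_le_divide_eq le_max_iff_disj)
      then have "\<epsilon> ^ card (\<P> (n \<epsilon>)) \<le> E ^ card (\<P> (n \<epsilon>))" using pos by (intro power_mono) auto
      also have "\<dots> \<le> E ^ K"
        using nB[OF 3(2) \<epsilon>] E1 by (intro power_increasing) (auto simp: K_def intro: member_le_sum)
      finally have "C * \<epsilon> ^ card (\<P> (n \<epsilon>)) \<le> C * E ^ K" using C by (intro mult_left_mono) auto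
      with CE large[OF 3(1)] show ?thesis by simp
    qed
  qed
  moreover have "exp (- (real N * ln (1 / \<epsilon>))) = \<epsilon> ^ N" if "0 < \<epsilon> * \<sigma>" for \<epsilon> N
  proof -
    have pos: "0 < \<epsilon>" using that \<sigma> by (simp add: zero_less_mult_iff)
    then have "- (real N * ln (1 / \<epsilon>)) = real N * ln \<epsilon>" by (simp add: ln_div)
    then show ?thesis using pos by (simp add: exp_of_nat_mult)
  qed
  ultimately show ?thesis
    using C by (intro exI[of _ C]) (simp add: P_def)
qed

end
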